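(* Let $\mathcal{X},\mathcal{Y}$ be complete interpolating sequences for $PW_\pi$. If $(\phi_\alpha)_{\alpha\in A}$ is a family of regular interpolators for $PW_\pi$ and $\psi$ satisfies (A1) and (A2) with $\operatorname{supp}(\widehat\psi)=\mathbb{T}$, then $(\phi_\alpha)_{\alpha\in A}$ satisfies (B1)--(B4). In particular, for every $f\in V(\psi,\mathcal{X})$, the interpolants $I_{\phi_\alpha}^{\mathcal{Y}}f$ converge to $f$ as $\alpha\to\infty$ both in $L_2(\mathbb{R})$ and uniformly on $\mathbb{R}$.
   Context: Fourier transform: $\widehat f(\xi)=\frac{1}{\sqrt{2\pi}}\int_{\mathbb{R}}f(x)e^{-i\xi x}\,dx$. $\mathbb{T}=[-\pi,\pi)$. $\|g\|_{W(L_\infty,\ell_1)}:=\sum_{k}\|g(\cdot+2\pi k)\|_{L_\infty(\mathbb{T})}$. $PW_\pi=\{f\in L_2(\mathbb{R}):\widehat f=0\text{ a.e. outside }[-\pi,\pi]\}$. A sequence $\mathcal{X}=(x_j)\subset\mathbb{R}$ is a complete interpolating sequence (CIS) for $PW_\pi$ if for every $(c_j)\in\ell_2$ there is a unique $f\in PW_\pi$ with $f(x_j)=c_j$; equivalently $(e^{-ix_j\cdot})_j$ is a Riesz basis of $L_2(\mathbb{T})$. A function $\phi$ satisfies (A1) if $\phi\in L_2(\mathbb{R})$ is positive definite; (A2) if $\widehat\phi\in W(L_\infty,\ell_1)$, $\delta_\phi:=\inf_{\xi\in\mathbb{T}}|\widehat\phi(\xi)|>0$ and $C_\phi:=\delta_\phi^{-1}\sum_{j\neq0}\|\widehat\phi(\cdot+2\pi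 j)\|_{L_\infty(\mathbb{T})}<\infty$. $V(\phi,\mathcal{Y})$ is the $L_2(\mathbb{R})$-closure of the span of $\{\phi(\cdot-y_j)\}$; $I_{\phi}^{\mathcal{Y}}f$ is the unique $\sum_ja_j\phi(\cdot-y_j)$, $(a_j)\in\ell_2$, with $I_\phi^{\mathcal{Y}}f(y_k)=f(y_k)$ for all $k$. Prolongation: for a CIS $\mathcal{X}$ and $h=\sum_jc_je^{-ix_j\cdot}\in L_2(\mathbb{T})$, $E_{\mathcal{X}}h(t)=\sum_jc_je^{-ix_jt}$ ($t\in\mathbb{R}$), $A_{\mathcal{X}}^kh(t)=E_{\mathcal{X}}h(t+2\pi k)$ ($t\in\mathbb{T}$). Operators on $L_2(\mathbb{T})$: $M_\phi g=\delta_\phi g/\widehat\phi$; $T_{\phi,k}g=\delta_\phi^{-1}\widehat\phi(\cdot+2\pi k)g$. A family $(\phi_\alpha)_{\alpha\in A}$ is indexed by $A\subseteq\mathbb{R}$ unbounded above; conditions: (B1) each $\phi_\alpha$ satisfies (A1),(A2); (B2) $\sup_\alpha C_{\phi_\alpha}<\infty$; (B3) $\lim_{\alpha\to\infty}\sum_{k\neq0}\|T_{\psi,k}A_{\mathcal{X}}^k(M_\psi-M_{\phi_\alpha})g\|_{L_2(\mathbb{T})}=0$ for every $g\in L_2(\mathbb{T})$; (B4) $\lim_{\alpha\to\infty}\sum_{k\neq0}\|(T_{\phi_\alpha,k}A_{\mathcal{Y}}^k-T_{\psi,k}A_{\mathcal{X}}^k)M_{\phi_\alpha}g\|_{L_2(\mathbb{T})}=0$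 for every $g\in L_2(\mathbb{T})$. The family is a family of regular interpolators for $PW_\pi$ if it satisfies (B1), (B2) and $\lim_{\alpha\to\infty}\delta_{\phi_\alpha}/\widehat{\phi_\alpha}(\xi)=0$ for a.e. $\xi\in\mathbb{T}$. *)

theory Defs
  imports "HOL-Analysis.Analysis"
begin

definition TT :: "real set" where
  "TT = {-pi..<pi}"

definition L2R :: "(real \<Rightarrow> complex) \<Rightarrow> bool" where
  "L2R f \<longleftrightarrow> f \<in> borel_measurable lborel \<and> integrable lborel (\<lambda>x. (cmod (f x))\<^sup>2)"

definition normR :: "(real \<Rightarrow> complex) \<Rightarrow> real" where
  "normR f = sqrt (LINT x|lborel. (cmod (f x))\<^sup>2)"

definition L2T :: "(real \<Rightarrow> complex) \<Rightarrow> bool" where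
  "L2T g \<longleftrightarrow> set_borel_measurable lborel TT g \<and> set_integrable lborel TT (\<lambda>t. (cmod (g t))\<^sup>2)"

definition normT :: "(real \<Rightarrow> complex) \<Rightarrow> real" where
  "normT g = sqrt (LINT t:TT|lborel. (cmod (g t))\<^sup>2)"

definition l2 :: "(int \<Rightarrow> complex) \<Rightarrow> bool" where
  "l2 c \<longleftrightarrow> (\<lambda>j. (cmod (c j))\<^sup>2) summable_on UNIV"

definition ft_trunc :: "(real \<Rightarrow> complex) \<Rightarrow> real \<Rightarrow> real \<Rightarrow> complex" where
  "ft_trunc f R \<xi> = complex_of_real (1 / sqrt (2 * pi)) * (LINT x:{-R..R}|lborel. f x * cis (- (\<xi> * x)))"

text \<open>F is (a representative of) the L2 Fourier transform of f (Plancherel: L2 limit of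
  the truncated Fourier integrals).\<close>
definition fourier_rel :: "(real \<Rightarrow> complex) \<Rightarrow> (real \<Rightarrow> complex) \<Rightarrow> bool" where
  "fourier_rel f F \<longleftrightarrow> L2R f \<and> L2R F \<and>
     ((\<lambda>R. normR (\<lambda>\<xi>. ft_trunc f R \<xi> - F \<xi>)) \<longlongrightarrow> 0) at_top"

text \<open>Paley--Wiener space, elements taken as their continuous representatives.\<close>
definition PW :: "(real \<Rightarrow> complex) set" where
  "PW = {f. continuous_on UNIV f \<and> L2R f \<and>
            (\<exists>F. fourier_rel f F \<and> (AE \<xi> in lborel. \<xi> \<notin> {-pi..pi} \<longrightarrow> F \<xi> = 0))}"

definition CIS :: "(int \<Rightarrow> real) \<Rightarrow> bool" where
  "CIS x \<longleftrightarrow> (\<forall>c. l2 c \<longrightarrow> (\<exists>!f. f \<in> PW \<and> (\<forall>j. f (x j) = c j)))"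

definition posdef :: "(real \<Rightarrow> complex) \<Rightarrow> bool" where
  "posdef \<phi> \<longleftrightarrow> (\<forall>(n::nat) (x::nat \<Rightarrow> real) (c::nat \<Rightarrow> complex).
     Im (\<Sum>j<n. \<Sum>k<n. c j * cnj (c k) * \<phi> (x j - x k)) = 0 \<and>
     Re (\<Sum>j<n. \<Sum>k<n. c j * cnj (c k) * \<phi> (x j - x k)) \<ge> 0)"

definition A1 :: "(real \<Rightarrow> complex) \<Rightarrow> bool" where
  "A1 \<phi> \<longleftrightarrow> L2R \<phi> \<and> posdef \<phi>"

definition esssupT :: "(real \<Rightarrow> complex) \<Rightarrow> ennreal" where
  "esssupT g = Inf {C. AE t in lborel. t \<in> TT \<longrightarrow> ennreal (cmod (g t)) \<le> C}"

definition essinfT :: "(real \<Rightarrow> complex) \<Rightarrow> ennreal" where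
  "essinfT g = Sup {C. AE t in lborel. t \<in> TT \<longrightarrow> C \<le> ennreal (cmod (g t))}"

definition shift2pi :: "int \<Rightarrow> (real \<Rightarrow> complex) \<Rightarrow> real \<Rightarrow> complex" where
  "shift2pi k G = (\<lambda>t. G (t + 2 * pi * of_int k))"

definition wiener_norm :: "(real \<Rightarrow> complex) \<Rightarrow> ennreal" where
  "wiener_norm G = (\<integral>\<^sup>+ k. esssupT (shift2pi k G) \<partial>count_space (UNIV :: int set))"

definition inW :: "(real \<Rightarrow> complex) \<Rightarrow> bool" where
  "inW G \<longleftrightarrow> G \<in> borel_measurable lborel \<and> wiener_norm G < \<infinity>"

text \<open>delta_phi and C_phi, expressed through (a representative G of) the Fourier transform.\<close>
definition delta :: "(real \<Rightarrow> complex) \<Rightarrow> real" where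
  "delta G = enn2real (essinfT G)"

definition Cconst :: "(real \<Rightarrow> complex) \<Rightarrow> ennreal" where
  "Cconst G = (\<integral>\<^sup>+ k. esssupT (shift2pi k G) \<partial>count_space (UNIV - {0 :: int})) / ennreal (delta G)"

definition A2 :: "(real \<Rightarrow> complex) \<Rightarrow> bool" where
  "A2 G \<longleftrightarrow> inW G \<and> essinfT G > 0 \<and> essinfT G < \<infinity> \<and> Cconst G < \<infinity>"

definition Vspace :: "(real \<Rightarrow> complex) \<Rightarrow> (int \<Rightarrow> real) \<Rightarrow> (real \<Rightarrow> complex) set" where
  "Vspace \<phi> y = {f. continuous_on UNIV f \<and> L2R f \<and>
     (\<forall>e>0. \<exists>F c. finite F \<and> normR (\<lambda>t. f t - (\<Sum>j\<in>F. c j * \<phi> (t - y j))) < e)}"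

definition interp :: "(real \<Rightarrow> complex) \<Rightarrow> (int \<Rightarrow> real) \<Rightarrow> (real \<Rightarrow> complex) \<Rightarrow> (real \<Rightarrow> complex)" where
  "interp \<phi> y f = (SOME s. continuous_on UNIV s \<and> L2R s \<and>
     (\<exists>a. l2 a \<and> ((\<lambda>F. normR (\<lambda>t. s t - (\<Sum>j\<in>F. a j * \<phi> (t - y j)))) \<longlongrightarrow> 0)
                     (finite_subsets_at_top UNIV)) \<and>
     (\<forall>k. s (y k) = f (y k)))"

definition series_L2T :: "(int \<Rightarrow> complex) \<Rightarrow> (int \<Rightarrow> real \<Rightarrow> complex) \<Rightarrow> (real \<Rightarrow> complex) \<Rightarrow> bool" where
  "series_L2T c e h \<longleftrightarrow>
     ((\<lambda>F. normT (\<lambda>t. h t - (\<Sum>j\<in>F. c j * e j t))) \<longlongrightarrow> 0) (finite_subsets_at_top UNIV)"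

text \<open>A_X^k h (t) = E_X h (t + 2 pi k), t in T, where h = sum_j c_j exp(-i x_j .).\<close>
definition prolongA :: "(int \<Rightarrow> real) \<Rightarrow> int \<Rightarrow> (real \<Rightarrow> complex) \<Rightarrow> (real \<Rightarrow> complex)" where
  "prolongA x k h = (SOME G. L2T G \<and> (\<exists>c. l2 c \<and>
      series_L2T c (\<lambda>j t. cis (- (x j * t))) h \<and>
      series_L2T c (\<lambda>j t. cis (- (x j * (t + 2 * pi * of_int k)))) G))"

definition Mop :: "(real \<Rightarrow> complex) \<Rightarrow> (real \<Rightarrow> complex) \<Rightarrow> (real \<Rightarrow> complex)" where
  "Mop G g = (\<lambda>t. complex_of_real (delta G) * g t / G t)"

definition Top :: "(real \<Rightarrow> complex) \<Rightarrow> int \<Rightarrow> (real \<Rightarrow> complex) \<Rightarrow> (real \<Rightarrow> complex)" where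
  "Top G k g = (\<lambda>t. G (t + 2 * pi * of_int k) * g t / complex_of_real (delta G))"

definition alpha_filter :: "real set \<Rightarrow> real filter" where
  "alpha_filter A = inf at_top (principal A)"

text \<open>phi alpha is the family, Phi alpha a chosen representative of its Fourier transform.\<close>
definition B1 :: "real set \<Rightarrow> (real \<Rightarrow> real \<Rightarrow> complex) \<Rightarrow> (real \<Rightarrow> real \<Rightarrow> complex) \<Rightarrow> bool" where
  "B1 A \<phi> \<Phi> \<longleftrightarrow> (\<forall>\<alpha>\<in>A. A1 (\<phi> \<alpha>) \<and> A2 (\<Phi> \<alpha>))"

definition B2 :: "real set \<Rightarrow> (real \<Rightarrow> real \<Rightarrow> complex) \<Rightarrow> bool" where
  "B2 A \<Phi> \<longleftrightarrow> (SUP \<alpha>\<in>A. Cconst (\<Phi> \<alpha>)) < \<infinity>"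

definition B3 :: "real set \<Rightarrow> (real \<Rightarrow> real \<Rightarrow> complex) \<Rightarrow> (real \<Rightarrow> complex) \<Rightarrow> (int \<Rightarrow> real) \<Rightarrow> bool" where
  "B3 A \<Phi> \<Psi> x \<longleftrightarrow> (\<forall>g. L2T g \<longrightarrow>
     ((\<lambda>\<alpha>. \<integral>\<^sup>+ k. ennreal (normT (Top \<Psi> k (prolongA x k (\<lambda>t. Mop \<Psi> g t - Mop (\<Phi> \<alpha>) g t))))
              \<partial>count_space (UNIV - {0})) \<longlongrightarrow> 0) (alpha_filter A))"

definition B4 :: "real set \<Rightarrow> (real \<Rightarrow> real \<Rightarrow> complex) \<Rightarrow> (real \<Rightarrow> complex) \<Rightarrow> (int \<Rightarrow> real) \<Rightarrow> (int \<Rightarrow> real) \<Rightarrow> bool" where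
  "B4 A \<Phi> \<Psi> x y \<longleftrightarrow> (\<forall>g. L2T g \<longrightarrow>
     ((\<lambda>\<alpha>. \<integral>\<^sup>+ k. ennreal (normT (\<lambda>t.
              Top (\<Phi> \<alpha>) k (prolongA y k (Mop (\<Phi> \<alpha>) g)) t
            - Top \<Psi> k (prolongA x k (Mop (\<Phi> \<alpha>) g)) t))
              \<partial>count_space (UNIV - {0})) \<longlongrightarrow> 0) (alpha_filter A))"

definition regular_interpolators ::
  "real set \<Rightarrow> (real \<Rightarrow> real \<Rightarrow> complex) \<Rightarrow> (real \<Rightarrow> real \<Rightarrow> complex) \<Rightarrow> bool" where
  "regular_interpolators A \<phi> \<Phi> \<longleftrightarrow>
     (\<forall>M. \<exists>\<alpha>\<in>A. \<alpha> > M) \<and>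
     (\<forall>\<alpha>\<in>A. continuous_on UNIV (\<phi> \<alpha>) \<and> fourier_rel (\<phi> \<alpha>) (\<Phi> \<alpha>)) \<and>
     B1 A \<phi> \<Phi> \<and> B2 A \<Phi> \<and>
     (AE \<xi> in lborel. \<xi> \<in> TT \<longrightarrow>
        ((\<lambda>\<alpha>. complex_of_real (delta (\<Phi> \<alpha>)) / \<Phi> \<alpha> \<xi>) \<longlongrightarrow> 0) (alpha_filter A))"

definition ess_supp :: "(real \<Rightarrow> complex) \<Rightarrow> real set" where
  "ess_supp F = {\<xi>. \<forall>e>0. \<not> (AE t in lborel. t \<in> ball \<xi> e \<longrightarrow> F t = 0)}"

end

theory Submission
  imports Defs "HOL-Probability.Probability"
begin

text \<open>
  All functions involved are handled through their Fourier transforms. A complete interpolating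
  sequence \<open>y\<close> gives a Riesz basis of exponentials: interpolability yields the lower Riesz bound by
  uniform boundedness, the lower bound separates the nodes, and separation yields the upper bound,
  on every translate of \<open>TT\<close> with the same constants. So coefficients \<open>a\<close> in \<open>l2\<close> correspond to a
  function \<open>g\<close> on the line whose restriction to each block \<open>TT + 2 \<pi> k\<close> has norm comparable to that
  of \<open>a\<close>, and prolongation is bounded uniformly in \<open>k\<close>. Since \<open>\<Psi>\<close> lives on \<open>TT\<close>, B3 is trivial and
  B4 reduces to \<open>\<delta> / \<Phi> * g \<rightarrow> 0\<close> in \<open>L\<^sub>2\<close>, which is dominated convergence.

  An interpolant of a band-limited \<open>f\<close> with transform \<open>F\<close> has transform \<open>\<Phi> * g\<close>, where
  \<open>\<Phi> * g\<close> and \<open>F\<close> have the same pairings with all exponentials \<open>exp (i y\<^sub>k \<xi>)\<close>. Positive definiteness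
  gives \<open>\<Phi> \<ge> 0\<close>, so this system is symmetric and coercive, hence solvable, and testing it with \<open>g\<close>
  itself gives \<open>\<parallel>\<surd>\<Phi> g\<parallel> \<le> \<parallel>F / \<surd>\<Phi>\<parallel>\<close> on \<open>TT\<close>. Therefore \<open>\<delta> \<parallel>a\<parallel>\<close> is at most a multiple of
  \<open>\<parallel>\<surd>(\<delta> / \<Phi>) F\<parallel>\<close>, which tends to \<open>0\<close>. The part of \<open>\<Phi> * g\<close> outside \<open>TT\<close> is bounded by
  \<open>C\<^sub>\<Phi> \<delta> \<parallel>a\<parallel>\<close>, and by the Riesz property so is \<open>\<Phi> * g - F\<close> on \<open>TT\<close>; this controls both the
  \<open>L\<^sub>2\<close> and the uniform error.
\<close>

section \<open>Square-integrable functions\<close>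

text \<open>Regularity makes \<open>\<Phi>\<close> large against \<open>delta \<Phi>\<close> on
  \<open>TT\<close>, so the Gram systems have no condition number uniform in \<alpha>. Solvability
  holds for each \<alpha> separately, and coercivity with constant proportional to
  \<open>delta \<Phi>\<close> would only keep \<open>delta \<Phi> * norm a\<close> bounded without
  making it small. What is uniform is the weight \<open>delta \<Phi> / \<Phi>\<close>: its modulus
  is at most 1 on \<open>TT\<close> and tends to 0 almost everywhere, and no rate of convergence is
  available or asked for.

  Interpolation conditions need point values, which square integrability does not supply. Finite
  \<open>wiener_norm\<close> makes \<open>\<Phi>\<close> integrable, so point values come from
  absolutely convergent inverse Fourier integrals, and continuity turns equality almost everywhere
  into equality.

  \<open>interp\<close> and \<open>prolongA\<close> are picked by \<open>SOME\<close>. For both,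
  some object with the defining property is exhibited; every estimate is then derived from that
  property alone and holds for whichever object is picked.\<close>

lemma L2R_measurable [measurable_dest]: "L2R f \<Longrightarrow> f \<in> borel_measurable borel"
  by (simp add: L2R_def)

lemma L2R_iff_nn_integral:
  "L2R f \<longleftrightarrow> f \<in> borel_measurable borel \<and> (\<integral>\<^sup>+ x. ennreal ((cmod (f x))\<^sup>2) \<partial>lborel) < \<infinity>"
proof -
  have "integrable lborel (\<lambda>x. (cmod (f x))\<^sup>2) \<longleftrightarrow> (\<integral>\<^sup>+ x. ennreal ((cmod (f x))\<^sup>2) \<partial>lborel) < \<infinity>"
    if [measurable]: "f \<in> borel_measurable borel"
    by (subst integrable_iff_bounded) simp
  then show ?thesis
    by (auto simp: L2R_def)
qed

lemma normR_nonneg [simp]: "0 \<le> normR f"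
  by (simp add: normR_def)

lemma normR_square: "(normR f)\<^sup>2 = (LINT x|lborel. (cmod (f x))\<^sup>2)"
  by (simp add: normR_def)

lemma normR_square_nn_integral:
  assumes "L2R f"
  shows "ennreal ((normR f)\<^sup>2) = (\<integral>\<^sup>+ x. ennreal ((cmod (f x))\<^sup>2) \<partial>lborel)"
  unfolding normR_square using assms
  by (subst nn_integral_eq_integral) (auto simp: L2R_def)

lemma L2R_leI:
  assumes [measurable]: "f \<in> borel_measurable borel" and "0 \<le> C"
    and "(\<integral>\<^sup>+ x. ennreal ((cmod (f x))\<^sup>2) \<partial>lborel) \<le> ennreal (C\<^sup>2)"
  shows "L2R f" "normR f \<le> C"
proof -
  show f: "L2R f"
    using assms by (auto simp: L2R_iff_nn_integral intro: order.strict_trans1)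
  have "(normR f)\<^sup>2 \<le> C\<^sup>2"
    using assms(3) unfolding normR_square_nn_integral[OF f, symmetric] by (simp add: ennreal_le_iff)
  then show "normR f \<le> C"
    using assms(2) by (meson power2_le_imp_le)
qed

lemma L2R_bound_AE:
  assumes [measurable]: "g \<in> borel_measurable borel" and f: "L2R f" and "0 \<le> C"
    and "AE x in lborel. cmod (g x) \<le> C * cmod (f x)"
  shows "L2R g" "normR g \<le> C * normR f"
proof -
  have "(\<integral>\<^sup>+ x. ennreal ((cmod (g x))\<^sup>2) \<partial>lborel) \<le> (\<integral>\<^sup>+ x. ennreal (C\<^sup>2) * ennreal ((cmod (f x))\<^sup>2) \<partial>lborel)"
  proof (rule nn_integral_mono_AE, use assms(4) in eventually_elim)
    case (elim x)
    then have "(cmod (g x))\<^sup>2 \<le> (C * cmod (f x))\<^sup>2"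
      by (intro power_mono) auto
    then show ?case
      by (simp add: ennreal_mult[symmetric] power_mult_distrib ennreal_leI)
  qed
  also have "\<dots> = ennreal ((C * normR f)\<^sup>2)"
    using f by (subst nn_integral_cmult)
      (auto simp: normR_square_nn_integral[symmetric] ennreal_mult[symmetric] power_mult_distrib)
  finally have *: "(\<integral>\<^sup>+ x. ennreal ((cmod (g x))\<^sup>2) \<partial>lborel) \<le> ennreal ((C * normR f)\<^sup>2)" .
  show "L2R g" "normR g \<le> C * normR f"
    using L2R_leI[OF _ _ *] assms by auto
qed

lemma L2R_cong_AE:
  assumes "f \<in> borel_measurable borel" "L2R g" "AE x in lborel. f x = g x"
  shows "L2R f"
proof (rule L2R_bound_AE(1)[where C=1 and f=g])
  show "AE x in lborel. cmod (f x) \<le> 1 * cmod (g x)"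
    using assms(3) by eventually_elim simp
qed (use assms in auto)

lemma normR_cong_AE:
  assumes [measurable]: "f \<in> borel_measurable borel" "g \<in> borel_measurable borel"
    and "AE x in lborel. f x = g x"
  shows "normR f = normR g"
  unfolding normR_def
  by (subst integral_cong_AE[where g="\<lambda>x. (cmod (g x))\<^sup>2"]) (use assms(3) in auto)

lemma L2R_mult_bounded:
  assumes "g \<in> borel_measurable borel" "L2R f" "\<And>x. cmod (g x) \<le> C"
  shows "L2R (\<lambda>x. g x * f x)" "normR (\<lambda>x. g x * f x) \<le> C * normR f"
proof -
  note [measurable] = assms(1) L2R_measurable[OF assms(2)]
  have "0 \<le> C"
    using assms(3)[of 0] norm_ge_zero order_trans by blast
  then show "L2R (\<lambda>x. g x * f x)" "normR (\<lambda>x. g x * f x) \<le> C * normR f"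
    using assms(3) by (auto intro!: L2R_bound_AE[OF _ assms(2)] AE_I2 mult_right_mono simp: norm_mult)
qed

lemma L2R_zero [simp]: "L2R (\<lambda>x. 0)" and normR_zero [simp]: "normR (\<lambda>x. 0) = 0"
  by (auto simp: L2R_def normR_def)

lemma L2R_cmult [intro]: "L2R f \<Longrightarrow> L2R (\<lambda>x. c * f x)"
  by (rule L2R_mult_bounded(1)) auto

lemma normR_cmult: "normR (\<lambda>x. c * f x) = cmod c * normR f"
  by (simp add: normR_def norm_mult power_mult_distrib real_sqrt_mult)

lemma L2R_cnj [intro]: "L2R f \<Longrightarrow> L2R (\<lambda>x. cnj (f x))"
  unfolding L2R_def by (auto intro: borel_measurable_continuous_on[of cnj] continuous_intros)

lemma normR_minus [simp]: "normR (\<lambda>x. - f x) = normR f"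
  by (simp add: normR_def)

lemma normR_minus_commute: "normR (\<lambda>x. f x - g x) = normR (\<lambda>x. g x - f x)"
  by (simp add: normR_def norm_minus_commute)

lemma L2R_add [intro]:
  assumes "L2R f" "L2R g"
  shows "L2R (\<lambda>x. f x + g x)"
proof -
  note [measurable] = assms[THEN L2R_measurable]
  have "integrable lborel (\<lambda>x. (cmod (f x + g x))\<^sup>2)"
  proof (rule Bochner_Integration.integrable_bound)
    show "integrable lborel (\<lambda>x. 2 * (cmod (f x))\<^sup>2 + 2 * (cmod (g x))\<^sup>2)"
      using assms by (auto simp: L2R_def)
    show "AE x in lborel. norm ((cmod (f x + g x))\<^sup>2) \<le> norm (2 * (cmod (f x))\<^sup>2 + 2 * (cmod (g x))\<^sup>2)"
    proof (rule AE_I2)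
      fix x
      have "(cmod (f x + g x))\<^sup>2 \<le> (cmod (f x) + cmod (g x))\<^sup>2"
        by (intro power_mono norm_triangle_ineq) auto
      also have "\<dots> \<le> 2 * (cmod (f x))\<^sup>2 + 2 * (cmod (g x))\<^sup>2"
        using sum_squares_bound[of "cmod (f x)" "cmod (g x)"] by (simp add: power2_sum)
      finally show "norm ((cmod (f x + g x))\<^sup>2) \<le> norm (2 * (cmod (f x))\<^sup>2 + 2 * (cmod (g x))\<^sup>2)"
        by simp
    qed
  qed auto
  then show ?thesis
    using assms by (auto simp: L2R_def)
qed

lemma L2R_uminus [intro]: "L2R f \<Longrightarrow> L2R (\<lambda>x. - f x)"
  using L2R_cmult[of f "-1"] by simp

lemma L2R_diff [intro]: "L2R f \<Longrightarrow> L2R g \<Longrightarrow> L2R (\<lambda>x. f x - g x)"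
  using L2R_add[OF _ L2R_uminus] by simp

lemma L2R_mult_integrable:
  assumes "L2R f" "L2R g"
  shows "integrable lborel (\<lambda>x. f x * g x)"
proof (rule Bochner_Integration.integrable_bound)
  note [measurable] = assms[THEN L2R_measurable]
  show "integrable lborel (\<lambda>x. (cmod (f x))\<^sup>2 + (cmod (g x))\<^sup>2)"
    using assms by (auto simp: L2R_def)
  show "AE x in lborel. norm (f x * g x) \<le> norm ((cmod (f x))\<^sup>2 + (cmod (g x))\<^sup>2)"
  proof (rule AE_I2)
    fix x
    have "cmod (f x) * cmod (g x) \<le> (cmod (f x))\<^sup>2 + (cmod (g x))\<^sup>2"
      using sum_squares_bound[of "cmod (f x)" "cmod (g x)"] mult_nonneg_nonneg[OF norm_ge_zero norm_ge_zero, of "f x" "g x"]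
      by linarith
    then show "norm (f x * g x) \<le> norm ((cmod (f x))\<^sup>2 + (cmod (g x))\<^sup>2)"
      by (simp add: norm_mult)
  qed
  show "(\<lambda>x. f x * g x) \<in> borel_measurable lborel" by simp
qed

lemma L2R_Cauchy_Schwarz_norm:
  assumes "L2R f" "L2R g"
  shows "(LINT x|lborel. cmod (f x) * cmod (g x)) \<le> normR f * normR g"
proof -
  note [measurable] = assms[THEN L2R_measurable]
  have int: "integrable lborel (\<lambda>x. cmod (f x) * cmod (g x))"
    using integrable_norm[OF L2R_mult_integrable[OF assms]] by (simp add: norm_mult)
  have "ennreal ((LINT x|lborel. cmod (f x) * cmod (g x))\<^sup>2) = (\<integral>\<^sup>+ x. ennreal (cmod (f x)) * ennreal (cmod (g x)) \<partial>lborel)\<^sup>2"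
    using int by (subst ennreal_power[symmetric]) (auto simp: nn_integral_eq_integral ennreal_mult[symmetric] intro!: integral_nonneg_AE)
  also have "\<dots> \<le> (\<integral>\<^sup>+ x. (ennreal (cmod (f x)))\<^sup>2 \<partial>lborel) * (\<integral>\<^sup>+ x. (ennreal (cmod (g x)))\<^sup>2 \<partial>lborel)"
    by (rule Cauchy_Schwarz_nn_integral) auto
  also have "\<dots> = ennreal ((normR f * normR g)\<^sup>2)"
    using assms by (simp add: ennreal_power normR_square_nn_integral[symmetric] ennreal_mult[symmetric] power_mult_distrib)
  finally have "(LINT x|lborel. cmod (f x) * cmod (g x))\<^sup>2 \<le> (normR f * normR g)\<^sup>2"
    by (simp add: ennreal_le_iff)
  then show ?thesis
    by (rule power2_le_imp_le) auto
qed

lemma L2R_Cauchy_Schwarz: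
  assumes "L2R f" "L2R g"
  shows "cmod (LINT x|lborel. f x * g x) \<le> normR f * normR g"
proof -
  have "cmod (LINT x|lborel. f x * g x) \<le> (LINT x|lborel. cmod (f x * g x))"
    by (rule integral_norm_bound)
  then show ?thesis
    using L2R_Cauchy_Schwarz_norm[OF assms] by (simp add: norm_mult)
qed

lemma normR_triangle:
  assumes "L2R f" "L2R g"
  shows "normR (\<lambda>x. f x + g x) \<le> normR f + normR g"
proof -
  have int: "integrable lborel (\<lambda>x. cmod (f x) * cmod (g x))"
    using integrable_norm[OF L2R_mult_integrable[OF assms]] by (simp add: norm_mult)
  have "(normR (\<lambda>x. f x + g x))\<^sup>2 \<le> (LINT x|lborel. (cmod (f x))\<^sup>2 + 2 * (cmod (f x) * cmod (g x)) + (cmod (g x))\<^sup>2)"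
    unfolding normR_square
  proof (rule integral_mono)
    fix x
    have "(cmod (f x + g x))\<^sup>2 \<le> (cmod (f x) + cmod (g x))\<^sup>2"
      by (intro power_mono norm_triangle_ineq) auto
    then show "(cmod (f x + g x))\<^sup>2 \<le> (cmod (f x))\<^sup>2 + 2 * (cmod (f x) * cmod (g x)) + (cmod (g x))\<^sup>2"
      by (simp add: power2_sum algebra_simps)
  qed (use assms int L2R_add[OF assms] in \<open>auto simp: L2R_def\<close>)
  also have "\<dots> = (normR f)\<^sup>2 + 2 * (LINT x|lborel. cmod (f x) * cmod (g x)) + (normR g)\<^sup>2"
    using assms int by (simp add: L2R_def normR_square)
  also have "\<dots> \<le> (normR f + normR g)\<^sup>2"
    using L2R_Cauchy_Schwarz_norm[OF assms] by (simp add: power2_sum)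
  finally show ?thesis
    by (rule power2_le_imp_le) auto
qed

lemma normR_triangle_diff:
  assumes "L2R f" "L2R g"
  shows "normR (\<lambda>x. f x - g x) \<le> normR f + normR g"
  using normR_triangle[OF assms(1) L2R_uminus[OF assms(2)]] by simp

lemma normR_triangle_via:
  assumes "L2R (\<lambda>x. f x - g x)" "L2R (\<lambda>x. g x - h x)"
  shows "normR (\<lambda>x. f x - h x) \<le> normR (\<lambda>x. f x - g x) + normR (\<lambda>x. g x - h x)"
  using normR_triangle[OF assms] by simp

lemma normR_le_add_diff:
  assumes "L2R f" "L2R g"
  shows "normR f \<le> normR (\<lambda>x. f x - g x) + normR g"
  using normR_triangle[OF L2R_diff[OF assms] assms(2)] by simp

lemma normR_eq_0_AE:
  assumes "L2R f" "normR f = 0"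
  shows "AE x in lborel. f x = 0"
proof -
  note [measurable] = L2R_measurable[OF assms(1)]
  have "(\<integral>\<^sup>+ x. ennreal ((cmod (f x))\<^sup>2) \<partial>lborel) = 0"
    using normR_square_nn_integral[OF assms(1)] assms(2) by simp
  then have "AE x in lborel. ennreal ((cmod (f x))\<^sup>2) = 0"
    by (subst (asm) nn_integral_0_iff_AE) auto
  then show ?thesis
    by eventually_elim simp
qed

lemma L2R_Fatou:
  assumes [measurable]: "\<And>n. u n \<in> borel_measurable borel" "w \<in> borel_measurable borel"
    and "\<And>n. L2R (u n)" "\<And>n. normR (u n) \<le> C"
    and lim: "AE x in lborel. (\<lambda>n. u n x) \<longlonglongrightarrow> w x"
  shows "L2R w" "normR w \<le> C"
proof -
  have C: "0 \<le> C"
    using assms(4)[of 0] normR_nonneg order_trans by blast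
  have "(\<integral>\<^sup>+ x. ennreal ((cmod (w x))\<^sup>2) \<partial>lborel) = (\<integral>\<^sup>+ x. liminf (\<lambda>n. ennreal ((cmod (u n x))\<^sup>2)) \<partial>lborel)"
  proof (rule nn_integral_cong_AE, use lim in eventually_elim)
    case (elim x)
    then have "(\<lambda>n. ennreal ((cmod (u n x))\<^sup>2)) \<longlonglongrightarrow> ennreal ((cmod (w x))\<^sup>2)"
      by (intro tendsto_ennrealI tendsto_intros)
    then show ?case
      by (intro lim_imp_Liminf[symmetric]) (auto simp: trivial_limit_sequentially)
  qed
  also have "\<dots> \<le> liminf (\<lambda>n. \<integral>\<^sup>+ x. ennreal ((cmod (u n x))\<^sup>2) \<partial>lborel)"
    by (rule nn_integral_liminf) auto
  also have "\<dots> \<le> liminf (\<lambda>n. ennreal (C\<^sup>2))"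
    using assms(3,4) by (intro Liminf_mono always_eventually)
      (auto simp: normR_square_nn_integral[symmetric] intro!: ennreal_leI power_mono)
  also have "\<dots> = ennreal (C\<^sup>2)"
    by (simp add: Liminf_const)
  finally have *: "(\<integral>\<^sup>+ x. ennreal ((cmod (w x))\<^sup>2) \<partial>lborel) \<le> ennreal (C\<^sup>2)" .
  show "L2R w" "normR w \<le> C"
    using L2R_leI[OF _ C *] by auto
qed

text \<open>The geometric rate lets Tonelli replace Minkowski's inequality: almost everywhere
  \<open>\<Sum>n. 2^n * \<bar>u (n+1) x - u n x\<bar>^2\<close> is finite.\<close>

lemma L2R_rapid_Cauchy_AE_convergent:
  assumes "\<And>n. L2R (\<lambda>x. u (Suc n) x - u n x)"
    and bound: "\<And>n. (normR (\<lambda>x. u (Suc n) x - u n x))\<^sup>2 \<le> K * (1/4) ^ n"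
  shows "AE x in lborel. convergent (\<lambda>n. u n x)"
proof -
  note [measurable] = assms(1)[THEN L2R_measurable]
  let ?d = "\<lambda>n x. ennreal (2 ^ n * (cmod (u (Suc n) x - u n x))\<^sup>2)"
  have K: "0 \<le> K"
    using order_trans[OF zero_le_power2 bound[of 0]] by simp
  have "(\<integral>\<^sup>+ x. (\<Sum>n. ?d n x) \<partial>lborel) = (\<Sum>n. \<integral>\<^sup>+ x. ?d n x \<partial>lborel)"
    by (rule nn_integral_suminf) auto
  also have "\<dots> \<le> (\<Sum>n. ennreal (K * (1/2) ^ n))"
  proof (rule suminf_le)
    fix n
    have "(\<integral>\<^sup>+ x. ?d n x \<partial>lborel) = ennreal (2 ^ n) * ennreal ((normR (\<lambda>x. u (Suc n) x - u n x))\<^sup>2)"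
      using assms(1) by (simp add: normR_square_nn_integral nn_integral_cmult ennreal_mult)
    also have "\<dots> \<le> ennreal (2 ^ n * (K * (1/4) ^ n))"
      unfolding ennreal_mult[symmetric, OF zero_le_power zero_le_power2, of 2, simplified]
      by (intro ennreal_leI mult_left_mono bound) auto
    also have "2 ^ n * (K * (1/4) ^ n) = K * (1/2) ^ n"
      by (simp add: power_mult_distrib[symmetric] field_simps)
    finally show "(\<integral>\<^sup>+ x. ?d n x \<partial>lborel) \<le> ennreal (K * (1/2) ^ n)" .
  qed auto
  also have "\<dots> = ennreal (\<Sum>n. K * (1/2) ^ n)"
    using K by (intro suminf_ennreal2) (auto intro!: summable_mult summable_geometric)
  also have "\<dots> < \<infinity>" by simp
  finally have "(\<integral>\<^sup>+ x. (\<Sum>n. ?d n x) \<partial>lborel) \<noteq> \<infinity>" by simp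
  then have "AE x in lborel. (\<Sum>n. ?d n x) \<noteq> \<infinity>"
    by (intro nn_integral_PInf_AE) auto
  then show ?thesis
  proof eventually_elim
    case (elim x)
    define d where "d n = cmod (u (Suc n) x - u n x)" for n
    have "summable (\<lambda>n. 2 ^ n * (d n)\<^sup>2)"
      using elim unfolding d_def by (intro summable_suminf_not_top) (auto simp: top_ennreal_def infinity_ennreal_def)
    then have "(\<lambda>n. 2 ^ n * (d n)\<^sup>2) \<longlonglongrightarrow> 0"
      by (rule summable_LIMSEQ_zero)
    then obtain D where D: "\<And>n. \<bar>2 ^ n * (d n)\<^sup>2\<bar> \<le> D"
      using convergent_imp_Bseq[of "\<lambda>n. 2 ^ n * (d n)\<^sup>2"] unfolding Bseq_def convergent_def by auto
    \<comment> \<open>The terms with weight \<open>2 ^ n\<close> are bounded, so \<open>d n\<close>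
      lies below a geometric sequence of ratio \<open>1 / sqrt 2\<close> and the increments are
      absolutely summable at this point.\<close>
    have "d n \<le> sqrt D * (1 / sqrt 2) ^ n" for n
    proof -
      have "(d n)\<^sup>2 \<le> D / 2 ^ n"
        using D[of n] by (simp add: field_simps)
      then have "d n \<le> sqrt (D / 2 ^ n)"
        by (rule real_le_rsqrt)
      then show ?thesis
        by (simp add: real_sqrt_divide real_sqrt_power power_divide)
    qed
    moreover have "summable (\<lambda>n. sqrt D * (1 / sqrt 2) ^ n)"
      by (intro summable_mult summable_geometric) simp
    ultimately have "summable d"
      by (intro summable_comparison_test[of d "\<lambda>n. sqrt D * (1 / sqrt 2) ^ n"]) (auto simp: d_def)
    then have "summable (\<lambda>n. u (Suc n) x - u n x)"
      unfolding d_def by (rule summable_norm_cancel)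
    then have "convergent (\<lambda>n. \<Sum>k<n. u (Suc k) x - u k x)"
      by (simp add: summable_iff_convergent)
    then have "convergent (\<lambda>n. u n x - u 0 x)"
      by (simp add: sum_lessThan_telescope[of "\<lambda>n. u n x"])
    then have "convergent (\<lambda>n. (u n x - u 0 x) + u 0 x)"
      by (intro convergent_add convergent_const)
    then show "convergent (\<lambda>n. u n x)" by simp
  qed
qed

section \<open>Inverse Fourier integrals and Gaussians\<close>

text \<open>Sign and factor are inverse to those of \<open>ft_trunc\<close>. With this factor
  \<open>gauss 1\<close> is a fixed point and \<open>ift\<close> is a contraction in the L2 norm. If
  \<open>G\<close> is not integrable, the integral has its default value 0.\<close>

definition ift :: "(real \<Rightarrow> complex) \<Rightarrow> real \<Rightarrow> complex" where
  "ift G t = complex_of_real (1 / sqrt (2 * pi)) * (LINT \<xi>|lborel. G \<xi> * cis (\<xi> * t))"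

text \<open>\<open>c\<close> is a reciprocal width, so \<open>ift\<close> exchanges \<open>c\<close>
  and \<open>1 / c\<close> up to a factor. The height is kept at 1, which makes every Gaussian a
  multiplier bounded by 1.\<close>

definition gauss :: "real \<Rightarrow> real \<Rightarrow> real" where
  "gauss c t = exp (- ((c * t)\<^sup>2 / 2))"

lemma borel_measurable_cis [measurable]: "cis \<in> borel_measurable borel"
  by (intro borel_measurable_continuous_onI continuous_intros)

lemma borel_measurable_cnj' [measurable]: "cnj \<in> borel_measurable borel"
  by (intro borel_measurable_continuous_onI continuous_intros)

lemma borel_measurable_gauss [measurable]: "gauss c \<in> borel_measurable borel"
  unfolding gauss_def by measurable

lemma integrable_mult_bounded:
  fixes f :: "'a \<Rightarrow> complex"
  assumes "integrable M f" "g \<in> borel_measurable M" "\<And>x. cmod (g x) \<le> C"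
  shows "integrable M (\<lambda>x. f x * g x)"
proof (rule Bochner_Integration.integrable_bound)
  show "integrable M (\<lambda>x. C * cmod (f x))"
    using assms(1) by auto
  have "0 \<le> C"
    using assms(3) norm_ge_zero order_trans by blast
  then show "AE x in M. norm (f x * g x) \<le> norm (C * cmod (f x))"
    using assms(3) by (auto simp: norm_mult mult.commute[of C] intro!: AE_I2 mult_left_mono)
qed (use assms in auto)

lemma integrable_mult_cis [intro]:
  "integrable lborel G \<Longrightarrow> integrable lborel (\<lambda>\<xi>. G \<xi> * cis (\<xi> * t))"
  by (rule integrable_mult_bounded[where C=1]) auto

lemma norm_ift_le: "cmod (ift G t) \<le> 1 / sqrt (2 * pi) * (LINT \<xi>|lborel. cmod (G \<xi>))"
proof -
  have "cmod (LINT \<xi>|lborel. G \<xi> * cis (\<xi> * t)) \<le> (LINT \<xi>|lborel. cmod (G \<xi> * cis (\<xi> * t)))"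
    by (rule integral_norm_bound)
  then show ?thesis
    by (simp add: ift_def norm_mult norm_divide divide_right_mono)
qed

lemma ift_continuous:
  assumes "integrable lborel G"
  shows "continuous_on UNIV (ift G)"
proof -
  have "(\<lambda>n. LINT \<xi>|lborel. G \<xi> * cis (\<xi> * X n)) \<longlonglongrightarrow> (LINT \<xi>|lborel. G \<xi> * cis (\<xi> * t))"
    if "X \<longlonglongrightarrow> t" for X t
  proof (rule integral_dominated_convergence[where w="\<lambda>\<xi>. cmod (G \<xi>)"])
    show "AE \<xi> in lborel. (\<lambda>n. G \<xi> * cis (\<xi> * X n)) \<longlonglongrightarrow> G \<xi> * cis (\<xi> * t)"
      using that by (intro AE_I2 tendsto_intros)
  qed (use assms in \<open>auto simp: norm_mult\<close>)
  then have "(\<lambda>n. ift G (X n)) \<longlonglongrightarrow> ift G t" if "X \<longlonglongrightarrow> t" for X t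
    using that unfolding ift_def by (intro tendsto_intros) blast
  then show ?thesis
    by (auto simp: continuous_on_sequentially o_def)
qed

lemma borel_measurable_ift [measurable]:
  "integrable lborel G \<Longrightarrow> ift G \<in> borel_measurable borel"
  by (rule borel_measurable_continuous_onI[OF ift_continuous])

lemma ift_diff:
  assumes "integrable lborel F" "integrable lborel G"
  shows "ift (\<lambda>\<xi>. F \<xi> - G \<xi>) t = ift F t - ift G t"
  using integrable_mult_cis[OF assms(1), of t] integrable_mult_cis[OF assms(2), of t]
  by (simp add: ift_def algebra_simps)

lemma ift_cmult: "ift (\<lambda>\<xi>. c * G \<xi>) t = c * ift G t"
  by (simp add: ift_def mult.assoc mult.left_commute)

lemma ift_sum:
  assumes "\<And>j. j \<in> F \<Longrightarrow> integrable lborel (G j)"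
  shows "ift (\<lambda>\<xi>. \<Sum>j\<in>F. G j \<xi>) t = (\<Sum>j\<in>F. ift (G j) t)"
  using assms by (simp add: ift_def sum_distrib_right sum_distrib_left integrable_mult_cis)

lemma ift_cis: "ift (\<lambda>\<xi>. cis (a * \<xi>) * G \<xi>) t = ift G (t + a)"
  by (simp add: ift_def mult.assoc mult.left_commute cis_mult distrib_left mult.commute[of a])
    (simp add: mult.assoc[symmetric] cis_mult algebra_simps)

lemma integral_reflect:
  fixes f :: "real \<Rightarrow> complex"
  shows "(LINT x|lborel. f (- x)) = (LINT x|lborel. f x)"
  using lborel_integral_real_affine[of "-1" f 0] by simp

lemma cnj_ift: "cnj (ift G t) = ift (\<lambda>\<xi>. cnj (G (- \<xi>))) t"
proof -
  have "cnj (LINT \<xi>|lborel. G \<xi> * cis (\<xi> * t)) = (LINT \<xi>|lborel. cnj (G \<xi>) * cis (- (\<xi> * t)))"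
    by (subst Bochner_Integration.integral_cnj[symmetric]) (simp add: cis_cnj)
  also have "\<dots> = (LINT \<xi>|lborel. cnj (G (- \<xi>)) * cis (\<xi> * t))"
    using integral_reflect[of "\<lambda>\<xi>. cnj (G (- \<xi>)) * cis (\<xi> * t)"] by simp
  finally show ?thesis by (simp add: ift_def)
qed

text \<open>The multiplication formula: both sides are iterated integrals of
  \<open>F \<xi> * k t * cis (\<xi> * t)\<close>, which is integrable on the plane because
  \<open>F\<close> and \<open>k\<close> are integrable, so Fubini applies.\<close>

lemma integral_ift_mult:
  assumes "integrable lborel F" "integrable lborel k"
  shows "(LINT t|lborel. ift F t * k t) = (LINT \<xi>|lborel. F \<xi> * ift k \<xi>)"
proof -
  note [measurable] = assms[THEN borel_measurable_integrable]
  define h where "h \<xi> t = F \<xi> * k t * cis (\<xi> * t)" for \<xi> t :: real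
  have "integrable (lborel \<Otimes>\<^sub>M lborel) (\<lambda>(\<xi>, t). h \<xi> t)"
  proof (rule lborel_pair.Fubini_integrable)
    show "integrable lborel (\<lambda>\<xi>. LINT t|lborel. norm (case (\<xi>, t) of (\<xi>, t) \<Rightarrow> h \<xi> t))"
      using assms by (auto simp: h_def norm_mult)
    show "AE \<xi> in lborel. integrable lborel (\<lambda>t. case (\<xi>, t) of (\<xi>, t) \<Rightarrow> h \<xi> t)"
      using integrable_mult_cis[OF assms(2)]
      by (intro AE_I2) (auto simp: h_def mult.assoc mult.commute[of _ "_ :: real"] simp del: mult.commute)
  qed (auto simp: h_def)
  then have "(LINT t|lborel. LINT \<xi>|lborel. h \<xi> t) = (LINT \<xi>|lborel. LINT t|lborel. h \<xi> t)"
    by (rule lborel_pair.Fubini_integral)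
  moreover have "(LINT \<xi>|lborel. h \<xi> t) = (LINT \<xi>|lborel. F \<xi> * cis (\<xi> * t)) * k t" for t
    by (simp add: h_def mult.assoc mult.left_commute mult.commute[of "k t"] flip: integral_mult_left_zero)
  moreover have "(LINT t|lborel. h \<xi> t) = F \<xi> * (LINT t|lborel. k t * cis (t * \<xi>))" for \<xi>
    by (simp add: h_def mult.assoc mult.commute[of \<xi>] flip: integral_mult_right_zero)
  ultimately show ?thesis
    by (simp add: ift_def mult.assoc mult.left_commute)
qed

section \<open>Gaussians and their Fourier transforms\<close>

lemma gauss_pos: "0 < gauss c t" and gauss_le_1: "gauss c t \<le> 1"
  by (simp_all add: gauss_def)

lemma gauss_eq_std_normal_density: "gauss c t = sqrt (2 * pi) * std_normal_density (c * t)"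
  by (simp add: gauss_def std_normal_density_def)

lemma integrable_gauss:
  assumes "c \<noteq> 0"
  shows "integrable lborel (gauss c)"
proof -
  have "integrable lborel std_normal_density"
    by simp
  then have "integrable lborel (\<lambda>t. std_normal_density (0 + c * t))"
    using assms by (intro lborel_integrable_real_affine)
  then show ?thesis
    unfolding gauss_eq_std_normal_density[abs_def] by simp
qed

lemma integrable_of_real_gauss: "c \<noteq> 0 \<Longrightarrow> integrable lborel (\<lambda>t. complex_of_real (gauss c t))"
  using integrable_gauss by auto

text \<open>Read off from the characteristic function of the standard normal distribution; the other
  Gaussian transforms follow by scaling and modulation.\<close>

lemma ift_gauss_1: "ift (\<lambda>t. complex_of_real (gauss 1 t)) s = complex_of_real (gauss 1 s)"
proof -
  have "complex_of_real (exp (- s\<^sup>2 / 2)) = char std_normal_distribution s"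
    by (simp add: char_std_normal_distribution)
  also have "\<dots> = (LINT x|lborel. complex_of_real (std_normal_density x) * iexp (s * x))"
    by (simp add: char_def integral_density scaleR_conv_of_real)
  also have "\<dots> = (LINT x|lborel. complex_of_real (1 / sqrt (2 * pi)) * (complex_of_real (gauss 1 x) * cis (x * s)))"
    by (intro Bochner_Integration.integral_cong) (auto simp: gauss_def std_normal_density_def cis_conv_exp mult_ac)
  finally show ?thesis
    by (simp add: ift_def gauss_def)
qed

lemma ift_gauss:
  assumes "0 < c"
  shows "ift (\<lambda>t. complex_of_real (gauss c t)) s = complex_of_real (gauss (1 / c) s / c)"
proof -
  have "(LINT \<xi>|lborel. complex_of_real (gauss 1 \<xi>) * cis (\<xi> * (s / c))) =
      c *\<^sub>R (LINT \<xi>|lborel. complex_of_real (gauss 1 (c * \<xi>)) * cis (c * \<xi> * (s / c)))"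
    using lborel_integral_real_affine[of c "\<lambda>\<xi>. complex_of_real (gauss 1 \<xi>) * cis (\<xi> * (s / c))" 0] assms
    by simp
  also have "\<dots> = c *\<^sub>R (LINT \<xi>|lborel. complex_of_real (gauss c \<xi>) * cis (\<xi> * s))"
    using assms by (simp add: gauss_def)
  finally show ?thesis
    using ift_gauss_1[of "s / c"] assms by (simp add: ift_def gauss_def scaleR_conv_of_real field_simps)
qed

lemma ift_gauss_cis:
  assumes "0 < c"
  shows "ift (\<lambda>t. cis (a * t) * complex_of_real (gauss c t)) s = complex_of_real (gauss (1 / c) (s + a) / c)"
  by (simp add: ift_cis ift_gauss[OF assms])

section \<open>Uniqueness and Bessel inequality\<close>

text \<open>Integrating the hypothesis over all centres \<eta> in the interval replaces the Gaussian
  by a smoothed indicator of the interval, which tends to the indicator off the two end points as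
  the width shrinks.\<close>

lemma integral_interval_nonneg_if_gauss:
  fixes u :: "real \<Rightarrow> real"
  assumes u: "integrable lborel u"
    and pos: "\<And>c \<eta>. 0 < c \<Longrightarrow> 0 \<le> (LINT \<xi>|lborel. u \<xi> * gauss c (\<xi> - \<eta>))"
  shows "0 \<le> (LINT \<xi>|lborel. u \<xi> * indicator {a..b} \<xi>)"
proof -
  note [measurable] = borel_measurable_integrable[OF u]
  let ?I = "indicator {a..b} :: real \<Rightarrow> real"
  define c where "c n = real (Suc n)" for n
  have c: "0 < c n" for n by (simp add: c_def)
  \<comment> \<open>The indicator convolved with a Gaussian of width \<open>1 / c n\<close>, written
    in the variable \<open>v = c n * (\<eta> - \<xi>)\<close> so that the dominating function does
    not depend on \<open>n\<close>.\<close>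
  define W where "W n \<xi> = (LINT v|lborel. ?I (\<xi> + v / c n) * std_normal_density v)" for n \<xi>
  have W_le: "\<bar>W n \<xi>\<bar> \<le> 1" for n \<xi>
  proof -
    have "\<bar>W n \<xi>\<bar> \<le> (LINT v|lborel. \<bar>?I (\<xi> + v / c n) * std_normal_density v\<bar>)"
      unfolding W_def by (rule integral_abs_bound)
    also have "\<dots> \<le> (LINT v|lborel. std_normal_density v)"
    proof (rule integral_mono)
      show "integrable lborel (\<lambda>v. \<bar>?I (\<xi> + v / c n) * std_normal_density v\<bar>)"
        by (rule Bochner_Integration.integrable_bound[of _ std_normal_density])
          (auto simp: abs_mult split: split_indicator)
    qed (auto simp: abs_mult split: split_indicator)
    finally show ?thesis by simp
  qed
  have W_meas [measurable]: "W n \<in> borel_measurable borel" for n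
    unfolding W_def by measurable
  have W_lim: "(\<lambda>n. W n \<xi>) \<longlonglongrightarrow> ?I \<xi>" if "\<xi> \<noteq> a" "\<xi> \<noteq> b" for \<xi>
  proof -
    have "(\<lambda>n. W n \<xi>) \<longlonglongrightarrow> (LINT v|lborel. ?I \<xi> * std_normal_density v)"
      unfolding W_def
    proof (rule integral_dominated_convergence[where w=std_normal_density])
      show "AE v in lborel. (\<lambda>n. ?I (\<xi> + v / c n) * std_normal_density v) \<longlonglongrightarrow> ?I \<xi> * std_normal_density v"
      proof (intro AE_I2 tendsto_mult tendsto_const)
        fix v
        have lim: "(\<lambda>n. \<xi> + v / c n) \<longlonglongrightarrow> \<xi>"
          unfolding c_def by real_asymp
        have "isCont ?I \<xi>"
          using that by (simp add: isCont_indicator frontier_cbox[of a b, simplified])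
        then show "(\<lambda>n. ?I (\<xi> + v / c n)) \<longlonglongrightarrow> ?I \<xi>"
          using lim by (rule isCont_tendsto_compose)
      qed
    qed (auto simp: abs_mult split: split_indicator)
    then show ?thesis by simp
  qed
  have "0 \<le> (LINT \<xi>|lborel. u \<xi> * W n \<xi>)" for n
  proof -
    define h where "h \<eta> \<xi> = ?I \<eta> * (c n / sqrt (2 * pi)) * (u \<xi> * gauss (c n) (\<xi> - \<eta>))" for \<eta> \<xi>
    have "integrable (lborel \<Otimes>\<^sub>M lborel) (\<lambda>(\<eta>, \<xi>). h \<eta> \<xi>)"
    proof (rule Bochner_Integration.integrable_bound)
      show "integrable (lborel \<Otimes>\<^sub>M lborel) (\<lambda>(\<eta>, \<xi>). ?I \<eta> * (c n / sqrt (2 * pi)) * u \<xi>)"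
      proof (rule lborel_pair.Fubini_integrable)
        show "integrable lborel (\<lambda>\<eta>. LINT \<xi>|lborel. norm (case (\<eta>, \<xi>) of (\<eta>, \<xi>) \<Rightarrow> ?I \<eta> * (c n / sqrt (2 * pi)) * u \<xi>))"
          using u by (auto simp: abs_mult emeasure_lborel_Icc_eq intro!: integrable_divide integrable_mult_left integrable_real_indicator)
      qed (use u in auto)
      show "AE x in lborel \<Otimes>\<^sub>M lborel. norm (case x of (\<eta>, \<xi>) \<Rightarrow> h \<eta> \<xi>) \<le> norm (case x of (\<eta>, \<xi>) \<Rightarrow> ?I \<eta> * (c n / sqrt (2 * pi)) * u \<xi>)"
        using gauss_pos gauss_le_1 less_imp_le[OF gauss_pos]
        by (intro AE_I2) (auto simp: h_def abs_mult intro!: mult_left_mono mult_left_le divide_right_mono)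
    qed (auto simp: h_def)
    then have swap: "(LINT \<xi>|lborel. LINT \<eta>|lborel. h \<eta> \<xi>) = (LINT \<eta>|lborel. LINT \<xi>|lborel. h \<eta> \<xi>)"
      by (rule lborel_pair.Fubini_integral)
    have "0 \<le> (LINT \<eta>|lborel. LINT \<xi>|lborel. h \<eta> \<xi>)"
    proof (rule integral_nonneg_AE, rule AE_I2)
      fix \<eta>
      have "(LINT \<xi>|lborel. h \<eta> \<xi>) = ?I \<eta> * (c n / sqrt (2 * pi)) * (LINT \<xi>|lborel. u \<xi> * gauss (c n) (\<xi> - \<eta>))"
        unfolding h_def by (rule integral_mult_right_zero)
      then show "0 \<le> (LINT \<xi>|lborel. h \<eta> \<xi>)"
        using c[of n] pos[OF c, of n \<eta>] by simp
    qed
    moreover have "(LINT \<xi>|lborel. LINT \<eta>|lborel. h \<eta> \<xi>) = (LINT \<xi>|lborel. u \<xi> * W n \<xi>)"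
    proof (rule Bochner_Integration.integral_cong[OF refl])
      fix \<xi>
      have "(LINT \<eta>|lborel. ?I \<eta> * (c n / sqrt (2 * pi)) * gauss (c n) (\<xi> - \<eta>)) =
          (1 / c n) * (LINT v|lborel. ?I (\<xi> + v / c n) * (c n / sqrt (2 * pi)) * gauss (c n) (- v / c n))"
        using lborel_integral_real_affine[of "1 / c n" "\<lambda>\<eta>. ?I \<eta> * (c n / sqrt (2 * pi)) * gauss (c n) (\<xi> - \<eta>)" \<xi>] c[of n]
        by simp
      also have "\<dots> = W n \<xi>"
        unfolding W_def integral_mult_right_zero[symmetric]
        using c[of n] by (intro Bochner_Integration.integral_cong) (auto simp: gauss_def std_normal_density_def)
      finally have "u \<xi> * (LINT \<eta>|lborel. ?I \<eta> * (c n / sqrt (2 * pi)) * gauss (c n) (\<xi> - \<eta>)) = u \<xi> * W n \<xi>"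
        by simp
      then show "(LINT \<eta>|lborel. h \<eta> \<xi>) = u \<xi> * W n \<xi>"
        unfolding h_def integral_mult_right_zero[symmetric] by (simp only: mult_ac)
    qed
    ultimately show ?thesis using swap by simp
  qed
  moreover have "(\<lambda>n. LINT \<xi>|lborel. u \<xi> * W n \<xi>) \<longlonglongrightarrow> (LINT \<xi>|lborel. u \<xi> * ?I \<xi>)"
  proof (rule integral_dominated_convergence[where w="\<lambda>\<xi>. \<bar>u \<xi>\<bar>"])
    have "AE \<xi> in lborel. \<xi> \<noteq> a" "AE \<xi> in lborel. \<xi> \<noteq> b"
      by (rule AE_lborel_singleton)+
    then show "AE \<xi> in lborel. (\<lambda>n. u \<xi> * W n \<xi>) \<longlonglongrightarrow> u \<xi> * ?I \<xi>"
      by eventually_elim (intro tendsto_intros W_lim)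
    show "AE \<xi> in lborel. norm (u \<xi> * W n \<xi>) \<le> \<bar>u \<xi>\<bar>" for n
      using W_le[of n] by (intro AE_I2) (auto simp: abs_mult intro!: mult_left_le)
  qed (use u in auto)
  ultimately show ?thesis
    by (intro LIMSEQ_le_const) auto
qed

text \<open>By Lebesgue differentiation \<open>u\<close> is, off a negligible set, the limit of its
  averages over short intervals to the right of a point, and these averages are nonnegative. The
  differentiation theorem speaks of gauge integrals and Lebesgue measure, hence the change of
  integral and of measure.\<close>

lemma AE_nonneg_if_gauss:
  fixes u :: "real \<Rightarrow> real"
  assumes u: "integrable lborel u"
    and pos: "\<And>c \<eta>. 0 < c \<Longrightarrow> 0 \<le> (LINT \<xi>|lborel. u \<xi> * gauss c (\<xi> - \<eta>))"
  shows "AE \<xi> in lborel. 0 \<le> u \<xi>"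
proof -
  note [measurable] = borel_measurable_integrable[OF u]
  have si: "set_integrable lborel {a..b} u" for a b
    using integrable_mult_indicator[of "{a..b}" lborel u] u by (simp add: set_integrable_def)
  have int: "u integrable_on {a..b}" "0 \<le> integral {a..b} u" for a b
  proof -
    show "u integrable_on {a..b}"
      by (rule set_borel_integral_eq_integral(1)[OF si])
    have "integral {a..b} u = (LINT \<xi>|lborel. u \<xi> * indicator {a..b} \<xi>)"
      using set_borel_integral_eq_integral(2)[OF si, of a b]
      by (simp add: set_lebesgue_integral_def mult.commute)
    then show "0 \<le> integral {a..b} u"
      using integral_interval_nonneg_if_gauss[OF u pos] by simp
  qed
  obtain N where N: "negligible N" and
    lim: "\<And>x e. \<lbrakk>x \<notin> N; 0 < e\<rbrakk> \<Longrightarrow>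
      \<exists>d>0. \<forall>h. 0 < h \<and> h < d \<longrightarrow> norm (integral (cbox x (x + h *\<^sub>R One)) u /\<^sub>R h ^ DIM(real) - u x) < e"
    using integrable_ccontinuous_explicit[of u] int(1) by (auto simp: cbox_interval)
  have "0 \<le> u x" if "x \<notin> N" for x
  proof (rule ccontr)
    assume "\<not> 0 \<le> u x"
    then have "\<exists>d>0. \<forall>h. 0 < h \<and> h < d \<longrightarrow> \<bar>integral {x..x+h} u / h - u x\<bar> < - u x"
      using lim[OF that, of "- u x"] by (auto simp: cbox_interval divide_inverse mult.commute)
    then obtain d where d: "d > 0" "\<And>h. 0 < h \<Longrightarrow> h < d \<Longrightarrow> \<bar>integral {x..x+h} u / h - u x\<bar> < - u x"
      by blast
    define q where "q = integral {x..x + d/2} u / (d/2)"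
    have "0 \<le> q"
      unfolding q_def using int(2) d(1) by (intro divide_nonneg_nonneg) auto
    moreover have "\<bar>q - u x\<bar> < - u x"
      unfolding q_def using d(1) by (intro d(2)) auto
    ultimately show False by linarith
  qed
  then have "AE x in lebesgue. 0 \<le> u x"
    using N by (auto simp: negligible_iff_null_sets intro!: AE_I'[of N])
  then show ?thesis
    by (subst (asm) AE_completion_iff) auto
qed

lemma gauss_minus_commute: "gauss c (a - b) = gauss c (b - a)"
  by (simp add: gauss_def power2_commute right_diff_distrib)

text \<open>Positivity is applied to both signs of the real part and of the imaginary part.\<close>

lemma AE_zero_if_gauss:
  fixes u :: "real \<Rightarrow> complex"
  assumes u: "integrable lborel u"
    and zero: "\<And>c \<eta>. 0 < c \<Longrightarrow> (LINT \<xi>|lborel. u \<xi> * of_real (gauss c (\<xi> - \<eta>))) = 0"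
  shows "AE \<xi> in lborel. u \<xi> = 0"
proof -
  have int: "integrable lborel (\<lambda>\<xi>. u \<xi> * of_real (gauss c (\<xi> - \<eta>)))" for c \<eta>
    using u by (rule integrable_mult_bounded[where C=1])
      (auto simp: less_imp_le[OF gauss_pos] gauss_le_1)
  have Re: "(LINT \<xi>|lborel. Re (u \<xi>) * gauss c (\<xi> - \<eta>)) = 0" if "0 < c" for c \<eta>
    using integral_Re[OF int[of c \<eta>]] zero[OF that, of \<eta>] by simp
  have Im: "(LINT \<xi>|lborel. Im (u \<xi>) * gauss c (\<xi> - \<eta>)) = 0" if "0 < c" for c \<eta>
    using integral_Im[OF int[of c \<eta>]] zero[OF that, of \<eta>] by simp
  have "AE \<xi> in lborel. 0 \<le> Re (u \<xi>)" "AE \<xi> in lborel. 0 \<le> - Re (u \<xi>)"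
    "AE \<xi> in lborel. 0 \<le> Im (u \<xi>)" "AE \<xi> in lborel. 0 \<le> - Im (u \<xi>)"
    using u Re Im by (auto intro!: AE_nonneg_if_gauss simp del: neg_0_le_iff_le)
  then show ?thesis
    by eventually_elim (auto simp: complex_eq_iff)
qed

text \<open>Each translated Gaussian is, up to a factor, \<open>ift\<close> of a modulated Gaussian,
  so the multiplication formula turns its pairing with \<open>u\<close> into an integral against
  \<open>ift u\<close>.\<close>

lemma AE_zero_if_ift_zero:
  assumes u: "integrable lborel u" and zero: "\<And>t. ift u t = 0"
  shows "AE \<xi> in lborel. u \<xi> = 0"
proof (rule AE_zero_if_gauss[OF u])
  fix c \<eta> :: real
  assume c: "0 < c"
  let ?k = "\<lambda>t. cis (- \<eta> * t) * complex_of_real (gauss (1/c) t)"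
  have "integrable lborel (\<lambda>t. complex_of_real (gauss (1/c) t) * cis (- \<eta> * t))"
    using c by (intro integrable_mult_bounded[where C=1] integrable_of_real_gauss) auto
  then have "(LINT \<xi>|lborel. u \<xi> * ift ?k \<xi>) = (LINT t|lborel. ift u t * ?k t)"
    using u by (intro integral_ift_mult[symmetric]) (simp_all add: mult.commute)
  then have "(LINT \<xi>|lborel. c * (u \<xi> * of_real (gauss c (\<xi> - \<eta>)))) = 0"
    using ift_gauss_cis[of "1/c" "-\<eta>"] c by (simp add: zero mult_ac)
  then show "(LINT \<xi>|lborel. u \<xi> * of_real (gauss c (\<xi> - \<eta>))) = 0"
    using c by simp
qed

text \<open>Bessel's inequality for the Fourier transform: regularise with a Gaussian, transfer it to the
  other side with the multiplication formula and bound the resulting double integral by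
  \<open>2 a b \<le> a\<^sup>2 + b\<^sup>2\<close>.\<close>

lemma normR_ift_gauss_le:
  assumes G: "integrable lborel G" "L2R G" and c: "0 < c"
  shows "ennreal (LINT t|lborel. (cmod (ift G t))\<^sup>2 * gauss c t) \<le> ennreal ((normR G)\<^sup>2)"
proof -
  note [measurable] = borel_measurable_integrable[OF G(1)] borel_measurable_ift[OF G(1)]
  define B where "B = 1 / sqrt (2 * pi) * (LINT \<xi>|lborel. cmod (G \<xi>))"
  define k where "k t = cnj (ift G t) * complex_of_real (gauss c t)" for t
  have k: "integrable lborel k"
    unfolding k_def using c norm_ift_le[of G]
    by (subst mult.commute) (auto intro!: integrable_mult_bounded[where C=B] integrable_of_real_gauss simp: B_def)
  \<comment> \<open>The transform of \<open>gauss c\<close> divided by \<open>sqrt (2 * pi)\<close>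
    is the normal density with standard deviation \<open>c\<close>. Its total mass 1 is what makes
    the final constant exactly 1.\<close>
  define \<Gamma> where "\<Gamma> = normal_density 0 c"
  have \<Gamma>: "\<Gamma> t = gauss (1 / c) t / c / sqrt (2 * pi)" for t
    using c by (simp add: \<Gamma>_def normal_density_def gauss_def real_sqrt_mult field_simps)
  have ift_k: "ift k \<xi> = (LINT \<eta>|lborel. cnj (G \<eta>) * of_real (\<Gamma> (\<xi> - \<eta>)))" for \<xi>
  proof -
    let ?G = "\<lambda>\<eta>. cnj (G (- \<eta>))"
    have iG: "integrable lborel ?G"
      using lborel_integrable_real_affine[OF G(1), of "-1" 0] by simp
    have "integrable lborel (\<lambda>t. cis (\<xi> * t) * complex_of_real (gauss c t))"
      using c by (subst mult.commute) (auto intro!: integrable_mult_bounded[where C=1] integrable_of_real_gauss)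
    then have "(LINT t|lborel. ift ?G t * (cis (\<xi> * t) * complex_of_real (gauss c t))) =
      (LINT \<eta>|lborel. ?G \<eta> * ift (\<lambda>t. cis (\<xi> * t) * complex_of_real (gauss c t)) \<eta>)"
      by (rule integral_ift_mult[OF iG])
    also have "\<dots> = (LINT \<eta>|lborel. ?G \<eta> * of_real (gauss (1 / c) (\<eta> + \<xi>) / c))"
      using c by (simp add: ift_gauss_cis)
    also have "\<dots> = (LINT \<eta>|lborel. cnj (G \<eta>) * of_real (gauss (1 / c) (\<xi> - \<eta>) / c))"
      using integral_reflect[of "\<lambda>\<eta>. ?G \<eta> * of_real (gauss (1 / c) (\<eta> + \<xi>) / c)", symmetric] by simp
    finally have "(LINT t|lborel. k t * cis (t * \<xi>)) = (LINT \<eta>|lborel. cnj (G \<eta>) * of_real (gauss (1 / c) (\<xi> - \<eta>) / c))"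
      unfolding k_def cnj_ift by (simp only: mult_ac)
    then have "ift k \<xi> = (LINT \<eta>|lborel. complex_of_real (1 / sqrt (2 * pi)) * (cnj (G \<eta>) * of_real (gauss (1 / c) (\<xi> - \<eta>) / c)))"
      unfolding integral_mult_right_zero ift_def by simp
    also have "\<dots> = (LINT \<eta>|lborel. cnj (G \<eta>) * of_real (\<Gamma> (\<xi> - \<eta>)))"
      by (intro Bochner_Integration.integral_cong) (simp_all add: \<Gamma>)
    finally show ?thesis .
  qed
  have "(LINT t|lborel. complex_of_real ((cmod (ift G t))\<^sup>2 * gauss c t)) = (LINT t|lborel. ift G t * k t)"
    by (intro Bochner_Integration.integral_cong) (auto simp: k_def complex_norm_square[of "ift G _"] simp del: of_real_power simp flip: mult.assoc)
  also have "\<dots> = (LINT \<xi>|lborel. G \<xi> * ift k \<xi>)"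
    by (rule integral_ift_mult[OF G(1) k])
  finally have eq: "complex_of_real (LINT t|lborel. (cmod (ift G t))\<^sup>2 * gauss c t) = (LINT \<xi>|lborel. G \<xi> * ift k \<xi>)"
    unfolding integral_complex_of_real .
  have Gk: "integrable lborel (\<lambda>\<xi>. G \<xi> * ift k \<xi>)"
    using k norm_ift_le[of k] by (intro integrable_mult_bounded[OF G(1)]) auto
  let ?g = "\<lambda>\<xi>. ennreal (cmod (G \<xi>))"
  have "ennreal (LINT t|lborel. (cmod (ift G t))\<^sup>2 * gauss c t) \<le> ennreal (cmod (LINT \<xi>|lborel. G \<xi> * ift k \<xi>))"
    unfolding eq[symmetric] by (simp add: ennreal_leI)
  also have "\<dots> \<le> (\<integral>\<^sup>+ \<xi>. ?g \<xi> * ennreal (cmod (ift k \<xi>)) \<partial>lborel)"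
    using integral_norm_bound_ennreal[OF Gk] by (simp add: norm_mult ennreal_mult)
  also have "\<dots> \<le> (\<integral>\<^sup>+ \<xi>. ?g \<xi> * (\<integral>\<^sup>+ \<eta>. ?g \<eta> * ennreal (\<Gamma> (\<xi> - \<eta>)) \<partial>lborel) \<partial>lborel)"
  proof (intro nn_integral_mono mult_left_mono)
    fix \<xi>
    have "integrable lborel (\<lambda>\<eta>. cnj (G \<eta>) * of_real (\<Gamma> (\<xi> - \<eta>)))"
      using c by (intro integrable_mult_bounded[where C="1 / c / sqrt (2 * pi)"] integrable_cnj G(1))
        (auto simp: \<Gamma> norm_divide norm_mult less_imp_le[OF gauss_pos] gauss_le_1 intro!: divide_right_mono)
    from integral_norm_bound_ennreal[OF this] c
    show "ennreal (cmod (ift k \<xi>)) \<le> (\<integral>\<^sup>+ \<eta>. ?g \<eta> * ennreal (\<Gamma> (\<xi> - \<eta>)) \<partial>lborel)"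
      by (simp add: ift_k norm_mult ennreal_mult \<Gamma>_def normal_density_nonneg)
  qed auto
  also have "\<dots> = (\<integral>\<^sup>+ \<xi>. \<integral>\<^sup>+ \<eta>. ennreal (cmod (G \<xi>) * cmod (G \<eta>) * \<Gamma> (\<xi> - \<eta>)) \<partial>lborel \<partial>lborel)"
    by (auto simp: nn_integral_cmult[symmetric] ennreal_mult \<Gamma>_def normal_density_nonneg mult.assoc intro!: nn_integral_cong)
  also have "\<dots> \<le> (\<integral>\<^sup>+ \<xi>. \<integral>\<^sup>+ \<eta>. ennreal ((cmod (G \<xi>))\<^sup>2 / 2 * \<Gamma> (\<xi> - \<eta>)) + ennreal ((cmod (G \<eta>))\<^sup>2 / 2 * \<Gamma> (\<xi> - \<eta>)) \<partial>lborel \<partial>lborel)"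
  proof (intro nn_integral_mono)
    fix \<xi> \<eta>
    have "cmod (G \<xi>) * cmod (G \<eta>) * \<Gamma> (\<xi> - \<eta>) \<le> ((cmod (G \<xi>))\<^sup>2 / 2 + (cmod (G \<eta>))\<^sup>2 / 2) * \<Gamma> (\<xi> - \<eta>)"
      using sum_squares_bound[of "cmod (G \<xi>)" "cmod (G \<eta>)"]
      by (intro mult_right_mono) (auto simp: \<Gamma>_def normal_density_nonneg)
    then show "ennreal (cmod (G \<xi>) * cmod (G \<eta>) * \<Gamma> (\<xi> - \<eta>)) \<le>
        ennreal ((cmod (G \<xi>))\<^sup>2 / 2 * \<Gamma> (\<xi> - \<eta>)) + ennreal ((cmod (G \<eta>))\<^sup>2 / 2 * \<Gamma> (\<xi> - \<eta>))"
      by (subst ennreal_plus[symmetric]) (auto simp: \<Gamma>_def normal_density_nonneg distrib_right simp del: ennreal_plus intro!: ennreal_leI)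
  qed
  also have "\<dots> = (\<integral>\<^sup>+ \<xi>. \<integral>\<^sup>+ \<eta>. ennreal ((cmod (G \<xi>))\<^sup>2 / 2) * ennreal (\<Gamma> (\<xi> - \<eta>)) \<partial>lborel \<partial>lborel) +
      (\<integral>\<^sup>+ \<eta>. \<integral>\<^sup>+ \<xi>. ennreal ((cmod (G \<eta>))\<^sup>2 / 2) * ennreal (\<Gamma> (\<xi> - \<eta>)) \<partial>lborel \<partial>lborel)"
    by (subst lborel_pair.Fubini'[where f="\<lambda>\<xi> \<eta>. ennreal ((cmod (G \<eta>))\<^sup>2 / 2) * ennreal (\<Gamma> (\<xi> - \<eta>))"])
      (auto simp: \<Gamma>_def normal_density_nonneg nn_integral_add ennreal_mult[symmetric])
  also have "\<dots> = (\<integral>\<^sup>+ \<xi>. ennreal ((cmod (G \<xi>))\<^sup>2 / 2) \<partial>lborel) + (\<integral>\<^sup>+ \<xi>. ennreal ((cmod (G \<xi>))\<^sup>2 / 2) \<partial>lborel)"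
  proof -
    have *: "(\<integral>\<^sup>+ \<eta>. ennreal (\<Gamma> \<eta>) \<partial>lborel) = 1"
      using c by (subst nn_integral_eq_integral) (auto simp: \<Gamma>_def normal_density_nonneg)
    have "(\<integral>\<^sup>+ \<eta>. ennreal (\<Gamma> (\<xi> - \<eta>)) \<partial>lborel) = 1" "(\<integral>\<^sup>+ \<eta>. ennreal (\<Gamma> (\<eta> - \<xi>)) \<partial>lborel) = 1" for \<xi>
      using * nn_integral_real_affine[of "\<lambda>\<eta>. ennreal (\<Gamma> \<eta>)" "-1" \<xi>] nn_integral_real_affine[of "\<lambda>\<eta>. ennreal (\<Gamma> \<eta>)" 1 "-\<xi>"]
      by (auto simp: \<Gamma>_def)
    then show ?thesis
      by (simp add: nn_integral_cmult \<Gamma>_def)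
  qed
  also have "\<dots> = (\<integral>\<^sup>+ \<xi>. ennreal ((cmod (G \<xi>))\<^sup>2) \<partial>lborel)"
    by (subst nn_integral_add[symmetric]) (auto simp flip: ennreal_plus)
  also have "\<dots> = ennreal ((normR G)\<^sup>2)"
    using normR_square_nn_integral[OF G(2)] by simp
  finally show ?thesis .
qed

text \<open>The Gaussian weight enters through its square root, so that the square of
  \<open>u n\<close> carries the weight of the preceding inequality. The weight tends to 1 pointwise
  as its width grows, and Fatou's lemma keeps the bound.\<close>

lemma
  assumes G: "integrable lborel G" "L2R G"
  shows L2R_ift: "L2R (ift G)" and normR_ift_le: "normR (ift G) \<le> normR G"
proof -
  note [measurable] = borel_measurable_integrable[OF G(1)] borel_measurable_ift[OF G(1)]
  define u where "u n t = ift G t * of_real (sqrt (gauss (1 / Suc n) t))" for n t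
  have u_meas [measurable]: "u n \<in> borel_measurable borel" for n
    unfolding u_def by measurable
  have u: "L2R (u n)" "normR (u n) \<le> normR G" for n
  proof -
    have "(\<integral>\<^sup>+ x. ennreal ((cmod (u n x))\<^sup>2) \<partial>lborel) = (\<integral>\<^sup>+ x. ennreal ((cmod (ift G x))\<^sup>2 * gauss (1 / Suc n) x) \<partial>lborel)"
      by (simp add: u_def norm_mult power_mult_distrib less_imp_le[OF gauss_pos])
    also have "\<dots> = ennreal (LINT t|lborel. (cmod (ift G t))\<^sup>2 * gauss (1 / Suc n) t)"
    proof (rule nn_integral_eq_integral)
      have "integrable lborel (\<lambda>t. complex_of_real (gauss (1 / Suc n) t) * (ift G t * cnj (ift G t)))"
        using norm_ift_le[of G] less_imp_le[OF gauss_pos]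
        by (intro integrable_mult_bounded[where C="(1 / sqrt (2 * pi) * (LINT \<xi>|lborel. cmod (G \<xi>)))\<^sup>2"] integrable_of_real_gauss)
          (auto simp: norm_mult power2_eq_square[symmetric] simp del: times_divide_eq_left intro!: power_mono)
      then have "integrable lborel (\<lambda>t. complex_of_real (gauss (1 / Suc n) t * (cmod (ift G t))\<^sup>2))"
        by (simp only: complex_norm_square[symmetric] of_real_mult[symmetric])
      then show "integrable lborel (\<lambda>t. (cmod (ift G t))\<^sup>2 * gauss (1 / Suc n) t)"
        by (subst (asm) complex_of_real_integrable_eq) (simp add: mult.commute)
    qed (auto simp: less_imp_le[OF gauss_pos])
    also have "\<dots> \<le> ennreal ((normR G)\<^sup>2)"
      by (rule normR_ift_gauss_le[OF G]) simp
    finally have *: "(\<integral>\<^sup>+ x. ennreal ((cmod (u n x))\<^sup>2) \<partial>lborel) \<le> ennreal ((normR G)\<^sup>2)" .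
    show "L2R (u n)" "normR (u n) \<le> normR G"
      using L2R_leI[OF _ _ *] by auto
  qed
  have "(\<lambda>n. u n t) \<longlonglongrightarrow> ift G t" for t
  proof -
    define a where "a n = 1 / real (Suc n) * t" for n
    have "a \<longlonglongrightarrow> 0 * t"
      unfolding a_def by (intro tendsto_mult tendsto_const LIMSEQ_inverse_real_of_nat[unfolded inverse_eq_divide])
    then have "(\<lambda>n. u n t) \<longlonglongrightarrow> ift G t * of_real (sqrt (exp (- ((0 * t)\<^sup>2 / 2))))"
      unfolding u_def gauss_def a_def[symmetric] by (intro tendsto_intros) auto
    then show ?thesis by simp
  qed
  then show "L2R (ift G)" "normR (ift G) \<le> normR G"
    using L2R_Fatou[of u "ift G" "normR G"] u by auto
qed

section \<open>Fourier transforms of square-integrable functions\<close>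

text \<open>A sequence of indices with \<tau> below \<open>(1/2) ^ n\<close> converges almost
  everywhere; Fatou's lemma then bounds the distance from every \<open>u i\<close> to the limit, not
  only along that sequence. The index type is left open because the families in use are indexed by a
  truncation radius and by lists.\<close>

lemma L2R_complete:
  fixes u :: "'i \<Rightarrow> real \<Rightarrow> complex"
  assumes u: "\<And>i. L2R (u i)"
    and Cauchy: "\<And>i j. normR (\<lambda>x. u i x - u j x) \<le> \<tau> i + \<tau> j"
    and small: "\<And>e. 0 < e \<Longrightarrow> \<exists>i. \<tau> i < e"
  obtains F where "L2R F" "\<And>i. normR (\<lambda>x. u i x - F x) \<le> \<tau> i"
proof -
  have "\<exists>i. \<tau> i < (1/2) ^ n" for n :: nat
    by (rule small) simp
  then obtain I where I: "\<And>n::nat. \<tau> (I n) < (1/2) ^ n" by metis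
  note [measurable] = u[THEN L2R_measurable]
  have "AE x in lborel. convergent (\<lambda>n. u (I n) x)"
  proof (rule L2R_rapid_Cauchy_AE_convergent)
    fix n
    have "normR (\<lambda>x. u (I (Suc n)) x - u (I n) x) \<le> (1/2) ^ Suc n + (1/2) ^ n"
      using Cauchy[of "I (Suc n)" "I n"] I[of n] I[of "Suc n"] by linarith
    also have "\<dots> \<le> 2 * (1/2) ^ n" by simp
    finally have "(normR (\<lambda>x. u (I (Suc n)) x - u (I n) x))\<^sup>2 \<le> (2 * (1/2) ^ n)\<^sup>2"
      by (intro power_mono) auto
    also have "((1/2::real) ^ n)\<^sup>2 = ((1/2)\<^sup>2) ^ n"
      by (simp only: power_mult[symmetric] mult.commute)
    then have "(2 * (1/2::real) ^ n)\<^sup>2 = 4 * (1/4) ^ n"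
      by (simp only: power_mult_distrib) (simp add: power2_eq_square)
    finally show "(normR (\<lambda>x. u (I (Suc n)) x - u (I n) x))\<^sup>2 \<le> 4 * (1/4) ^ n" .
  qed (auto intro: u)
  define F where "F x = lim (\<lambda>n. u (I n) x)" for x
  have [measurable]: "F \<in> borel_measurable borel"
    unfolding F_def by measurable
  have lim: "AE x in lborel. (\<lambda>n. u (I n) x) \<longlonglongrightarrow> F x"
    using \<open>AE x in lborel. convergent (\<lambda>n. u (I n) x)\<close>
    by eventually_elim (simp add: F_def convergent_LIMSEQ_iff)
  have *: "L2R (\<lambda>x. u i x - F x)" "normR (\<lambda>x. u i x - F x) \<le> \<tau> i + (1/2) ^ m" for i m
  proof -
    have "AE x in lborel. (\<lambda>n. u i x - u (I (n + m)) x) \<longlonglongrightarrow> u i x - F x"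
      using lim by eventually_elim (intro tendsto_intros LIMSEQ_ignore_initial_segment)
    moreover have "normR (\<lambda>x. u i x - u (I (n + m)) x) \<le> \<tau> i + (1/2) ^ m" for n
    proof -
      have "(1/2::real) ^ (n + m) \<le> (1/2) ^ m"
        by (rule power_decreasing) auto
      then show ?thesis
        using Cauchy[of i "I (n + m)"] I[of "n + m"] by linarith
    qed
    ultimately show "L2R (\<lambda>x. u i x - F x)" "normR (\<lambda>x. u i x - F x) \<le> \<tau> i + (1/2) ^ m"
      using L2R_Fatou[of "\<lambda>n x. u i x - u (I (n + m)) x" "\<lambda>x. u i x - F x" "\<tau> i + (1/2) ^ m"] u by auto
  qed
  show ?thesis
  proof
    show "L2R F"
      using L2R_diff[OF u *(1), of "I 0" "I 0"] by simp
    fix i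
    have "(\<lambda>m. \<tau> i + (1/2) ^ m) \<longlonglongrightarrow> \<tau> i + 0"
      by (intro tendsto_intros LIMSEQ_power_zero) auto
    then show "normR (\<lambda>x. u i x - F x) \<le> \<tau> i"
      using *(2) by (intro LIMSEQ_le_const) auto
  qed
qed

lemma tendsto_zero_dominated:
  fixes f g :: "'a \<Rightarrow> real"
  assumes "\<And>x. 0 \<le> f x" "\<And>x. f x \<le> g x" "(g \<longlongrightarrow> 0) F"
  shows "(f \<longlongrightarrow> 0) F"
  by (rule tendsto_sandwich[OF _ _ tendsto_const assms(3)]) (auto simp: assms)

lemma ift_translate: "ift (\<lambda>\<xi>. G (\<xi> + s)) t = cis (- (s * t)) * ift G t"
proof -
  have "(LINT \<xi>|lborel. G \<xi> * cis (\<xi> * t)) = (LINT \<xi>|lborel. G (\<xi> + s) * cis ((\<xi> + s) * t))"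
    using lborel_integral_real_affine[of 1 "\<lambda>\<xi>. G \<xi> * cis (\<xi> * t)" s] by (simp add: add.commute)
  also have "\<dots> = (LINT \<xi>|lborel. cis (s * t) * (G (\<xi> + s) * cis (\<xi> * t)))"
  proof (rule Bochner_Integration.integral_cong[OF refl])
    fix \<xi>
    have "cis ((\<xi> + s) * t) = cis (s * t) * cis (\<xi> * t)"
      by (simp add: cis_mult algebra_simps)
    then show "G (\<xi> + s) * cis ((\<xi> + s) * t) = cis (s * t) * (G (\<xi> + s) * cis (\<xi> * t))"
      by (simp only: mult_ac)
  qed
  also have "\<dots> = cis (s * t) * (LINT \<xi>|lborel. G (\<xi> + s) * cis (\<xi> * t))"
    by simp
  finally have "cis (- (s * t)) * (LINT \<xi>|lborel. G \<xi> * cis (\<xi> * t)) = (LINT \<xi>|lborel. G (\<xi> + s) * cis (\<xi> * t))"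
    by (simp add: mult.assoc[symmetric] cis_mult)
  then show ?thesis
    by (simp only: ift_def mult.left_commute[of "cis (- (s * t))"])
qed

lemma ift_reflect: "ift (\<lambda>\<xi>. G (- \<xi>)) t = ift G (- t)"
  using integral_reflect[of "\<lambda>\<xi>. G \<xi> * cis (\<xi> * - t)"] by (simp add: ift_def)

lemma L2R_reflect: "L2R f \<Longrightarrow> L2R (\<lambda>x. f (- x))"
  and normR_reflect: "normR (\<lambda>x. f (- x)) = normR f"
proof -
  have eq: "(LINT x|lborel. (cmod (f (- x)))\<^sup>2) = (LINT x|lborel. (cmod (f x))\<^sup>2)"
    using lborel_integral_real_affine[of "-1" "\<lambda>x. (cmod (f x))\<^sup>2" 0] by simp
  then show "normR (\<lambda>x. f (- x)) = normR f"
    by (simp add: normR_def)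
  assume f: "L2R f"
  note [measurable] = L2R_measurable[OF f]
  have "(\<lambda>x. f (- x)) \<in> borel_measurable borel" by measurable
  moreover have "integrable lborel (\<lambda>x. (cmod (f (- x)))\<^sup>2)"
    using lborel_integrable_real_affine[of "\<lambda>x. (cmod (f x))\<^sup>2" "-1" 0] f by (simp add: L2R_def)
  ultimately show "L2R (\<lambda>x. f (- x))"
    by (simp add: L2R_def)
qed

lemma L2R_gauss:
  assumes "c \<noteq> 0"
  shows "L2R (\<lambda>t. complex_of_real (gauss c (t + s)))"
proof -
  have "integrable lborel (\<lambda>t. gauss c (s + 1 * t))"
    using assms by (intro lborel_integrable_real_affine integrable_gauss) auto
  then have "integrable lborel (\<lambda>t. (gauss c (t + s))\<^sup>2)"
    by (rule Bochner_Integration.integrable_bound)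
      (auto simp: power2_eq_square add.commute less_imp_le[OF gauss_pos] gauss_le_1 intro!: mult_left_le)
  then show ?thesis
    by (simp add: L2R_def less_imp_le[OF gauss_pos])
qed

lemma integrable_gauss_translate:
  "c \<noteq> 0 \<Longrightarrow> integrable lborel (\<lambda>t. complex_of_real (gauss c (t + s)))"
  using lborel_integrable_real_affine[OF integrable_of_real_gauss, of c 1 s] by (simp add: add.commute)

section \<open>Truncated transforms, Plancherel extension and inversion\<close>

definition trunc :: "(real \<Rightarrow> complex) \<Rightarrow> real \<Rightarrow> real \<Rightarrow> complex" where
  "trunc f R x = indicator {-R..R} x *\<^sub>R f x"

lemma ft_trunc_eq_ift: "ft_trunc f R \<xi> = ift (trunc f R) (- \<xi>)"
  by (simp add: ft_trunc_def ift_def trunc_def[abs_def] set_lebesgue_integral_def mult.commute[of \<xi>])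

lemma L2R_indicator:
  assumes "A \<in> sets borel" "emeasure lborel A < \<infinity>"
  shows "L2R (\<lambda>x. complex_of_real (indicator A x))"
proof -
  have "(\<lambda>x. (cmod (complex_of_real (indicator A x)))\<^sup>2) = indicat_real A"
    by (auto simp: fun_eq_iff split: split_indicator)
  then show ?thesis
    using assms by (auto simp: L2R_def intro!: integrable_real_indicator)
qed

lemma L2R_trunc:
  assumes "L2R f"
  shows "L2R (trunc f R)"
  using L2R_mult_bounded(1)[OF _ assms, of "\<lambda>x. complex_of_real (indicator {-R..R} x)" 1]
  by (simp add: trunc_def[abs_def] scaleR_conv_of_real indicator_le_1)

lemma integrable_trunc:
  assumes "L2R f"
  shows "integrable lborel (trunc f R)"
  using L2R_mult_integrable[OF L2R_indicator assms, of "{-R..R}"]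
  by (simp add: trunc_def[abs_def] scaleR_conv_of_real emeasure_lborel_Icc_eq)

lemma L2R_ft_trunc: "L2R f \<Longrightarrow> L2R (ft_trunc f R)"
  and normR_ft_trunc: "L2R f \<Longrightarrow> normR (ft_trunc f R) \<le> normR (trunc f R)"
  using L2R_reflect[OF L2R_ift[OF integrable_trunc[of f R] L2R_trunc]]
    normR_reflect[of "ift (trunc f R)"] normR_ift_le[OF integrable_trunc[of f R] L2R_trunc]
  by (simp_all add: ft_trunc_eq_ift[abs_def])

lemma normR_trunc_le: "L2R f \<Longrightarrow> normR (trunc f R) \<le> normR f"
  using L2R_mult_bounded(2)[of "\<lambda>x. complex_of_real (indicator {-R..R} x)" f 1]
  by (simp add: trunc_def[abs_def] scaleR_conv_of_real indicator_le_1)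

lemma ft_trunc_diff:
  assumes "L2R f" "L2R g"
  shows "ft_trunc (\<lambda>x. f x - g x) R \<xi> = ft_trunc f R \<xi> - ft_trunc g R \<xi>"
proof -
  have "trunc (\<lambda>x. f x - g x) R = (\<lambda>x. trunc f R x - trunc g R x)"
    by (simp add: trunc_def fun_eq_iff scaleR_diff_right)
  then show ?thesis
    using assms by (simp add: ft_trunc_eq_ift ift_diff integrable_trunc)
qed

lemma normR_trunc_tail:
  assumes "L2R f"
  shows "((\<lambda>R. normR (\<lambda>x. trunc f R x - f x)) \<longlongrightarrow> 0) at_top"
proof -
  note [measurable] = L2R_measurable[OF assms]
  have "((\<lambda>R. integral\<^sup>L lborel (\<lambda>x. (cmod (trunc f R x - f x))\<^sup>2)) \<longlongrightarrow> integral\<^sup>L lborel (\<lambda>x::real. (0::real))) at_top"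
  proof (rule integral_dominated_convergence_at_top[where w="\<lambda>x. (cmod (f x))\<^sup>2" and f="\<lambda>x::real. 0::real" and M=lborel])
    show "AE x in lborel. ((\<lambda>R. (cmod (trunc f R x - f x))\<^sup>2) \<longlongrightarrow> 0) at_top"
    proof (intro AE_I2 tendsto_eventually)
      fix x
      show "\<forall>\<^sub>F R in at_top. (cmod (trunc f R x - f x))\<^sup>2 = 0"
        using eventually_ge_at_top[of "\<bar>x\<bar>"] by eventually_elim (auto simp: trunc_def indicator_def)
    qed
  qed (use assms in \<open>auto simp: L2R_def trunc_def split: split_indicator\<close>)
  then have "((\<lambda>R. sqrt (LINT x|lborel. (cmod (trunc f R x - f x))\<^sup>2)) \<longlongrightarrow> sqrt 0) at_top"
    by (intro tendsto_real_sqrt) simp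
  then show ?thesis
    by (simp add: normR_def)
qed

text \<open>Bessel's inequality bounds the distance of two truncated transforms by the distance of
  the truncations, so the truncation errors serve as \<tau> in the completeness lemma.\<close>

lemma fourier_rel_exists:
  assumes f: "L2R f"
  obtains F where "fourier_rel f F"
proof -
  define \<tau> where "\<tau> R = normR (\<lambda>x. trunc f R x - f x)" for R
  have \<tau>: "(\<tau> \<longlongrightarrow> 0) at_top"
    unfolding \<tau>_def by (rule normR_trunc_tail[OF f])
  note L2 = L2R_trunc[OF f] f L2R_ft_trunc[OF f]
  have "normR (\<lambda>\<xi>. ft_trunc f R \<xi> - ft_trunc f S \<xi>) \<le> \<tau> R + \<tau> S" for R S
  proof -
    let ?d = "\<lambda>x. trunc f R x - trunc f S x"
    have "normR (\<lambda>\<xi>. ft_trunc f R \<xi> - ft_trunc f S \<xi>) = normR (\<lambda>\<xi>. ift ?d (- \<xi>))"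
      by (simp add: ft_trunc_eq_ift ift_diff integrable_trunc f)
    also have "\<dots> \<le> normR ?d"
      unfolding normR_reflect[of "ift ?d"]
      by (rule normR_ift_le) (auto intro: L2 integrable_trunc f)
    also have "\<dots> \<le> \<tau> R + \<tau> S"
      unfolding \<tau>_def normR_minus_commute[of "trunc f S"]
      by (rule normR_triangle_via) (auto intro: L2)
    finally show ?thesis .
  qed
  moreover have "\<exists>R. \<tau> R < e" if "0 < e" for e
    using order_tendstoD(2)[OF \<tau> that] eventually_happens[of _ "at_top :: real filter"] by auto
  ultimately obtain F where F: "L2R F" "\<And>R. normR (\<lambda>\<xi>. ft_trunc f R \<xi> - F \<xi>) \<le> \<tau> R"
    using L2R_complete[of "ft_trunc f" \<tau>] L2 by metis
  have "((\<lambda>R. normR (\<lambda>\<xi>. ft_trunc f R \<xi> - F \<xi>)) \<longlongrightarrow> 0) at_top"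
    by (rule tendsto_zero_dominated[OF _ F(2) \<tau>]) simp
  then show ?thesis
    using that f F(1) by (auto simp: fourier_rel_def)
qed

lemma fourier_rel_L2R: "fourier_rel f F \<Longrightarrow> L2R f" "fourier_rel f F \<Longrightarrow> L2R F"
  by (auto simp: fourier_rel_def)

lemma fourier_rel_normR_le:
  assumes "fourier_rel f F"
  shows "normR F \<le> normR f"
proof -
  note L2 = fourier_rel_L2R[OF assms]
  have "normR F \<le> normR (\<lambda>\<xi>. ft_trunc f R \<xi> - F \<xi>) + normR f" for R
  proof -
    have "normR F \<le> normR (\<lambda>\<xi>. F \<xi> - ft_trunc f R \<xi>) + normR (ft_trunc f R)"
      by (intro normR_le_add_diff L2 L2R_ft_trunc)
    then show ?thesis
      using normR_ft_trunc[OF L2(1), of R] normR_trunc_le[OF L2(1), of R]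
      by (simp add: normR_minus_commute[of F])
  qed
  moreover have "((\<lambda>R. normR (\<lambda>\<xi>. ft_trunc f R \<xi> - F \<xi>) + normR f) \<longlongrightarrow> 0 + normR f) at_top"
    using assms by (intro tendsto_intros) (auto simp: fourier_rel_def)
  ultimately have "normR F \<le> 0 + normR f"
    by (intro tendsto_lowerbound[of _ "0 + normR f" "at_top :: real filter"] always_eventually allI) auto
  then show ?thesis by simp
qed

lemma fourier_rel_diff:
  assumes "fourier_rel f F" "fourier_rel g G"
  shows "fourier_rel (\<lambda>x. f x - g x) (\<lambda>\<xi>. F \<xi> - G \<xi>)"
proof -
  note L2 = assms[THEN fourier_rel_L2R(1)] assms[THEN fourier_rel_L2R(2)]
  have le: "normR (\<lambda>\<xi>. ft_trunc (\<lambda>x. f x - g x) R \<xi> - (F \<xi> - G \<xi>)) \<le>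
      normR (\<lambda>\<xi>. ft_trunc f R \<xi> - F \<xi>) + normR (\<lambda>\<xi>. ft_trunc g R \<xi> - G \<xi>)" for R
    using normR_triangle_diff[of "\<lambda>\<xi>. ft_trunc f R \<xi> - F \<xi>" "\<lambda>\<xi>. ft_trunc g R \<xi> - G \<xi>"] L2
    by (simp add: ft_trunc_diff L2R_ft_trunc L2R_diff algebra_simps)
  have "((\<lambda>R. normR (\<lambda>\<xi>. ft_trunc f R \<xi> - F \<xi>) + normR (\<lambda>\<xi>. ft_trunc g R \<xi> - G \<xi>)) \<longlongrightarrow> 0) at_top"
    using assms by (intro tendsto_add_zero) (auto simp: fourier_rel_def)
  from tendsto_zero_dominated[OF normR_nonneg le this]
  have "((\<lambda>R. normR (\<lambda>\<xi>. ft_trunc (\<lambda>x. f x - g x) R \<xi> - (F \<xi> - G \<xi>))) \<longlongrightarrow> 0) at_top" .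
  then show ?thesis
    using L2 by (auto simp: fourier_rel_def)
qed

lemma fourier_rel_cong_AE:
  assumes "fourier_rel f F" "G \<in> borel_measurable borel" "AE \<xi> in lborel. G \<xi> = F \<xi>"
  shows "fourier_rel f G"
proof -
  note L2 = fourier_rel_L2R[OF assms(1)]
  note [measurable] = assms(2) L2(2)[THEN L2R_measurable] L2R_ft_trunc[OF L2(1), THEN L2R_measurable]
  have "normR (\<lambda>\<xi>. ft_trunc f R \<xi> - G \<xi>) = normR (\<lambda>\<xi>. ft_trunc f R \<xi> - F \<xi>)" for R
    by (rule normR_cong_AE) (use assms(3) in auto)
  then show ?thesis
    using assms(1) L2R_cong_AE[OF assms(2) L2(2) assms(3)] by (simp add: fourier_rel_def)
qed

text \<open>The multiplication formula holds for truncations and passes to the limit by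
  Cauchy-Schwarz on both sides. The reflected argument appears because \<open>ft_trunc\<close> and
  \<open>ift\<close> have opposite signs.\<close>

lemma fourier_rel_pairing:
  assumes "fourier_rel f F" and k: "integrable lborel k" "L2R k"
  shows "(LINT \<xi>|lborel. F \<xi> * k \<xi>) = (LINT t|lborel. f t * ift k (- t))"
proof -
  note L2 = fourier_rel_L2R[OF assms(1)]
  let ?q = "\<lambda>t. ift k (- t)"
  have q: "L2R ?q"
    by (rule L2R_reflect[OF L2R_ift[OF k]])
  have "((\<lambda>R. LINT \<xi>|lborel. ft_trunc f R \<xi> * k \<xi>) \<longlongrightarrow> (LINT \<xi>|lborel. F \<xi> * k \<xi>)) at_top"
  proof (rule Lim_null[THEN iffD2], rule Lim_null_comparison)
    show "\<forall>\<^sub>F R in at_top. norm ((LINT \<xi>|lborel. ft_trunc f R \<xi> * k \<xi>) - (LINT \<xi>|lborel. F \<xi> * k \<xi>))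
        \<le> normR (\<lambda>\<xi>. ft_trunc f R \<xi> - F \<xi>) * normR k"
    proof (rule always_eventually, rule allI)
      fix R
      have "(LINT \<xi>|lborel. ft_trunc f R \<xi> * k \<xi>) - (LINT \<xi>|lborel. F \<xi> * k \<xi>) = (LINT \<xi>|lborel. (ft_trunc f R \<xi> - F \<xi>) * k \<xi>)"
        using L2R_mult_integrable[OF L2R_ft_trunc[OF L2(1)] k(2)] L2R_mult_integrable[OF L2(2) k(2)]
        by (simp add: left_diff_distrib)
      then show "norm ((LINT \<xi>|lborel. ft_trunc f R \<xi> * k \<xi>) - (LINT \<xi>|lborel. F \<xi> * k \<xi>))
        \<le> normR (\<lambda>\<xi>. ft_trunc f R \<xi> - F \<xi>) * normR k"
        using L2R_Cauchy_Schwarz[OF L2R_diff[OF L2R_ft_trunc[OF L2(1)] L2(2)] k(2)] by simp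
    qed
    show "((\<lambda>R. normR (\<lambda>\<xi>. ft_trunc f R \<xi> - F \<xi>) * normR k) \<longlongrightarrow> 0) at_top"
      using assms(1) by (intro tendsto_mult_left_zero) (auto simp: fourier_rel_def)
  qed
  moreover have "((\<lambda>R. LINT t|lborel. trunc f R t * ?q t) \<longlongrightarrow> (LINT t|lborel. f t * ?q t)) at_top"
  proof (rule Lim_null[THEN iffD2], rule Lim_null_comparison)
    show "\<forall>\<^sub>F R in at_top. norm ((LINT t|lborel. trunc f R t * ?q t) - (LINT t|lborel. f t * ?q t))
        \<le> normR (\<lambda>t. trunc f R t - f t) * normR ?q"
    proof (rule always_eventually, rule allI)
      fix R
      have "(LINT t|lborel. trunc f R t * ?q t) - (LINT t|lborel. f t * ?q t) = (LINT t|lborel. (trunc f R t - f t) * ?q t)"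
        using L2R_mult_integrable[OF L2R_trunc[OF L2(1)] q] L2R_mult_integrable[OF L2(1) q]
        by (simp add: left_diff_distrib)
      then show "norm ((LINT t|lborel. trunc f R t * ?q t) - (LINT t|lborel. f t * ?q t))
        \<le> normR (\<lambda>t. trunc f R t - f t) * normR ?q"
        using L2R_Cauchy_Schwarz[OF L2R_diff[OF L2R_trunc[OF L2(1)] L2(1)] q] by simp
    qed
    show "((\<lambda>R. normR (\<lambda>t. trunc f R t - f t) * normR ?q) \<longlongrightarrow> 0) at_top"
      by (intro tendsto_mult_left_zero normR_trunc_tail L2)
  qed
  moreover have "(LINT \<xi>|lborel. ft_trunc f R \<xi> * k \<xi>) = (LINT t|lborel. trunc f R t * ?q t)" for R
  proof -
    have "(LINT \<xi>|lborel. ft_trunc f R \<xi> * k \<xi>) = (LINT \<xi>|lborel. ift (trunc f R) \<xi> * k (- \<xi>))"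
      using integral_reflect[of "\<lambda>\<xi>. ift (trunc f R) \<xi> * k (- \<xi>)"] by (simp add: ft_trunc_eq_ift)
    also have "\<dots> = (LINT t|lborel. trunc f R t * ift (\<lambda>\<xi>. k (- \<xi>)) t)"
      using lborel_integrable_real_affine[OF k(1), of "-1" 0]
      by (intro integral_ift_mult integrable_trunc L2) simp
    finally show ?thesis
      by (simp add: ift_reflect)
  qed
  ultimately show ?thesis
    by (intro tendsto_unique[of at_top]) auto
qed

lemma continuous_AE_eq_imp_eq:
  fixes f g :: "real \<Rightarrow> complex"
  assumes "continuous_on UNIV f" "continuous_on UNIV g" "AE x in lborel. f x = g x"
  shows "f = g"
proof
  fix x
  have "closed {x. f x = g x}"
    using closed_Collect_eq[OF assms(1,2)] .
  moreover have "AE x in lebesgue. x \<in> {x. f x = g x}"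
    using AE_completion[OF assms(3)] by simp
  ultimately show "f x = g x"
    using mem_closed_if_AE_lebesgue[of "{x. f x = g x}" x] by simp
qed

text \<open>The factor \<open>gauss 1\<close> makes \<open>f\<close> and \<open>ift F\<close>
  integrable, so injectivity of \<open>ift\<close> can be applied to their difference; both have the
  same pairings with modulated Gaussians. The factor is positive and is cancelled
  afterwards.\<close>

lemma fourier_inversion:
  assumes fF: "fourier_rel f F" and F: "integrable lborel F" and f: "continuous_on UNIV f"
  shows "f = ift F"
proof (rule continuous_AE_eq_imp_eq[OF f ift_continuous[OF F]])
  note L2 = fourier_rel_L2R[OF fF]
  have f_int: "integrable lborel (\<lambda>t. f t * of_real (gauss 1 t))"
    using L2R_mult_integrable[OF L2(1) L2R_gauss[of 1 0]] by simp
  have F_int: "integrable lborel (\<lambda>t. ift F t * of_real (gauss 1 t))"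
    using norm_ift_le[of F] F
    by (subst mult.commute) (intro integrable_mult_bounded[OF integrable_of_real_gauss], auto)
  let ?d = "\<lambda>t. f t * of_real (gauss 1 t) - ift F t * of_real (gauss 1 t)"
  have "AE t in lborel. ?d t = 0"
  proof (rule AE_zero_if_ift_zero)
    fix s
    have "(LINT t|lborel. ift F t * (cis (s * t) * of_real (gauss 1 t))) = (LINT \<xi>|lborel. F \<xi> * of_real (gauss 1 (\<xi> + s)))"
      using integral_ift_mult[OF F integrable_mult_cis[OF integrable_of_real_gauss], of 1 s] ift_gauss_cis[of 1 s]
      by (simp add: mult.commute)
    also have "\<dots> = (LINT t|lborel. f t * (cis (s * t) * of_real (gauss 1 t)))"
      using fourier_rel_pairing[OF fF integrable_gauss_translate L2R_gauss, of 1 s]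
        ift_translate[of "\<lambda>t. of_real (gauss 1 t)" s] ift_gauss_1
      by (simp add: gauss_def)
    finally have "ift (\<lambda>t. ift F t * of_real (gauss 1 t)) s = ift (\<lambda>t. f t * of_real (gauss 1 t)) s"
      by (simp add: ift_def mult_ac)
    then show "ift ?d s = 0"
      using ift_diff[OF f_int F_int] by simp
  qed (use f_int F_int in auto)
  then show "AE t in lborel. f t = ift F t"
    by eventually_elim (use gauss_pos[of 1] in \<open>auto simp: less_le simp flip: left_diff_distrib\<close>)
qed

text \<open>The same damping by \<open>gauss 1\<close>, now on the frequency side: some transform
  \<open>F\<close> of \<open>ift G\<close> exists, and its pairings with modulated Gaussians agree
  with those of \<open>G\<close>.\<close>

lemma fourier_rel_ift:
  assumes G: "integrable lborel G" "L2R G"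
  shows "fourier_rel (ift G) G"
proof -
  obtain F where F: "fourier_rel (ift G) F"
    using fourier_rel_exists[OF L2R_ift[OF G]] .
  note L2 = fourier_rel_L2R[OF F]
  have F_int: "integrable lborel (\<lambda>t. F t * of_real (gauss 1 t))" and G_int: "integrable lborel (\<lambda>t. G t * of_real (gauss 1 t))"
    using L2R_mult_integrable[OF L2(2) L2R_gauss[of 1 0]] L2R_mult_integrable[OF G(2) L2R_gauss[of 1 0]] by simp_all
  let ?d = "\<lambda>t. F t * of_real (gauss 1 t) - G t * of_real (gauss 1 t)"
  have "AE t in lborel. ?d t = 0"
  proof (rule AE_zero_if_ift_zero)
    fix s
    let ?k = "\<lambda>\<xi>. cis (s * \<xi>) * complex_of_real (gauss 1 \<xi>)"
    have k: "integrable lborel ?k" "L2R ?k"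
      using integrable_mult_cis[OF integrable_of_real_gauss, of 1 s] L2R_mult_bounded(1)[of "\<lambda>\<xi>. cis (s * \<xi>)", OF _ L2R_gauss[of 1 0], of 1]
      by (simp_all add: mult.commute)
    have "(LINT \<xi>|lborel. F \<xi> * ?k \<xi>) = (LINT t|lborel. ift G t * of_real (gauss 1 (t + - s)))"
      using fourier_rel_pairing[OF F k] by (simp add: ift_gauss_cis gauss_minus_commute[of 1 s])
    also have "\<dots> = (LINT \<xi>|lborel. G \<xi> * ?k \<xi>)"
      using integral_ift_mult[OF G(1) integrable_gauss_translate, of 1 "-s"]
        ift_translate[of "\<lambda>t. of_real (gauss 1 t)" "-s"] ift_gauss_1
      by (simp add: gauss_def)
    finally have "ift (\<lambda>t. F t * of_real (gauss 1 t)) s = ift (\<lambda>t. G t * of_real (gauss 1 t)) s"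
      by (simp add: ift_def mult_ac)
    then show "ift ?d s = 0"
      using ift_diff[OF F_int G_int] by simp
  qed (use F_int G_int in auto)
  then have "AE \<xi> in lborel. G \<xi> = F \<xi>"
    by eventually_elim (use gauss_pos[of 1] in \<open>auto simp: less_le simp flip: left_diff_distrib\<close>)
  then show ?thesis
    using fourier_rel_cong_AE[OF F] G(2) by auto
qed

section \<open>Positive definite functions\<close>

text \<open>From \<open>ln (cos y) / y\<^sup>2\<close> tending to -1/2 at 0, applied to
  \<open>y = x / sqrt (2 * n)\<close>, for which
  \<open>2 * n * y\<^sup>2 = x\<^sup>2\<close>.\<close>

lemma cos_power_tendsto_gauss:
  "(\<lambda>n. cos (x / sqrt (2 * real n)) ^ (2 * n)) \<longlonglongrightarrow> exp (- (x\<^sup>2 / 2))"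
proof (cases "x = 0")
  case False
  have ev: "\<forall>\<^sub>F n in sequentially. 0 < cos (x / sqrt (2 * real n)) \<and> n > 0"
  proof -
    have "(\<lambda>n. cos (x / sqrt (2 * real n))) \<longlonglongrightarrow> cos 0"
      by (intro tendsto_intros) real_asymp
    then have "\<forall>\<^sub>F n in sequentially. 0 < cos (x / sqrt (2 * real n))"
      by (rule order_tendstoD) simp
    then show ?thesis
      using eventually_gt_at_top[of 0] by eventually_elim simp
  qed
  have "((\<lambda>y::real. ln (cos y) / y\<^sup>2) \<longlongrightarrow> - 1 / 2) (at 0)"
    by real_asymp
  moreover have "filterlim (\<lambda>n. x / sqrt (2 * real n)) (at 0) sequentially"
    unfolding filterlim_at
  proof
    show "\<forall>\<^sub>F n in sequentially. x / sqrt (2 * real n) \<in> UNIV \<and> x / sqrt (2 * real n) \<noteq> 0"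
      using eventually_gt_at_top[of 0] by eventually_elim (use False in auto)
    show "(\<lambda>n. x / sqrt (2 * real n)) \<longlonglongrightarrow> 0" by real_asymp
  qed
  ultimately have "(\<lambda>n. ln (cos (x / sqrt (2 * real n))) / (x / sqrt (2 * real n))\<^sup>2) \<longlonglongrightarrow> - 1 / 2"
    by (rule filterlim_compose)
  then have "(\<lambda>n. exp (x\<^sup>2 * (ln (cos (x / sqrt (2 * real n))) / (x / sqrt (2 * real n))\<^sup>2))) \<longlonglongrightarrow> exp (x\<^sup>2 * (- 1 / 2))"
    by (intro tendsto_exp tendsto_mult_left)
  then have "(\<lambda>n. cos (x / sqrt (2 * real n)) ^ (2 * n)) \<longlonglongrightarrow> exp (x\<^sup>2 * (- 1 / 2))"
  proof (rule Lim_transform_eventually, use ev in eventually_elim)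
    case (elim n)
    have "x\<^sup>2 * (ln (cos (x / sqrt (2 * real n))) / (x / sqrt (2 * real n))\<^sup>2) = real (2 * n) * ln (cos (x / sqrt (2 * real n)))"
      using elim False by (simp add: power_divide field_simps)
    then show ?case
      using elim by (simp add: exp_of_nat_mult del: of_nat_mult)
  qed
  then show ?thesis by simp
qed simp

text \<open>Frequencies are arbitrary reals, like the points in \<open>posdef\<close>: the cosine
  powers use a step that varies with the power.\<close>

definition trig_poly :: "(real \<Rightarrow> complex) \<Rightarrow> bool" where
  "trig_poly p \<longleftrightarrow> (\<exists>(n::nat) x c. p = (\<lambda>\<xi>. \<Sum>j<n. c j * cis (x j * \<xi>)))"

lemma trig_poly_const: "trig_poly (\<lambda>\<xi>. a)"
  unfolding trig_poly_def by (intro exI[of _ "1::nat"] exI[of _ "\<lambda>_. 0"] exI[of _ "\<lambda>_. a"]) simp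

lemma trig_poly_add:
  assumes "trig_poly p" "trig_poly q"
  shows "trig_poly (\<lambda>\<xi>. p \<xi> + q \<xi>)"
proof -
  obtain n x c where p: "p = (\<lambda>\<xi>. \<Sum>j<(n::nat). c j * cis (x j * \<xi>))"
    using assms(1) by (auto simp: trig_poly_def)
  obtain m y d where q: "q = (\<lambda>\<xi>. \<Sum>j<(m::nat). d j * cis (y j * \<xi>))"
    using assms(2) by (auto simp: trig_poly_def)
  let ?c = "\<lambda>j. if j < n then c j else d (j - n)" and ?x = "\<lambda>j. if j < n then x j else y (j - n)"
  have split: "(\<Sum>j<n+m. g j) = (\<Sum>j<n. g j) + (\<Sum>j<m. g (n + j))" for g :: "nat \<Rightarrow> complex"
    by (induction m) (simp_all add: add.assoc)
  have "(\<Sum>j<n+m. ?c j * cis (?x j * \<xi>)) = p \<xi> + q \<xi>" for \<xi>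
    unfolding p q split by simp
  then show ?thesis
    unfolding trig_poly_def by (intro exI[of _ "n+m"] exI[of _ ?x] exI[of _ ?c]) auto
qed

lemma trig_poly_cmult_cis:
  assumes "trig_poly p"
  shows "trig_poly (\<lambda>\<xi>. a * cis (b * \<xi>) * p \<xi>)"
proof -
  obtain n x c where p: "p = (\<lambda>\<xi>. \<Sum>j<(n::nat). c j * cis (x j * \<xi>))"
    using assms by (auto simp: trig_poly_def)
  show ?thesis
    unfolding trig_poly_def p
    by (intro exI[of _ n] exI[of _ "\<lambda>j. x j + b"] exI[of _ "\<lambda>j. a * c j"])
      (auto simp: sum_distrib_left distrib_right mult.left_commute mult.assoc add.commute simp flip: cis_mult intro!: ext sum.cong)
qed

lemma trig_poly_cos_power: "trig_poly (\<lambda>\<xi>. complex_of_real (cos (a * (\<xi> - \<eta>)) ^ n))"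
proof (induction n)
  case 0
  then show ?case using trig_poly_const[of 1] by simp
next
  case (Suc n)
  have "complex_of_real (cos (a * (\<xi> - \<eta>))) = cis (- (a * \<eta>)) / 2 * cis (a * \<xi>) + cis (a * \<eta>) / 2 * cis (- a * \<xi>)" for \<xi>
  proof -
    have "cis (- (a * \<eta>)) / 2 * cis (a * \<xi>) + cis (a * \<eta>) / 2 * cis (- a * \<xi>) = (cis (a * (\<xi> - \<eta>)) + cis (- (a * (\<xi> - \<eta>)))) / 2"
      by (simp add: cis_mult add_divide_distrib algebra_simps)
    then show ?thesis
      by (simp add: complex_eq_iff)
  qed
  then show ?case
    using trig_poly_add[OF trig_poly_cmult_cis[OF Suc, of "cis (- (a * \<eta>)) / 2" a] trig_poly_cmult_cis[OF Suc, of "cis (a * \<eta>) / 2" "-a"]]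
    by (simp add: distrib_right)
qed

text \<open>Expanding the square of the modulus of \<open>p\<close> turns the integral into
  \<open>sqrt (2 * pi)\<close> times the quadratic form of \<open>posdef\<close>, with the
  frequencies of \<open>p\<close> as points.\<close>

lemma posdef_ift_trig_poly:
  assumes F: "integrable lborel F" and "posdef (ift F)" and "trig_poly p"
  shows "Im (LINT \<xi>|lborel. F \<xi> * of_real ((cmod (p \<xi>))\<^sup>2)) = 0" "0 \<le> Re (LINT \<xi>|lborel. F \<xi> * of_real ((cmod (p \<xi>))\<^sup>2))"
proof -
  obtain n x c where p: "p = (\<lambda>\<xi>. \<Sum>j<(n::nat). c j * cis (x j * \<xi>))"
    using assms by (auto simp: trig_poly_def)
  let ?s = "\<Sum>j<n. \<Sum>k<n. c j * cnj (c k) * ift F (x j - x k)"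
  have "F \<xi> * of_real ((cmod (p \<xi>))\<^sup>2) = (\<Sum>j<n. \<Sum>k<n. c j * cnj (c k) * (F \<xi> * cis (\<xi> * (x j - x k))))" for \<xi>
  proof -
    have "F \<xi> * (c j * cis (x j * \<xi>) * cnj (c k * cis (x k * \<xi>))) = c j * cnj (c k) * (F \<xi> * cis (\<xi> * (x j - x k)))" for j k
    proof -
      have "cis (\<xi> * (x j - x k)) = cis (x j * \<xi>) * cis (- (x k * \<xi>))"
        by (simp add: cis_mult algebra_simps)
      then show ?thesis
        by (simp add: cis_cnj mult_ac)
    qed
    then show ?thesis
      unfolding complex_norm_square p by (simp only: cnj_sum sum_product) (simp only: sum_distrib_left)
  qed
  then have "(LINT \<xi>|lborel. F \<xi> * of_real ((cmod (p \<xi>))\<^sup>2)) =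
      (LINT \<xi>|lborel. (\<Sum>j<n. \<Sum>k<n. c j * cnj (c k) * (F \<xi> * cis (\<xi> * (x j - x k)))))"
    by presburger
  also have "\<dots> = (\<Sum>j<n. \<Sum>k<n. c j * cnj (c k) * (LINT \<xi>|lborel. F \<xi> * cis (\<xi> * (x j - x k))))"
    using integrable_mult_cis[OF F] by simp
  also have "\<dots> = of_real (sqrt (2 * pi)) * ?s"
    by (simp add: ift_def sum_distrib_left mult.left_commute[of "_ / _"])
  finally have "(LINT \<xi>|lborel. F \<xi> * of_real ((cmod (p \<xi>))\<^sup>2)) = of_real (sqrt (2 * pi)) * ?s" .
  then show "Im (LINT \<xi>|lborel. F \<xi> * of_real ((cmod (p \<xi>))\<^sup>2)) = 0" "0 \<le> Re (LINT \<xi>|lborel. F \<xi> * of_real ((cmod (p \<xi>))\<^sup>2))"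
    using assms(2) by (auto simp: posdef_def)
qed

text \<open>The powers \<open>cos (c s / sqrt (2 n)) ^ n\<close> are trigonometric polynomials bounded by \<open>1\<close>
  whose squares converge to a Gaussian.\<close>

lemma AE_nonneg_if_posdef_ift:
  assumes F: "integrable lborel F" and "posdef (ift F)"
  shows "AE \<xi> in lborel. F \<xi> = of_real (cmod (F \<xi>))"
proof -
  note [measurable] = borel_measurable_integrable[OF F]
  have gauss: "Im (LINT \<xi>|lborel. F \<xi> * of_real (gauss c (\<xi> - \<eta>))) = 0"
      "0 \<le> Re (LINT \<xi>|lborel. F \<xi> * of_real (gauss c (\<xi> - \<eta>)))" for c \<eta>
  proof -
    define p where "p n \<xi> = complex_of_real (cos (c / sqrt (2 * real n) * (\<xi> - \<eta>)) ^ n)" for n \<xi>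
    have p: "trig_poly (p n)" for n
      unfolding p_def by (rule trig_poly_cos_power)
    have lim: "(\<lambda>n. LINT \<xi>|lborel. F \<xi> * of_real ((cmod (p n \<xi>))\<^sup>2)) \<longlonglongrightarrow> (LINT \<xi>|lborel. F \<xi> * of_real (gauss c (\<xi> - \<eta>)))"
    proof (rule integral_dominated_convergence[where w="\<lambda>\<xi>. cmod (F \<xi>)"])
      show "AE \<xi> in lborel. (\<lambda>n. F \<xi> * of_real ((cmod (p n \<xi>))\<^sup>2)) \<longlonglongrightarrow> F \<xi> * of_real (gauss c (\<xi> - \<eta>))"
        using cos_power_tendsto_gauss
        by (intro AE_I2 tendsto_intros) (simp add: p_def gauss_def norm_power power_even_eq power_mult[symmetric] mult.commute[of 2] power_even_abs)
      show "AE \<xi> in lborel. norm (F \<xi> * of_real ((cmod (p n \<xi>))\<^sup>2)) \<le> cmod (F \<xi>)" for n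
        by (intro AE_I2) (auto simp: p_def norm_mult norm_power intro!: mult_left_le power_le_one)
    qed (use F in \<open>auto simp: p_def\<close>)
    show "Im (LINT \<xi>|lborel. F \<xi> * of_real (gauss c (\<xi> - \<eta>))) = 0"
      using tendsto_Im[OF lim] posdef_ift_trig_poly(1)[OF assms p] by (simp add: LIMSEQ_const_iff)
    show "0 \<le> Re (LINT \<xi>|lborel. F \<xi> * of_real (gauss c (\<xi> - \<eta>)))"
      using tendsto_Re[OF lim] posdef_ift_trig_poly(2)[OF assms p] by (intro LIMSEQ_le_const) auto
  qed
  have int: "integrable lborel (\<lambda>\<xi>. F \<xi> * of_real (gauss c (\<xi> - \<eta>)))" for c \<eta>
    using F by (rule integrable_mult_bounded[where C=1])
      (auto simp: less_imp_le[OF gauss_pos] gauss_le_1)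
  have Re: "0 \<le> (LINT \<xi>|lborel. Re (F \<xi>) * gauss c (\<xi> - \<eta>))" for c \<eta>
    using integral_Re[OF int[of c \<eta>]] gauss(2)[of c \<eta>] by simp
  have Im: "(LINT \<xi>|lborel. Im (F \<xi>) * gauss c (\<xi> - \<eta>)) = 0" for c \<eta>
    using integral_Im[OF int[of c \<eta>]] gauss(1)[of c \<eta>] by simp
  have "AE \<xi> in lborel. 0 \<le> Re (F \<xi>)"
    "AE \<xi> in lborel. 0 \<le> Im (F \<xi>)" "AE \<xi> in lborel. 0 \<le> - Im (F \<xi>)"
    using F Re Im by (auto intro!: AE_nonneg_if_gauss simp del: neg_0_le_iff_le)
  then show ?thesis
    by eventually_elim (auto simp: complex_eq_iff cmod_eq_Re)
qed

section \<open>Restriction to translates of the base interval\<close>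

lemma TT_sets [measurable]: "TT \<in> sets borel"
  by (simp add: TT_def)

lemma emeasure_TT: "emeasure lborel TT = ennreal (2 * pi)"
  by (simp add: TT_def)

lemma normT_eq_normR: "normT g = normR (\<lambda>t. indicator TT t * g t)"
  unfolding normT_def normR_def set_lebesgue_integral_def
  by (rule arg_cong[where f=sqrt], rule Bochner_Integration.integral_cong) (auto split: split_indicator)

lemma L2T_iff_L2R: "L2T g \<longleftrightarrow> L2R (\<lambda>t. indicator TT t * g t)"
proof -
  have "(\<lambda>t. (cmod (indicator TT t * g t))\<^sup>2) = (\<lambda>t. indicator TT t *\<^sub>R (cmod (g t))\<^sup>2)"
    "(\<lambda>t. indicator TT t *\<^sub>R g t) = (\<lambda>t. indicator TT t * g t)"
    by (auto simp: fun_eq_iff split: split_indicator)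
  then show ?thesis
    by (simp add: L2T_def L2R_def set_borel_measurable_def set_integrable_def)
qed

lemma normT_nonneg [simp]: "0 \<le> normT g"
  by (simp add: normT_eq_normR)

lemma L2T_bound_AE:
  assumes [measurable]: "(\<lambda>t. indicator TT t * g t) \<in> borel_measurable borel" and f: "L2T f" and "0 \<le> C"
    and "AE t in lborel. t \<in> TT \<longrightarrow> cmod (g t) \<le> C * cmod (f t)"
  shows "L2T g" "normT g \<le> C * normT f"
proof -
  have *: "AE t in lborel. cmod (indicator TT t * g t) \<le> C * cmod (indicator TT t * f t)"
    using assms(4) by eventually_elim (auto split: split_indicator)
  show "L2T g" "normT g \<le> C * normT f"
    using L2R_bound_AE[OF assms(1) _ assms(3) *] f by (auto simp: L2T_iff_L2R normT_eq_normR)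
qed

lemma L2T_diff [intro]: "L2T f \<Longrightarrow> L2T g \<Longrightarrow> L2T (\<lambda>t. f t - g t)"
  using L2R_diff by (simp add: L2T_iff_L2R right_diff_distrib)

lemma L2T_add [intro]: "L2T f \<Longrightarrow> L2T g \<Longrightarrow> L2T (\<lambda>t. f t + g t)"
  using L2R_add by (simp add: L2T_iff_L2R distrib_left)

lemma L2T_cmult [intro]: "L2T f \<Longrightarrow> L2T (\<lambda>t. c * f t)"
  using L2R_cmult[of "\<lambda>t. indicator TT t * f t" c] by (simp add: L2T_iff_L2R mult_ac)

lemma normT_cmult: "normT (\<lambda>t. c * f t) = cmod c * normT f"
  using normR_cmult[of c "\<lambda>t. indicator TT t * f t"] by (simp add: normT_eq_normR mult_ac)

lemma L2T_cnj [intro]: "L2T f \<Longrightarrow> L2T (\<lambda>t. cnj (f t))"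
proof -
  have "(\<lambda>t. cnj (indicator TT t * f t)) = (\<lambda>t. indicator TT t * cnj (f t))"
    by (auto split: split_indicator)
  then show "L2T f \<Longrightarrow> L2T (\<lambda>t. cnj (f t))"
    using L2R_cnj[of "\<lambda>t. indicator TT t * f t"] by (simp add: L2T_iff_L2R)
qed

lemma normT_cnj [simp]: "normT (\<lambda>t. cnj (f t)) = normT f"
  by (simp add: normT_def)

lemma normT_minus_commute: "normT (\<lambda>x. f x - g x) = normT (\<lambda>x. g x - f x)"
  by (simp add: normT_def norm_minus_commute)

lemma normT_triangle: "L2T f \<Longrightarrow> L2T g \<Longrightarrow> normT (\<lambda>t. f t + g t) \<le> normT f + normT g"
  using normR_triangle by (simp add: L2T_iff_L2R normT_eq_normR distrib_left)

lemma normT_triangle_via: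
  "L2T (\<lambda>x. f x - g x) \<Longrightarrow> L2T (\<lambda>x. g x - h x) \<Longrightarrow>
    normT (\<lambda>x. f x - h x) \<le> normT (\<lambda>x. f x - g x) + normT (\<lambda>x. g x - h x)"
  using normT_triangle[of "\<lambda>x. f x - g x" "\<lambda>x. g x - h x"] by simp

lemma normT_le_add_diff: "L2T f \<Longrightarrow> L2T g \<Longrightarrow> normT f \<le> normT (\<lambda>x. f x - g x) + normT g"
  using normT_triangle[of "\<lambda>x. f x - g x" g] by auto

lemma L2T_mult_integrable:
  assumes "L2T f" "L2T g"
  shows "integrable lborel (\<lambda>t. indicator TT t * (f t * g t))"
proof -
  have "(\<lambda>t. (indicator TT t * f t) * (indicator TT t * g t)) = (\<lambda>t. indicator TT t * (f t * g t))"
    by (auto split: split_indicator)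
  then show ?thesis
    using L2R_mult_integrable[of "\<lambda>t. indicator TT t * f t" "\<lambda>t. indicator TT t * g t"] assms
    by (simp add: L2T_iff_L2R)
qed

lemma L2T_Cauchy_Schwarz:
  assumes "L2T f" "L2T g"
  shows "cmod (LINT t|lborel. indicator TT t * (f t * g t)) \<le> normT f * normT g"
proof -
  have "(\<lambda>t. (indicator TT t * f t) * (indicator TT t * g t)) = (\<lambda>t. indicator TT t * (f t * g t))"
    by (auto split: split_indicator)
  then show ?thesis
    using L2R_Cauchy_Schwarz[of "\<lambda>t. indicator TT t * f t" "\<lambda>t. indicator TT t * g t"] assms
    by (simp add: L2T_iff_L2R normT_eq_normR)
qed

lemma L2T_bounded:
  assumes [measurable]: "g \<in> borel_measurable borel" and "\<And>x. x \<in> TT \<Longrightarrow> cmod (g x) \<le> C"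
  shows "L2T g" "normT g \<le> C * sqrt (2 * pi)"
proof -
  have C: "0 \<le> C"
    using assms(2)[of 0] norm_ge_zero[of "g 0"] by (auto simp: TT_def intro: order_trans[rotated])
  have "L2T (\<lambda>t. 1)"
    using L2R_indicator[of TT] by (simp add: L2T_iff_L2R emeasure_TT of_real_indicator)
  moreover have "normT (\<lambda>t. 1) = sqrt (2 * pi)"
    by (simp add: normT_def set_lebesgue_integral_def TT_def)
  ultimately show "L2T g" "normT g \<le> C * sqrt (2 * pi)"
    using L2T_bound_AE[of g "\<lambda>t. 1" C] C assms(2) by auto
qed

text \<open>Since \<open>TT\<close> is half-open, every \<xi> lies in exactly one translate, so the
  indicators of the translates sum to 1; Tonelli does the rest.\<close>

lemma nn_integral_blocks:
  assumes [measurable]: "f \<in> borel_measurable borel"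
  shows "(\<integral>\<^sup>+ \<xi>. f \<xi> \<partial>lborel) = (\<integral>\<^sup>+ k. (\<integral>\<^sup>+ t. f (t + 2 * pi * of_int k) * indicator TT t \<partial>lborel) \<partial>count_space UNIV)"
proof -
  have *: "(\<integral>\<^sup>+ k. f \<xi> * indicator TT (\<xi> - 2 * pi * of_int k) \<partial>count_space UNIV) = f \<xi>" for \<xi>
  proof -
    define m where "m = \<lfloor>(\<xi> + pi) / (2 * pi)\<rfloor>"
    have "\<xi> - 2 * pi * of_int k \<in> TT \<longleftrightarrow> k = m" for k
    proof -
      have "\<xi> - 2 * pi * of_int k \<in> TT \<longleftrightarrow> of_int k \<le> (\<xi> + pi) / (2 * pi) \<and> (\<xi> + pi) / (2 * pi) < of_int k + 1"
        using pi_gt_zero by (auto simp: TT_def field_simps)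
      then show ?thesis
        unfolding m_def by (simp only: floor_eq_iff eq_commute[of k])
    qed
    then have "(\<integral>\<^sup>+ k. f \<xi> * indicator TT (\<xi> - 2 * pi * of_int k) \<partial>count_space UNIV) = (\<integral>\<^sup>+ k. f \<xi> * indicator {m} k \<partial>count_space UNIV)"
      by (intro nn_integral_cong) (auto split: split_indicator)
    then show ?thesis
      by (simp add: nn_integral_cmult)
  qed
  have "(\<integral>\<^sup>+ \<xi>. f \<xi> \<partial>lborel) = (\<integral>\<^sup>+ \<xi>. (\<integral>\<^sup>+ k. f \<xi> * indicator TT (\<xi> - 2 * pi * of_int k) \<partial>count_space UNIV) \<partial>lborel)"
    by (simp add: *)
  also have "\<dots> = (\<integral>\<^sup>+ k. (\<integral>\<^sup>+ \<xi>. f \<xi> * indicator TT (\<xi> - 2 * pi * of_int k) \<partial>lborel) \<partial>count_space UNIV)"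
    by (rule nn_integral_count_space_nn_integral) auto
  also have "\<dots> = (\<integral>\<^sup>+ k. (\<integral>\<^sup>+ t. f (t + 2 * pi * of_int k) * indicator TT t \<partial>lborel) \<partial>count_space UNIV)"
  proof (rule nn_integral_cong)
    fix k :: int
    show "(\<integral>\<^sup>+ \<xi>. f \<xi> * indicator TT (\<xi> - 2 * pi * of_int k) \<partial>lborel) = (\<integral>\<^sup>+ t. f (t + 2 * pi * of_int k) * indicator TT t \<partial>lborel)"
      using nn_integral_real_affine[of "\<lambda>\<xi>. f \<xi> * indicator TT (\<xi> - 2 * pi * of_int k)" 1 "2 * pi * of_int k"]
      by (simp add: add.commute)
  qed
  finally show ?thesis .
qed

section \<open>The sequence space\<close>

lemma l2_add:
  assumes "l2 a" "l2 b"
  shows "l2 (\<lambda>j. a j + b j)"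
  unfolding l2_def
proof (rule summable_on_comparison_test)
  show "(\<lambda>j. 2 * (cmod (a j))\<^sup>2 + 2 * (cmod (b j))\<^sup>2) summable_on UNIV"
    using assms unfolding l2_def by (intro summable_on_add summable_on_cmult_right)
  show "(cmod (a j + b j))\<^sup>2 \<le> 2 * (cmod (a j))\<^sup>2 + 2 * (cmod (b j))\<^sup>2" for j
  proof -
    have "(cmod (a j + b j))\<^sup>2 \<le> (cmod (a j) + cmod (b j))\<^sup>2"
      by (intro power_mono norm_triangle_ineq) auto
    then show ?thesis
      using sum_squares_bound[of "cmod (a j)" "cmod (b j)"] by (simp add: power2_sum)
  qed
qed auto

lemma l2_cmult: "l2 a \<Longrightarrow> l2 (\<lambda>j. z * a j)"
  unfolding l2_def by (simp add: norm_mult power_mult_distrib summable_on_cmult_right)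

lemma l2_zero: "l2 (\<lambda>j. 0)"
  by (simp add: l2_def)

text \<open>Packaged as a type so that it can be an instance of \<open>real_inner\<close> and
  \<open>complete_space\<close>, the classes for which the functional analytic lemmas below are
  stated. The inner product is the real part of the complex one; complex identities are recovered by
  testing with 1 and \<i>.\<close>

typedef ell2 = "{c. l2 c}" morphisms nth Abs_ell2
  using l2_zero by blast

lemma l2_nth [simp]: "l2 (nth a)"
  using nth[of a] by simp

lemma nth_Abs: "l2 c \<Longrightarrow> nth (Abs_ell2 c) = c"
  by (simp add: Abs_ell2_inverse)

lemma ell2_eqI: "(\<And>j. nth a j = nth b j) \<Longrightarrow> a = b"
  by (metis ext nth_inject)

instantiation ell2 :: real_vector
begin
definition "0 = Abs_ell2 (\<lambda>j. 0)"
definition "a + b = Abs_ell2 (\<lambda>j. nth a j + nth b j)"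
definition "- a = Abs_ell2 (\<lambda>j. - nth a j)" for a :: ell2
definition "a - b = Abs_ell2 (\<lambda>j. nth a j - nth b j)"
definition "r *\<^sub>R a = Abs_ell2 (\<lambda>j. of_real r * nth a j)"

lemma nth_zero [simp]: "nth 0 j = 0"
  by (simp add: zero_ell2_def nth_Abs l2_zero)

lemma nth_add [simp]: "nth (a + b) j = nth a j + nth b j"
  by (simp add: plus_ell2_def nth_Abs l2_add)

lemma nth_uminus [simp]: "nth (- a) j = - nth a j"
  using l2_cmult[of "nth a" "-1"] by (simp add: uminus_ell2_def nth_Abs)

lemma nth_diff [simp]: "nth (a - b) j = nth a j - nth b j"
  using l2_add[OF l2_nth l2_cmult[of "nth b" "-1"], of a] by (simp add: minus_ell2_def nth_Abs)

lemma nth_scaleR [simp]: "nth (r *\<^sub>R a) j = of_real r * nth a j"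
  by (simp add: scaleR_ell2_def nth_Abs l2_cmult)

instance
  by standard (auto intro!: ell2_eqI simp: algebra_simps)
end

lemma l2_inner_summable:
  assumes "l2 a" "l2 b"
  shows "(\<lambda>j. a j \<bullet> b j) summable_on UNIV"
proof (rule Infinite_Sum.abs_summable_summable, rule summable_on_comparison_test)
  show "(\<lambda>j. (cmod (a j))\<^sup>2 + (cmod (b j))\<^sup>2) summable_on UNIV"
    using assms unfolding l2_def by (rule summable_on_add)
  fix j
  have "\<bar>a j \<bullet> b j\<bar> \<le> cmod (a j) * cmod (b j)"
    by (rule Cauchy_Schwarz_ineq2)
  also have "\<dots> \<le> (cmod (a j))\<^sup>2 + (cmod (b j))\<^sup>2"
    using sum_squares_bound[of "cmod (a j)" "cmod (b j)"] mult_nonneg_nonneg[OF norm_ge_zero norm_ge_zero, of "a j" "b j"]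
    by linarith
  finally show "norm (a j \<bullet> b j) \<le> (cmod (a j))\<^sup>2 + (cmod (b j))\<^sup>2"
    by simp
qed simp

instantiation ell2 :: real_inner
begin
definition "a \<bullet> b = (\<Sum>\<^sub>\<infinity>j. nth a j \<bullet> nth b j)"
definition "norm a = sqrt (a \<bullet> a)" for a :: ell2
definition "dist a b = norm (a - b)" for a b :: ell2
definition "sgn a = a /\<^sub>R norm a" for a :: ell2
definition [code del]: "(uniformity :: (ell2 \<times> ell2) filter) = (INF e\<in>{0<..}. principal {(x, y). dist x y < e})"
definition [code del]: "open (U :: ell2 set) \<longleftrightarrow> (\<forall>x\<in>U. \<forall>\<^sub>F (x', y) in uniformity. x' = x \<longrightarrow> y \<in> U)"

instance
proof
  fix a b c :: ell2 and r :: real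
  show "a \<bullet> b = b \<bullet> a"
    by (simp add: inner_ell2_def inner_commute)
  show "(a + b) \<bullet> c = a \<bullet> c + b \<bullet> c"
    by (simp add: inner_ell2_def inner_add_left infsum_add l2_inner_summable)
  show "(r *\<^sub>R a) \<bullet> b = r * (a \<bullet> b)"
    by (simp add: inner_ell2_def infsum_cmult_right' flip: scaleR_conv_of_real)
  show "0 \<le> a \<bullet> a"
    by (auto simp: inner_ell2_def intro: infsum_nonneg)
  have "a = 0" if "a \<bullet> a = 0"
  proof (rule ell2_eqI)
    fix j
    have "nth a j \<bullet> nth a j = 0"
      by (rule nonneg_infsum_le_0D[where A=UNIV])
        (use that l2_inner_summable[of "nth a" "nth a"] in \<open>auto simp: inner_ell2_def\<close>)
    then show "nth a j = nth 0 j" by simp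
  qed
  then show "(a \<bullet> a = 0) = (a = 0)"
    by (auto simp: inner_ell2_def)
qed (fact norm_ell2_def dist_ell2_def sgn_ell2_def uniformity_ell2_def open_ell2_def)+
end

lemma has_sum_norm_ell2: "((\<lambda>j. (cmod (nth a j))\<^sup>2) has_sum (norm a)\<^sup>2) UNIV"
proof -
  have "(\<lambda>j. (cmod (nth a j))\<^sup>2) summable_on UNIV"
    using l2_nth[of a] by (simp add: l2_def)
  moreover have "(norm a)\<^sup>2 = (\<Sum>\<^sub>\<infinity>j. (cmod (nth a j))\<^sup>2)"
    unfolding power2_norm_eq_inner by (simp add: inner_ell2_def power2_norm_eq_inner)
  ultimately show ?thesis by (simp add: has_sum_infsum)
qed

lemma sum_le_norm_ell2: "finite F \<Longrightarrow> (\<Sum>j\<in>F. (cmod (nth a j))\<^sup>2) \<le> (norm a)\<^sup>2"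
  using finite_sum_le_has_sum[OF has_sum_norm_ell2, of F a] by auto

lemma norm_nth_le: "cmod (nth a j) \<le> norm a"
  using sum_le_norm_ell2[of "{j}" a] by (simp add: power2_le_iff_abs_le)

lemma l2_bounded_sums:
  assumes "\<And>F. finite F \<Longrightarrow> (\<Sum>j\<in>F. (cmod (c j))\<^sup>2) \<le> C"
  shows "l2 c"
  unfolding l2_def using assms by (intro nonneg_bounded_partial_sums_imp_summable_on) auto

lemma norm_ell2_le:
  assumes "\<And>F. finite F \<Longrightarrow> (\<Sum>j\<in>F. (cmod (nth a j))\<^sup>2) \<le> C\<^sup>2" and "0 \<le> C"
  shows "norm a \<le> C"
proof -
  have "(norm a)\<^sup>2 \<le> C\<^sup>2"
    using assms(1) by (intro has_sum_le_finite_sums[OF has_sum_norm_ell2]) auto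
  then show ?thesis
    using assms(2) by (rule power2_le_imp_le)
qed

text \<open>The limit is taken coordinatewise. The Cauchy estimate survives in every finite partial
  sum, hence in the norm.\<close>

instance ell2 :: complete_space
proof
  fix X :: "nat \<Rightarrow> ell2"
  assume X: "Cauchy X"
  have "Cauchy (\<lambda>n. nth (X n) j)" for j
  proof (rule metric_CauchyI)
    fix e :: real assume "0 < e"
    then obtain M where M: "\<And>m n. m \<ge> M \<Longrightarrow> n \<ge> M \<Longrightarrow> dist (X m) (X n) < e"
      using metric_CauchyD[OF X] by blast
    have "dist (nth (X m) j) (nth (X n) j) < e" if "m \<ge> M" "n \<ge> M" for m n
      using norm_nth_le[of "X m - X n" j] M[OF that] by (simp add: dist_norm)
    then show "\<exists>M. \<forall>m\<ge>M. \<forall>n\<ge>M. dist (nth (X m) j) (nth (X n) j) < e" by blast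
  qed
  then have "\<forall>j. \<exists>l. (\<lambda>n. nth (X n) j) \<longlonglongrightarrow> l"
    by (simp add: Cauchy_convergent_iff convergent_def)
  then obtain c where c: "\<And>j. (\<lambda>n. nth (X n) j) \<longlonglongrightarrow> c j"
    by metis
  have *: "(\<Sum>j\<in>F. (cmod (nth (X n) j - c j))\<^sup>2) \<le> e\<^sup>2"
    if "finite F" and e: "\<And>m. m \<ge> n \<Longrightarrow> dist (X n) (X m) \<le> e" for F n e
  proof (rule LIMSEQ_le_const2)
    show "(\<lambda>m. \<Sum>j\<in>F. (cmod (nth (X n) j - nth (X m) j))\<^sup>2) \<longlonglongrightarrow> (\<Sum>j\<in>F. (cmod (nth (X n) j - c j))\<^sup>2)"
      by (intro tendsto_intros c)
    have "(\<Sum>j\<in>F. (cmod (nth (X n) j - nth (X m) j))\<^sup>2) \<le> e\<^sup>2" if "m \<ge> n" for m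
    proof -
      have "(\<Sum>j\<in>F. (cmod (nth (X n) j - nth (X m) j))\<^sup>2) \<le> (norm (X n - X m))\<^sup>2"
        using sum_le_norm_ell2[OF \<open>finite F\<close>, of "X n - X m"] by simp
      also have "\<dots> \<le> e\<^sup>2"
        using e[OF that] by (intro power_mono) (auto simp: dist_norm)
      finally show ?thesis .
    qed
    then show "\<exists>N. \<forall>m\<ge>N. (\<Sum>j\<in>F. (cmod (nth (X n) j - nth (X m) j))\<^sup>2) \<le> e\<^sup>2" by blast
  qed
  obtain N where N: "\<And>m n. m \<ge> N \<Longrightarrow> n \<ge> N \<Longrightarrow> dist (X m) (X n) < 1"
    using metric_CauchyD[OF X, of 1] by auto
  have "l2 (\<lambda>j. nth (X N) j - c j)"
    by (rule l2_bounded_sums[where C="1\<^sup>2"], rule *) (auto intro: less_imp_le N)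
  then have "l2 (\<lambda>j. nth (X N) j + (-1) * (nth (X N) j - c j))"
    by (intro l2_add l2_cmult) auto
  then have c_l2: "l2 c" by simp
  have "X \<longlonglongrightarrow> Abs_ell2 c"
  proof (rule metric_LIMSEQ_I)
    fix e :: real assume "0 < e"
    then obtain M where M: "\<And>m n. m \<ge> M \<Longrightarrow> n \<ge> M \<Longrightarrow> dist (X m) (X n) < e/2"
      using metric_CauchyD[OF X, of "e/2"] by auto
    have "dist (X n) (Abs_ell2 c) < e" if "n \<ge> M" for n
    proof -
      have "norm (X n - Abs_ell2 c) \<le> e/2"
      proof (rule norm_ell2_le)
        fix F :: "int set" assume "finite F"
        then have "(\<Sum>j\<in>F. (cmod (nth (X n) j - c j))\<^sup>2) \<le> (e/2)\<^sup>2"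
          using M[OF that] that by (intro *) (auto intro!: less_imp_le)
        then show "(\<Sum>j\<in>F. (cmod (nth (X n - Abs_ell2 c) j))\<^sup>2) \<le> (e/2)\<^sup>2"
          by (simp add: nth_Abs[OF c_l2])
      qed (use \<open>0 < e\<close> in simp)
      then show ?thesis
        using \<open>0 < e\<close> by (simp add: dist_norm)
    qed
    then show "\<exists>no. \<forall>n\<ge>no. dist (X n) (Abs_ell2 c) < e" by blast
  qed
  then show "convergent X"
    by (auto simp: convergent_def)
qed

section \<open>Finitely supported sequences\<close>

definition fin :: "int set \<Rightarrow> (int \<Rightarrow> complex) \<Rightarrow> ell2" where
  "fin F c = Abs_ell2 (\<lambda>j. if j \<in> F then c j else 0)"

lemma nth_fin:
  assumes "finite F"
  shows "nth (fin F c) j = (if j \<in> F then c j else 0)"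
proof -
  have "(\<lambda>j. (cmod (if j \<in> F then c j else 0))\<^sup>2) summable_on UNIV"
    using assms by (intro finite_nonzero_values_imp_summable_on) (auto intro: finite_subset)
  then show ?thesis
    by (simp add: fin_def nth_Abs l2_def)
qed

lemma norm_fin:
  assumes "finite F"
  shows "(norm (fin F c))\<^sup>2 = (\<Sum>j\<in>F. (cmod (c j))\<^sup>2)"
proof -
  have "((\<lambda>j. (cmod (nth (fin F c) j))\<^sup>2) has_sum (\<Sum>j\<in>F. (cmod (nth (fin F c) j))\<^sup>2)) UNIV"
    using assms by (intro has_sum_finite_neutralI) (auto simp: nth_fin)
  then have "(norm (fin F c))\<^sup>2 = (\<Sum>j\<in>F. (cmod (nth (fin F c) j))\<^sup>2)"
    using has_sum_unique[OF has_sum_norm_ell2] by blast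
  then show ?thesis
    using assms by (simp add: nth_fin)
qed

lemma inner_fin:
  assumes "finite F"
  shows "a \<bullet> fin F c = (\<Sum>j\<in>F. nth a j \<bullet> c j)"
proof -
  have "((\<lambda>j. nth a j \<bullet> nth (fin F c) j) has_sum (\<Sum>j\<in>F. nth a j \<bullet> nth (fin F c) j)) UNIV"
    using assms by (intro has_sum_finite_neutralI) (auto simp: nth_fin)
  then show ?thesis
    using assms by (simp add: inner_ell2_def infsumI nth_fin)
qed

text \<open>A truncation is orthogonal to its remainder, so the squared error is the difference of
  the squared norms.\<close>

lemma fin_tendsto: "((\<lambda>F. fin F (nth a)) \<longlongrightarrow> a) (finite_subsets_at_top UNIV)"
proof -
  have "((\<lambda>F. (norm a)\<^sup>2 - (\<Sum>j\<in>F. (cmod (nth a j))\<^sup>2)) \<longlongrightarrow> (norm a)\<^sup>2 - (norm a)\<^sup>2) (finite_subsets_at_top UNIV)"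
    using has_sum_norm_ell2[of a] unfolding has_sum_def by (intro tendsto_intros)
  moreover have "\<forall>\<^sub>F F in finite_subsets_at_top UNIV. (norm a)\<^sup>2 - (\<Sum>j\<in>F. (cmod (nth a j))\<^sup>2) = (norm (fin F (nth a) - a))\<^sup>2"
  proof (rule eventually_finite_subsets_at_top_weakI)
    fix F :: "int set" assume F: "finite F"
    have "a \<bullet> fin F (nth a) = (norm (fin F (nth a)))\<^sup>2"
      using F unfolding norm_fin[OF F] by (simp add: inner_fin power2_norm_eq_inner)
    then have "(norm (fin F (nth a) - a))\<^sup>2 = (norm a)\<^sup>2 - (norm (fin F (nth a)))\<^sup>2"
      by (simp add: power2_norm_eq_inner inner_diff_left inner_diff_right inner_commute)
    then show "(norm a)\<^sup>2 - (\<Sum>j\<in>F. (cmod (nth a j))\<^sup>2) = (norm (fin F (nth a) - a))\<^sup>2"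
      using F by (simp add: norm_fin)
  qed
  ultimately have "((\<lambda>F. (norm (fin F (nth a) - a))\<^sup>2) \<longlongrightarrow> 0) (finite_subsets_at_top UNIV)"
    by (simp only: diff_self Lim_transform_eventually)
  then have "((\<lambda>F. sqrt ((norm (fin F (nth a) - a))\<^sup>2)) \<longlongrightarrow> sqrt 0) (finite_subsets_at_top UNIV)"
    by (rule tendsto_real_sqrt)
  then have "((\<lambda>F. fin F (nth a) - a) \<longlongrightarrow> 0) (finite_subsets_at_top UNIV)"
    unfolding real_sqrt_abs real_sqrt_zero abs_norm_cancel by (rule tendsto_norm_zero_cancel)
  then show ?thesis
    using Lim_null by blast
qed

section \<open>Uniform boundedness and the Lax-Milgram lemma\<close>

text \<open>Sokal's proof of the uniform boundedness principle: for each functional one of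
  \<open>x + \<xi>\<close>, \<open>x - \<xi>\<close> is at least as large as at \<open>\<xi>\<close>.\<close>

lemma uniform_boundedness:
  fixes S :: "('a::{real_normed_vector, complete_space} \<Rightarrow> real) set"
  assumes lin: "\<And>f. f \<in> S \<Longrightarrow> bounded_linear f"
    and ptw: "\<And>x. \<exists>M. \<forall>f\<in>S. \<bar>f x\<bar> \<le> M"
  obtains C where "0 \<le> C" "\<And>f x. f \<in> S \<Longrightarrow> \<bar>f x\<bar> \<le> C * norm x"
proof -
  have "\<exists>n. \<forall>f\<in>S. onorm f \<le> 4 ^ n"
  proof (rule ccontr)
    assume "\<nexists>n. \<forall>f\<in>S. onorm f \<le> 4 ^ n"
    then have "\<forall>n. \<exists>f\<in>S. 4 ^ n < onorm f" by (metis not_le)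
    then obtain f where f: "\<And>n. f n \<in> S" "\<And>n::nat. 4 ^ n < onorm (f n)" by metis
    \<comment> \<open>The constants fit together: steps of length \<open>(1/3) ^ n\<close> leave a
      remainder of at most \<open>(1/3) ^ n / 2\<close> after step \<open>n\<close>, so of the gain
      \<open>2/3 * (1/3) ^ n * onorm (f n)\<close> the fraction 2/3 - 1/2 = 1/6 survives. With
      \<open>onorm (f n)\<close> above \<open>4 ^ n\<close> this grows like
      \<open>(4/3) ^ n\<close>.\<close>
    have "\<exists>\<xi>. norm \<xi> = 1 \<and> 2/3 * onorm (f n) \<le> \<bar>f n \<xi>\<bar>" for n
    proof (rule ccontr)
      assume *: "\<not> ?thesis"
      have pos: "0 < onorm (f n)"
        using f(2)[of n] by (auto intro: less_trans[rotated])
      have "onorm (f n) \<le> 2/3 * onorm (f n)"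
      proof (rule onorm_bound)
        fix x
        interpret bounded_linear "f n" using lin f by blast
        show "norm (f n x) \<le> 2/3 * onorm (f n) * norm x"
        proof (cases "x = 0")
          case False
          then have "\<bar>f n (x /\<^sub>R norm x)\<bar> < 2/3 * onorm (f n)"
            using * by (metis norm_sgn not_le sgn_div_norm)
          then show ?thesis
            using False by (simp add: scaleR abs_mult field_simps)
        qed (simp add: zero)
      qed (use pos in simp)
      then show False using pos by simp
    qed
    then obtain \<xi> where \<xi>: "\<And>n. norm (\<xi> n) = 1" "\<And>n. 2/3 * onorm (f n) \<le> \<bar>f n (\<xi> n)\<bar>" by metis
    have "\<exists>s. \<bar>s\<bar> = (1/3) ^ n \<and> (1/3) ^ n * \<bar>f n (\<xi> n)\<bar> \<le> \<bar>f n (x + s *\<^sub>R \<xi> n)\<bar>" for n x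
    proof -
      interpret bounded_linear "f n" using lin f by blast
      have e: "f n (x + s *\<^sub>R \<xi> n) = f n x + s * f n (\<xi> n)" for s
        by (simp add: add scaleR)
      have a: "(1/3) ^ n * \<bar>f n (\<xi> n)\<bar> = \<bar>(1/3) ^ n * f n (\<xi> n)\<bar>" by (simp add: abs_mult)
      have "(1/3) ^ n * \<bar>f n (\<xi> n)\<bar> \<le> \<bar>f n (x + (1/3) ^ n *\<^sub>R \<xi> n)\<bar> \<or> (1/3) ^ n * \<bar>f n (\<xi> n)\<bar> \<le> \<bar>f n (x + (- ((1/3) ^ n)) *\<^sub>R \<xi> n)\<bar>"
        unfolding e a by linarith
      then show ?thesis
        by (metis abs_minus_cancel abs_of_nonneg zero_le_power zero_le_divide_1_iff zero_le_numeral)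
    qed
    then obtain s where s: "\<And>n x. \<bar>s n x\<bar> = (1/3) ^ n" "\<And>n x. (1/3) ^ n * \<bar>f n (\<xi> n)\<bar> \<le> \<bar>f n (x + s n x *\<^sub>R \<xi> n)\<bar>" by metis
    define X where "X = rec_nat 0 (\<lambda>n x. x + s n x *\<^sub>R \<xi> n)"
    have X: "X (Suc n) = X n + s n (X n) *\<^sub>R \<xi> n" for n by (simp add: X_def)
    have step: "norm (X (Suc n) - X n) = (1/3) ^ n" for n
      using \<xi> s by (simp add: X)
    have diff: "norm (X (n + k) - X n) \<le> 3/2 * (1/3) ^ n * (1 - (1/3) ^ k)" for n k
    proof (induction k)
      case (Suc k)
      have "norm (X (n + Suc k) - X n) \<le> norm (X (Suc (n + k)) - X (n + k)) + norm (X (n + k) - X n)"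
        using norm_triangle_ineq[of "X (Suc (n + k)) - X (n + k)" "X (n + k) - X n"] by simp
      also have "\<dots> \<le> (1/3) ^ (n + k) + 3/2 * (1/3) ^ n * (1 - (1/3) ^ k)"
        using Suc step[of "n + k"] by linarith
      finally show ?case by (simp add: power_add field_simps)
    qed simp
    have diff': "norm (X m - X n) \<le> 3/2 * (1/3) ^ n" if "n \<le> m" for m n
    proof -
      have "3/2 * (1/3) ^ n * (1 - (1/3) ^ (m - n)) \<le> 3/2 * (1/3::real) ^ n"
        by (intro mult_left_le) auto
      moreover have "norm (X m - X n) \<le> 3/2 * (1/3) ^ n * (1 - (1/3) ^ (m - n))"
        using diff[of n "m - n"] that by simp
      ultimately show ?thesis by linarith
    qed
    have "Cauchy X"
    proof (rule metric_CauchyI)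
      fix e :: real assume "0 < e"
      have "(\<lambda>n. 3/2 * (1/3::real) ^ n) \<longlonglongrightarrow> 3/2 * 0"
        by (intro tendsto_intros LIMSEQ_power_zero) auto
      moreover have "3/2 * 0 < e/2"
        using \<open>0 < e\<close> by simp
      ultimately have "\<forall>\<^sub>F n in sequentially. 3/2 * (1/3::real) ^ n < e/2"
        by (rule order_tendstoD(2))
      then obtain N where N: "3/2 * (1/3::real) ^ N < e/2"
        using eventually_happens by (metis trivial_limit_sequentially)
      have "dist (X m) (X n) < e" if "m \<ge> N" "n \<ge> N" for m n
        using dist_triangle2[of "X m" "X n" "X N"] diff'[OF that(1)] diff'[OF that(2)] N by (simp add: dist_norm)
      then show "\<exists>M. \<forall>m\<ge>M. \<forall>n\<ge>M. dist (X m) (X n) < e" by blast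
    qed
    then obtain x where x: "X \<longlonglongrightarrow> x"
      using Cauchy_convergent_iff convergent_def by blast
    obtain M where M: "\<And>n. \<bar>f n x\<bar> \<le> M"
      using ptw[of x] f by blast
    have "(4/3) ^ n / 6 \<le> M" for n :: nat
    proof -
      interpret bounded_linear "f n" using lin f by blast
      have "norm (x - X (Suc n)) \<le> 3/2 * (1/3) ^ Suc n"
      proof (rule LIMSEQ_le_const2)
        show "(\<lambda>m. norm (X m - X (Suc n))) \<longlonglongrightarrow> norm (x - X (Suc n))"
          by (intro tendsto_intros x)
        show "\<exists>N. \<forall>m\<ge>N. norm (X m - X (Suc n)) \<le> 3/2 * (1/3) ^ Suc n"
          using diff' by blast
      qed
      then have "onorm (f n) * norm (x - X (Suc n)) \<le> onorm (f n) * ((1/3) ^ n / 2)"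
        by (intro mult_left_mono onorm_pos_le bounded_linear_axioms) simp
      moreover have "\<bar>f n (x - X (Suc n))\<bar> \<le> onorm (f n) * norm (x - X (Suc n))"
        using onorm[OF bounded_linear_axioms, of "x - X (Suc n)"] by simp
      ultimately have "\<bar>f n (x - X (Suc n))\<bar> \<le> onorm (f n) * ((1/3) ^ n / 2)"
        by linarith
      moreover have "(1/3) ^ n * (2/3 * onorm (f n)) \<le> \<bar>f n (X (Suc n))\<bar>"
        unfolding X by (rule order_trans[OF mult_left_mono[OF \<xi>(2)] s(2)]) simp
      moreover have "f n x = f n (x - X (Suc n)) + f n (X (Suc n))"
        by (simp flip: add)
      ultimately have "(1/3) ^ n * (2/3 * onorm (f n)) - onorm (f n) * ((1/3) ^ n / 2) \<le> \<bar>f n x\<bar>"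
        by linarith
      then have "(1/3) ^ n * onorm (f n) / 6 \<le> M"
        using M[of n] by (simp add: algebra_simps)
      moreover have "(4/3) ^ n \<le> (1/3) ^ n * onorm (f n)"
      proof -
        have "(4/3::real) ^ n = (1/3) ^ n * 4 ^ n" by (simp add: power_mult_distrib[symmetric])
        then show ?thesis using f(2)[of n] by simp
      qed
      ultimately show ?thesis by linarith
    qed
    moreover obtain n where "6 * M < (4/3::real) ^ n"
      using real_arch_pow[of "4/3" "6 * M"] by auto
    ultimately show False
      by (metis divide_le_eq mult.commute not_le zero_less_numeral)
  qed
  then obtain n where n: "\<And>f. f \<in> S \<Longrightarrow> onorm f \<le> 4 ^ n" by blast
  have "\<bar>f x\<bar> \<le> 4 ^ n * norm x" if "f \<in> S" for f x
    using onorm[OF lin[OF that], of x] n[OF that]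
    by (auto intro: order_trans[OF _ mult_right_mono])
  then show ?thesis
    using that[of "4 ^ n"] by auto
qed

text \<open>For symmetric \<open>B\<close> the solution minimises the energy
  \<open>J a = B a a - 2 * l a\<close>. The parallelogram identity together with coercivity makes
  every minimising sequence Cauchy, and the first variation at the minimiser is the
  equation.\<close>

lemma symmetric_Lax_Milgram:
  fixes B :: "'a::{real_inner, complete_space} \<Rightarrow> 'a \<Rightarrow> real"
  assumes B: "bounded_bilinear B" and sym: "\<And>a b. B a b = B b a"
    and coercive: "0 < m" "\<And>a. m * (norm a)\<^sup>2 \<le> B a a"
    and l: "bounded_linear l"
  obtains a where "\<And>b. B a b = l b"
proof -
  interpret B: bounded_bilinear B by fact
  interpret l: bounded_linear l by fact
  define J where "J a = B a a - 2 * l a" for a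
  obtain L where L: "\<And>a. \<bar>l a\<bar> \<le> norm a * L"
    using l.bounded by auto
  have "- (L\<^sup>2 / m) \<le> J a" for a
  proof -
    have "0 \<le> (m * norm a - L)\<^sup>2 / m"
      using coercive(1) by simp
    also have "\<dots> = m * (norm a)\<^sup>2 - 2 * (norm a * L) + L\<^sup>2 / m"
      using coercive(1) by (simp add: power2_eq_square field_simps)
    finally show ?thesis
      using coercive(2)[of a] L[of a] unfolding J_def by linarith
  qed
  then have bdd: "bdd_below (range J)"
    by (auto intro!: bdd_belowI)
  define d where "d = Inf (range J)"
  have d: "d \<le> J a" for a
    unfolding d_def using bdd by (intro cInf_lower) auto
  have "\<exists>a. J a < d + (1/2) ^ n" for n :: nat
    using cInf_lessD[of "range J" "d + (1/2) ^ n"] unfolding d_def by auto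
  then obtain X where X: "\<And>n::nat. J (X n) < d + (1/2) ^ n" by metis
  have par: "m / 2 * (norm (a - b))\<^sup>2 \<le> J a + J b - 2 * d" for a b
  proof -
    have "J a + J b = 2 * J ((1/2) *\<^sub>R (a + b)) + B (a - b) (a - b) / 2"
      by (simp add: J_def B.add_left B.add_right B.diff_left B.diff_right B.scaleR_left B.scaleR_right
          l.scaleR l.add sym[of b a] field_simps)
    then show ?thesis
      using d[of "(1/2) *\<^sub>R (a + b)"] coercive(2)[of "a - b"] by linarith
  qed
  have "Cauchy X"
  proof (rule metric_CauchyI)
    fix e :: real assume "0 < e"
    have "(\<lambda>n. 2 * (1/2::real) ^ n) \<longlonglongrightarrow> 2 * 0"
      by (intro tendsto_intros LIMSEQ_power_zero) auto
    moreover have "2 * 0 < m / 2 * e\<^sup>2"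
      using \<open>0 < e\<close> coercive(1) by simp
    ultimately have "\<forall>\<^sub>F n in sequentially. 2 * (1/2::real) ^ n < m / 2 * e\<^sup>2"
      by (rule order_tendstoD(2))
    then obtain N where N: "2 * (1/2::real) ^ N < m / 2 * e\<^sup>2"
      using eventually_happens by (metis trivial_limit_sequentially)
    have "dist (X i) (X j) < e" if "i \<ge> N" "j \<ge> N" for i j
    proof -
      have "(1/2::real) ^ i \<le> (1/2) ^ N" "(1/2::real) ^ j \<le> (1/2) ^ N"
        using that by (auto intro: power_decreasing)
      then have "m / 2 * (norm (X i - X j))\<^sup>2 < m / 2 * e\<^sup>2"
        using par[of "X i" "X j"] X[of i] X[of j] N by linarith
      then have "(norm (X i - X j))\<^sup>2 < e\<^sup>2"
        using coercive(1) by simp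
      then show ?thesis
        using \<open>0 < e\<close> by (simp add: dist_norm power2_less_imp_less)
    qed
    then show "\<exists>M. \<forall>i\<ge>M. \<forall>j\<ge>M. dist (X i) (X j) < e" by blast
  qed
  then obtain a where a: "X \<longlonglongrightarrow> a"
    using Cauchy_convergent_iff convergent_def by blast
  have "(\<lambda>n. J (X n)) \<longlonglongrightarrow> J a"
    unfolding J_def by (intro tendsto_intros B.tendsto l.tendsto a)
  moreover have "(\<lambda>n. d + (1/2) ^ n) \<longlonglongrightarrow> d + 0"
    by (intro tendsto_intros LIMSEQ_power_zero) auto
  ultimately have "J a \<le> d + 0"
    by (rule LIMSEQ_le) (auto intro!: exI[of _ 0] less_imp_le X)
  have "B a b = l b" for b
  proof (rule ccontr)
    assume ne: "B a b \<noteq> l b"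
    define r where "r = B a b - l b"
    \<comment> \<open>Essentially the optimal step in direction \<open>b\<close>; the added 1 keeps
      the denominator positive when \<open>B b b\<close> vanishes.\<close>
    define t where "t = - r / (B b b + 1)"
    have Bb: "0 \<le> B b b"
      using coercive(2)[of b] coercive(1) by (auto intro: order_trans[rotated])
    have "J (a + t *\<^sub>R b) = J a + 2 * t * r + t\<^sup>2 * B b b"
      by (simp add: J_def r_def B.add_left B.add_right B.scaleR_left B.scaleR_right l.scaleR l.add sym[of b a]
          power2_eq_square algebra_simps)
    then have "0 \<le> 2 * t * r + t\<^sup>2 * B b b"
      using d[of "a + t *\<^sub>R b"] \<open>J a \<le> d + 0\<close> by linarith
    also have "\<dots> \<le> 2 * t * r + t\<^sup>2 * (B b b + 1)"
      by (simp add: algebra_simps)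
    also have "\<dots> = t * r"
      using Bb by (simp add: t_def power2_eq_square)
    also have "\<dots> = - (r\<^sup>2 / (B b b + 1))"
      by (simp add: t_def power2_eq_square)
    also have "\<dots> < 0"
      using ne Bb by (simp add: r_def)
    finally show False by simp
  qed
  then show ?thesis using that by blast
qed

section \<open>Riesz bases of exponentials\<close>

text \<open>Bilinear, without conjugation: pairing with \<open>cis (s * t)\<close> then gives the
  value at \<open>s\<close> of the band-limited function, up to the factor
  \<open>1 / sqrt (2 * pi)\<close>. Conjugates are written out where an inner product is
  meant.\<close>

definition ipT :: "(real \<Rightarrow> complex) \<Rightarrow> (real \<Rightarrow> complex) \<Rightarrow> complex" where
  "ipT f g = (LINT t|lborel. indicator TT t * (f t * g t))"

lemma norm_ipT_le: "L2T f \<Longrightarrow> L2T g \<Longrightarrow> cmod (ipT f g) \<le> normT f * normT g"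
  unfolding ipT_def by (rule L2T_Cauchy_Schwarz)

lemma ipT_commute: "ipT f g = ipT g f"
  by (simp add: ipT_def mult.commute)

lemma ipT_diff_left: "L2T f \<Longrightarrow> L2T g \<Longrightarrow> L2T h \<Longrightarrow> ipT (\<lambda>t. f t - g t) h = ipT f h - ipT g h"
  using L2T_mult_integrable[of f h] L2T_mult_integrable[of g h] by (simp add: ipT_def algebra_simps)

lemma ipT_diff_right: "L2T f \<Longrightarrow> L2T g \<Longrightarrow> L2T h \<Longrightarrow> ipT h (\<lambda>t. f t - g t) = ipT h f - ipT h g"
  using ipT_diff_left by (simp add: ipT_commute[of h])

lemma ipT_sum_right:
  assumes "L2T f" "\<And>j. j \<in> K \<Longrightarrow> L2T (g j)"
  shows "ipT f (\<lambda>t. \<Sum>j\<in>K. c j * g j t) = (\<Sum>j\<in>K. c j * ipT f (g j))"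
proof -
  have "(\<lambda>t. indicator TT t * (f t * (\<Sum>j\<in>K. c j * g j t))) = (\<lambda>t. \<Sum>j\<in>K. c j * (indicator TT t * (f t * g j t)))"
    by (simp add: sum_distrib_left mult.left_commute)
  then show ?thesis
    using L2T_mult_integrable[OF assms] by (simp add: ipT_def)
qed

lemma ipT_cnj_self: "ipT f (\<lambda>t. cnj (f t)) = of_real ((normT f)\<^sup>2)"
proof -
  have "ipT f (\<lambda>t. cnj (f t)) = (LINT t|lborel. complex_of_real ((cmod (indicator TT t * f t))\<^sup>2))"
    unfolding ipT_def by (intro Bochner_Integration.integral_cong)
      (auto simp: complex_norm_square simp del: of_real_power split: split_indicator)
  also have "\<dots> = of_real ((normT f)\<^sup>2)"
    unfolding integral_complex_of_real normT_eq_normR normR_square ..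
  finally show ?thesis .
qed

lemma ipT_cong_AE:
  assumes "L2T f" "L2T f'" "L2T g" "AE t in lborel. t \<in> TT \<longrightarrow> f t = f' t"
  shows "ipT f g = ipT f' g"
  unfolding ipT_def
proof (rule integral_cong_AE)
  show "AE t in lborel. indicator TT t * (f t * g t) = indicator TT t * (f' t * g t)"
    using assms(4) by eventually_elim (auto split: split_indicator)
qed (use L2T_mult_integrable assms in auto)

lemma normT_eq_0_AE:
  assumes "L2T f" "normT f = 0"
  shows "AE t in lborel. t \<in> TT \<longrightarrow> f t = 0"
  using normR_eq_0_AE[of "\<lambda>t. indicator TT t * f t"] assms
  by (auto simp: L2T_iff_L2R normT_eq_normR elim!: eventually_mono split: split_indicator)

lemma normT_cong_AE:
  assumes "L2T f" "L2T g" "AE t in lborel. t \<in> TT \<longrightarrow> f t = g t"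
  shows "normT f = normT g"
  unfolding normT_eq_normR
proof (rule normR_cong_AE)
  show "AE t in lborel. indicator TT t * f t = indicator TT t * g t"
    using assms(3) by eventually_elim (auto split: split_indicator)
qed (use assms L2R_measurable in \<open>auto simp: L2T_iff_L2R\<close>)

section \<open>Paley-Wiener functions as Fourier integrals over \<open>TT\<close>\<close>

definition band :: "(real \<Rightarrow> complex) \<Rightarrow> real \<Rightarrow> complex" where
  "band F = ift (\<lambda>\<xi>. indicator TT \<xi> * F \<xi>)"

lemma integrable_L2T: "L2T F \<Longrightarrow> integrable lborel (\<lambda>\<xi>. indicator TT \<xi> * F \<xi>)"
  using L2T_mult_integrable[of F "\<lambda>_. 1"] L2T_bounded(1)[of "\<lambda>_. 1" 1] by simp

lemma L2T_cis [intro]: "L2T (\<lambda>t. cis (a * t))" "L2T (\<lambda>t. cis (- (a * t)))"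
  by (rule L2T_bounded(1)[where C=1]; simp)+

lemma band_eq_ipT: "band F s = of_real (1 / sqrt (2 * pi)) * ipT F (\<lambda>t. cis (s * t))"
  by (simp add: band_def ift_def ipT_def mult.assoc mult.commute[of s])

text \<open>Square integrability on a bounded interval implies integrability, so inversion applies.
  The closed interval and \<open>TT\<close> differ in the single point \<open>pi\<close>, which is
  null.\<close>

lemma PW_iff_band: "f \<in> PW \<longleftrightarrow> (\<exists>F. L2T F \<and> f = band F)"
proof
  assume "\<exists>F. L2T F \<and> f = band F"
  then obtain F where F: "L2T F" "f = band F" by blast
  let ?G = "\<lambda>\<xi>. indicator TT \<xi> * F \<xi>"
  have G: "integrable lborel ?G" "L2R ?G"
    using integrable_L2T F by (auto simp: L2T_iff_L2R)
  show "f \<in> PW"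
    unfolding PW_def F(2) band_def
    using ift_continuous[OF G(1)] L2R_ift[OF G] fourier_rel_ift[OF G]
    by (auto intro!: exI[of _ ?G] AE_I2 simp: TT_def split: split_indicator)
next
  assume "f \<in> PW"
  then obtain F where f: "continuous_on UNIV f" "fourier_rel f F"
    and F: "AE \<xi> in lborel. \<xi> \<notin> {-pi..pi} \<longrightarrow> F \<xi> = 0"
    by (auto simp: PW_def)
  let ?G = "\<lambda>\<xi>. indicator TT \<xi> * F \<xi>"
  note [measurable] = L2R_measurable[OF fourier_rel_L2R(2)[OF f(2)]]
  have "AE \<xi> in lborel. \<xi> \<noteq> pi"
    by (rule AE_lborel_singleton)
  with F have "AE \<xi> in lborel. ?G \<xi> = F \<xi>"
    by eventually_elim (auto simp: TT_def split: split_indicator)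
  then have fG: "fourier_rel f ?G"
    by (intro fourier_rel_cong_AE[OF f(2)]) auto
  then have "L2T F"
    using fourier_rel_L2R(2) by (simp add: L2T_iff_L2R)
  moreover have "f = band F"
    unfolding band_def by (rule fourier_inversion[OF fG integrable_L2T[OF \<open>L2T F\<close>] f(1)])
  ultimately show "\<exists>F. L2T F \<and> f = band F" by blast
qed

lemma CIS_interpolate:
  assumes "CIS x" "l2 c"
  obtains F where "L2T F" "\<And>j. ipT F (\<lambda>t. cis (x j * t)) = c j"
proof -
  have "l2 (\<lambda>j. of_real (1 / sqrt (2 * pi)) * c j)"
    by (rule l2_cmult[OF assms(2)])
  then obtain f where "f \<in> PW" "\<And>j. f (x j) = of_real (1 / sqrt (2 * pi)) * c j"
    using assms(1) unfolding CIS_def by metis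
  then obtain F where "L2T F" "\<And>j. band F (x j) = of_real (1 / sqrt (2 * pi)) * c j"
    unfolding PW_iff_band by blast
  then show ?thesis
    using that by (auto simp: band_eq_ipT)
qed

text \<open>The uniqueness half of interpolation, for zero data, combined with injectivity of
  \<open>ift\<close>.\<close>

lemma CIS_complete:
  assumes "CIS x" "L2T F" "\<And>j. ipT F (\<lambda>t. cis (x j * t)) = 0"
  shows "AE t in lborel. t \<in> TT \<longrightarrow> F t = 0"
proof -
  have "band F \<in> PW" "(\<lambda>_. 0) \<in> PW"
  proof -
    have "band (\<lambda>_. 0) = (\<lambda>_. 0)"
      by (simp add: fun_eq_iff band_def ift_def)
    then show "band F \<in> PW" "(\<lambda>_. 0) \<in> PW"
      unfolding PW_iff_band using assms(2) L2T_bounded(1)[of "\<lambda>_. 0" 0] by (metis, force)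
  qed
  moreover have "\<exists>!f. f \<in> PW \<and> (\<forall>j. f (x j) = 0)"
    using assms(1) l2_zero unfolding CIS_def by blast
  moreover have "band F (x j) = 0" for j
    using assms(3) by (simp add: band_eq_ipT)
  ultimately have "band F = (\<lambda>_. 0)" by blast
  then have "AE \<xi> in lborel. indicator TT \<xi> * F \<xi> = 0"
    using integrable_L2T[OF assms(2)] by (intro AE_zero_if_ift_zero) (auto simp: band_def fun_eq_iff)
  then show ?thesis
    by eventually_elim (auto split: split_indicator)
qed

section \<open>Exponential sums and the two Riesz bounds\<close>

definition tp :: "(int \<Rightarrow> real) \<Rightarrow> int set \<Rightarrow> (int \<Rightarrow> complex) \<Rightarrow> real \<Rightarrow> complex" where
  "tp x K c t = (\<Sum>j\<in>K. c j * cis (- (x j * t)))"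

lemma borel_measurable_tp [measurable]: "tp x K c \<in> borel_measurable borel"
  unfolding tp_def by measurable

lemma norm_tp_le: "cmod (tp x K c t) \<le> (\<Sum>j\<in>K. cmod (c j))"
  unfolding tp_def by (rule order_trans[OF norm_sum]) (simp add: norm_mult)

lemma L2T_tp [intro]: "L2T (tp x K c)"
  by (rule L2T_bounded(1)[OF _ norm_tp_le]) simp

lemma tp_shift: "tp x K c (t + s) = tp x K (\<lambda>j. c j * cis (- (x j * s))) t"
  by (simp add: tp_def distrib_left mult.assoc cis_mult add.commute)

lemma tp_cmult: "tp x K (\<lambda>j. a * c j) t = a * tp x K c t"
  by (simp add: tp_def sum_distrib_left mult.assoc)

lemma tp_diff: "tp x K (\<lambda>j. a j - b j) t = tp x K a t - tp x K b t"
  by (simp add: tp_def sum_subtractf left_diff_distrib)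

lemma cnj_tp: "cnj (tp x K c t) = (\<Sum>j\<in>K. cnj (c j) * cis (x j * t))"
  by (simp add: tp_def cis_cnj)

lemma ipT_cnj_tp:
  assumes "L2T F"
  shows "ipT F (\<lambda>t. cnj (tp x K c t)) = (\<Sum>j\<in>K. cnj (c j) * ipT F (\<lambda>t. cis (x j * t)))"
  unfolding cnj_tp using assms by (intro ipT_sum_right) auto

text \<open>An interpolant \<open>G\<close> of the data \<open>a\<close> represents
  \<open>a \<bullet> fin K b\<close> as a pairing with \<open>tp x K b\<close>, so these functionals
  are bounded at \<open>a\<close> by \<open>normT G\<close>, uniformly over all sums of norm at most
  1. Uniform boundedness, tested with \<open>a = fin K b\<close>, gives the constant.\<close>

lemma CIS_lower_bound:
  assumes "CIS x"
  shows "\<exists>C\<ge>0. \<forall>K c. finite K \<longrightarrow> norm (fin K c) \<le> C * normT (tp x K c)"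
proof -
  define S where "S = {\<lambda>a. a \<bullet> fin K b | K b. finite K \<and> normT (tp x K b) \<le> 1}"
  have "\<exists>M. \<forall>f\<in>S. \<bar>f a\<bar> \<le> M" for a
  proof -
    obtain G where G: "L2T G" "\<And>j. ipT G (\<lambda>t. cis (x j * t)) = nth a j"
      using CIS_interpolate[OF assms l2_nth[of a]] by metis
    have "\<bar>a \<bullet> fin K b\<bar> \<le> normT G" if "finite K" "normT (tp x K b) \<le> 1" for K b
    proof -
      have "a \<bullet> fin K b = Re (ipT G (\<lambda>t. cnj (tp x K b t)))"
      proof -
        have "nth a j \<bullet> b j = Re (cnj (b j) * nth a j)" for j
          by (simp add: inner_complex_def)
        then show ?thesis
          using that by (simp only: inner_fin ipT_cnj_tp[OF G(1)] G(2) Re_sum)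
      qed
      also have "\<bar>\<dots>\<bar> \<le> cmod (ipT G (\<lambda>t. cnj (tp x K b t)))"
        by (rule abs_Re_le_cmod)
      also have "\<dots> \<le> normT G * normT (tp x K b)"
        using norm_ipT_le[OF G(1) L2T_cnj[OF L2T_tp]] by simp
      also have "\<dots> \<le> normT G"
        using that by (intro mult_left_le) auto
      finally show ?thesis .
    qed
    then show ?thesis by (auto simp: S_def)
  qed
  moreover have "bounded_linear f" if "f \<in> S" for f
    using that by (auto simp: S_def bounded_linear_inner_left)
  ultimately obtain C where C: "0 \<le> C" "\<And>f a. f \<in> S \<Longrightarrow> \<bar>f a\<bar> \<le> C * norm a"
    using uniform_boundedness by metis
  have *: "norm (fin K b) \<le> C" if "finite K" "normT (tp x K b) \<le> 1" for K b
  proof -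
    have "(norm (fin K b))\<^sup>2 \<le> C * norm (fin K b)"
      using C(2)[of "\<lambda>a. a \<bullet> fin K b" "fin K b"] that by (auto simp: S_def power2_norm_eq_inner)
    then show ?thesis
      using C(1) by (cases "norm (fin K b) = 0") (auto simp: power2_eq_square)
  qed
  have fin_scale: "norm (fin K (\<lambda>j. of_real r * b j)) = \<bar>r\<bar> * norm (fin K b)" if "finite K" for K r b
  proof -
    have "fin K (\<lambda>j. of_real r * b j) = r *\<^sub>R fin K b"
      using that by (auto intro!: ell2_eqI simp: nth_fin)
    then show ?thesis by simp
  qed
  have "norm (fin K b) \<le> C * normT (tp x K b)" if K: "finite K" for K b
  proof -
    \<comment> \<open>Homogeneity. A sum of norm 0 may be scaled by any positive \<open>r\<close>,
      which forces its coefficients to vanish; otherwise \<open>r\<close> normalises the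
      sum.\<close>
    have r: "r * norm (fin K b) \<le> C" if "0 < r" "r * normT (tp x K b) \<le> 1" for r
      using *[OF K, of "\<lambda>j. of_real r * b j"] that by (simp add: tp_cmult[abs_def] normT_cmult fin_scale[OF K])
    show ?thesis
    proof (cases "normT (tp x K b) = 0")
      case True
      have "norm (fin K b) \<le> 0"
      proof (rule ccontr)
        assume "\<not> norm (fin K b) \<le> 0"
        then show False
          using r[of "(C + 1) / norm (fin K b)"] True C(1) by auto
      qed
      then show ?thesis using True by simp
    next
      case False
      then have "0 < normT (tp x K b)"
        using normT_nonneg[of "tp x K b"] by linarith
      then show ?thesis
        using r[of "1 / normT (tp x K b)"] by (simp add: field_simps)
    qed
  qed
  then show ?thesis using C(1) by blast
qed

text \<open>The difference of two exponentials has coefficients of norm \<open>sqrt 2\<close>, yet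
  on \<open>TT\<close> it is at most \<open>\<bar>x j - x k\<bar> * pi\<close>; the lower bound
  excludes nodes that are too close.\<close>

lemma CIS_separated:
  assumes "CIS x"
  obtains d where "0 < d" "\<And>j k. j \<noteq> k \<Longrightarrow> d \<le> \<bar>x j - x k\<bar>"
proof -
  obtain C where C: "0 \<le> C" "\<And>K c. finite K \<Longrightarrow> norm (fin K c) \<le> C * normT (tp x K c)"
    using CIS_lower_bound[OF assms] by blast
  have "1 \<le> (C * sqrt (2 * pi) * pi) * \<bar>x j - x k\<bar>" if "j \<noteq> k" for j k
  proof -
    let ?c = "\<lambda>i. if i = j then 1 else - 1"
    have "(norm (fin {j, k} ?c))\<^sup>2 = 2"
      using that by (simp add: norm_fin)
    then have "1\<^sup>2 \<le> (norm (fin {j, k} ?c))\<^sup>2" by simp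
    then have "1 \<le> norm (fin {j, k} ?c)"
      by (rule power2_le_imp_le) simp
    also have "\<dots> \<le> C * normT (tp x {j, k} ?c)"
      by (rule C(2)) simp
    also have "normT (tp x {j, k} ?c) \<le> (\<bar>x j - x k\<bar> * pi) * sqrt (2 * pi)"
    proof (rule L2T_bounded(2))
      fix t assume "t \<in> TT"
      have "tp x {j, k} ?c t = cis (- (x j * t)) - cis (- (x k * t))"
        using that by (simp add: tp_def)
      also have "cmod \<dots> = cmod (cis (- (x k * t)) * (cis (- ((x j - x k) * t)) - 1))"
        by (simp add: right_diff_distrib cis_mult algebra_simps)
      also have "\<dots> = cmod (iexp (- ((x j - x k) * t)) - 1)"
        by (simp add: norm_mult cis_conv_exp)
      also have "\<dots> \<le> \<bar>x j - x k\<bar> * \<bar>t\<bar>"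
        using iexp_approx1[of "- ((x j - x k) * t)" 0] by (simp add: abs_mult)
      also have "\<dots> \<le> \<bar>x j - x k\<bar> * pi"
        using \<open>t \<in> TT\<close> by (intro mult_left_mono) (auto simp: TT_def)
      finally show "cmod (tp x {j, k} ?c t) \<le> \<bar>x j - x k\<bar> * pi" .
    qed simp
    finally have "1 \<le> C * (\<bar>x j - x k\<bar> * pi * sqrt (2 * pi))"
      using C(1) by (auto intro: mult_left_mono)
    then show ?thesis by (simp add: mult_ac)
  qed
  note sep = this
  have pos: "0 < C * sqrt (2 * pi) * pi"
  proof -
    have "C * sqrt (2 * pi) * pi \<noteq> 0"
      using sep[of 0 1] by auto
    then show ?thesis using C(1) by (simp add: less_le)
  qed
  show ?thesis
  proof
    show "0 < 1 / (C * sqrt (2 * pi) * pi)" using pos by simp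
    show "1 / (C * sqrt (2 * pi) * pi) \<le> \<bar>x j - x k\<bar>" if "j \<noteq> k" for j k
      using sep[OF that] pos by (simp add: pos_divide_le_eq mult.commute)
  qed
qed

lemma sum_geometric_int_le:
  fixes r :: real
  assumes "0 \<le> r" "r < 1" "finite N"
  shows "(\<Sum>n\<in>N. r ^ nat \<bar>n\<bar>) \<le> 2 / (1 - r)"
proof -
  have *: "(\<Sum>n\<in>M. r ^ nat \<bar>n\<bar>) \<le> 1 / (1 - r)" if "finite M" "inj_on (\<lambda>n. nat \<bar>n\<bar>) M" for M
  proof -
    have "(\<Sum>n\<in>M. r ^ nat \<bar>n\<bar>) = (\<Sum>k\<in>(\<lambda>n. nat \<bar>n\<bar>) ` M. r ^ k)"
      using that by (simp add: sum.reindex)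
    also have "\<dots> \<le> (\<Sum>k. r ^ k)"
      using assms that by (intro sum_le_suminf summable_geometric) auto
    finally show ?thesis
      using assms by (simp add: suminf_geometric)
  qed
  have "(\<Sum>n\<in>N. r ^ nat \<bar>n\<bar>) = (\<Sum>n\<in>N \<inter> {0..}. r ^ nat \<bar>n\<bar>) + (\<Sum>n\<in>N \<inter> {..<0}. r ^ nat \<bar>n\<bar>)"
    using assms(3) by (subst sum.union_disjoint[symmetric]) (auto intro!: sum.cong)
  also have "\<dots> \<le> 1 / (1 - r) + 1 / (1 - r)"
    using assms(3) by (intro add_mono *) (auto simp: inj_on_def)
  finally show ?thesis by simp
qed

text \<open>In bins of width \<open>d\<close> counted from \<open>a\<close>, each bin holds at most
  one node, so the sum is dominated by a geometric series over the bin numbers. The bound is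
  independent of \<open>a\<close>, as a row-sum test requires.\<close>

lemma sum_gauss_separated:
  fixes x :: "int \<Rightarrow> real"
  assumes d: "0 < d" "\<And>j k. j \<noteq> k \<Longrightarrow> d \<le> \<bar>x j - x k\<bar>"
  shows "\<exists>D\<ge>0. \<forall>K a. finite K \<longrightarrow> (\<Sum>k\<in>K. gauss 1 (x k - a)) \<le> D"
proof -
  define r where "r = exp (- d)"
  have r: "0 \<le> r" "r < 1" using d by (auto simp: r_def)
  \<comment> \<open>The constant collects 1/2 from
    \<open>\<bar>u\<bar> \<le> u\<^sup>2 / 2 + 1/2\<close> and one bin width \<open>d\<close> lost
    by the floor.\<close>
  have bound: "gauss 1 u \<le> exp (1/2 + d) * r ^ nat \<bar>\<lfloor>u / d\<rfloor>\<bar>" for u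
  proof -
    have "real (nat \<bar>\<lfloor>u / d\<rfloor>\<bar>) \<le> \<bar>u / d\<bar> + 1" by linarith
    then have "d * real (nat \<bar>\<lfloor>u / d\<rfloor>\<bar>) \<le> d * (\<bar>u / d\<bar> + 1)"
      using d(1) by (intro mult_left_mono) auto
    also have "\<dots> = \<bar>u\<bar> + d"
      using d(1) by (simp add: abs_divide field_simps)
    also have "\<bar>u\<bar> \<le> u\<^sup>2 / 2 + 1/2"
      using sum_squares_bound[of "\<bar>u\<bar>" 1] by (simp add: field_simps)
    finally have "- (u\<^sup>2 / 2) \<le> (1/2 + d) + real (nat \<bar>\<lfloor>u / d\<rfloor>\<bar>) * (- d)"
      by (simp add: mult.commute)
    then have "exp (- (u\<^sup>2 / 2)) \<le> exp ((1/2 + d) + real (nat \<bar>\<lfloor>u / d\<rfloor>\<bar>) * (- d))" by simp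
    then show ?thesis
      unfolding exp_add exp_of_nat_mult by (simp add: gauss_def r_def)
  qed
  have "(\<Sum>k\<in>K. gauss 1 (x k - a)) \<le> exp (1/2 + d) * (2 / (1 - r))" if K: "finite K" for K a
  proof -
    let ?n = "\<lambda>k. \<lfloor>(x k - a) / d\<rfloor>"
    have inj: "inj_on ?n K"
    proof (rule inj_onI, rule ccontr)
      fix j k assume eq: "?n j = ?n k" and "j \<noteq> k"
      then have "\<bar>(x j - a) / d - (x k - a) / d\<bar> < 1" by linarith
      moreover have "(x j - a) / d - (x k - a) / d = (x j - x k) / d"
        by (simp flip: diff_divide_distrib)
      ultimately have "\<bar>x j - x k\<bar> < d"
        using d(1) by (simp add: abs_divide)
      then show False using d(2)[OF \<open>j \<noteq> k\<close>] by simp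
    qed
    have "(\<Sum>k\<in>K. gauss 1 (x k - a)) \<le> (\<Sum>k\<in>K. exp (1/2 + d) * r ^ nat \<bar>?n k\<bar>)"
      by (intro sum_mono bound)
    also have "\<dots> = exp (1/2 + d) * (\<Sum>n\<in>?n ` K. r ^ nat \<bar>n\<bar>)"
      by (simp add: sum.reindex[OF inj] sum_distrib_left)
    also have "\<dots> \<le> exp (1/2 + d) * (2 / (1 - r))"
      using K r by (intro mult_left_mono sum_geometric_int_le) auto
    finally show ?thesis .
  qed
  then show ?thesis using r by (intro exI[of _ "exp (1/2 + d) * (2 / (1 - r))"]) simp
qed

text \<open>The upper Riesz bound: majorise the indicator of \<open>TT\<close> by a Gaussian, so that the Gram matrix
  becomes a Gaussian of the pairwise distances, and apply Schur's test.\<close>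

lemma separated_upper_bound:
  fixes x :: "int \<Rightarrow> real"
  assumes d: "0 < d" "\<And>j k. j \<noteq> k \<Longrightarrow> d \<le> \<bar>x j - x k\<bar>"
  shows "\<exists>B\<ge>0. \<forall>K c. finite K \<longrightarrow> normT (tp x K c) \<le> B * norm (fin K c)"
proof -
  obtain D where D: "0 \<le> D" "\<And>K a. finite K \<Longrightarrow> (\<Sum>k\<in>K. gauss 1 (x k - a)) \<le> D"
    using sum_gauss_separated[of d x] d by blast
  \<comment> \<open>\<open>exp (pi\<^sup>2 / 2)\<close> is the reciprocal of \<open>gauss 1\<close>
    at the edge of \<open>TT\<close>, \<open>sqrt (2 * pi)\<close> comes from the transform of the
    Gaussian, and \<open>D\<close> bounds the row sums of the Gram matrix.\<close>
  define E where "E = exp (pi\<^sup>2 / 2) * sqrt (2 * pi) * D"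
  have E: "0 \<le> E" using D(1) by (simp add: E_def)
  have "(normT (tp x K c))\<^sup>2 \<le> E * (norm (fin K c))\<^sup>2" if K: "finite K" for K c
  proof -
    have gram: "of_real ((cmod (tp x K c t))\<^sup>2 * gauss 1 t) =
        (\<Sum>j\<in>K. \<Sum>k\<in>K. c j * cnj (c k) * (of_real (gauss 1 t) * cis (t * (x k - x j))))" for t
    proof -
      have "c j * cis (- (x j * t)) * cnj (c k * cis (- (x k * t))) * of_real (gauss 1 t) = c j * cnj (c k) * (of_real (gauss 1 t) * cis (t * (x k - x j)))" for j k
      proof -
        have "cis (t * (x k - x j)) = cis (- (x j * t)) * cis (x k * t)"
          by (simp add: cis_mult algebra_simps)
        then show ?thesis by (simp add: cis_cnj mult_ac)
      qed
      then show ?thesis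
        unfolding of_real_mult complex_norm_square tp_def
        by (simp only: cnj_sum sum_product) (simp only: sum_distrib_right)
    qed
    have int: "integrable lborel (\<lambda>t. complex_of_real (gauss 1 t) * cis (t * a))" for a
      by (intro integrable_mult_cis integrable_of_real_gauss) simp
    have g: "(LINT t|lborel. of_real (gauss 1 t) * cis (t * a)) = complex_of_real (sqrt (2 * pi) * gauss 1 a)" for a
      using ift_gauss_1[of a] by (simp add: ift_def field_simps)
    have "(\<lambda>t. of_real ((cmod (tp x K c t))\<^sup>2 * gauss 1 t) :: complex) =
        (\<lambda>t. \<Sum>j\<in>K. \<Sum>k\<in>K. c j * cnj (c k) * (of_real (gauss 1 t) * cis (t * (x k - x j))))"
      using gram by (rule ext)
    then have int2: "integrable lborel (\<lambda>t. complex_of_real ((cmod (tp x K c t))\<^sup>2 * gauss 1 t))"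
      and eq: "complex_of_real (LINT t|lborel. (cmod (tp x K c t))\<^sup>2 * gauss 1 t) =
        (\<Sum>j\<in>K. \<Sum>k\<in>K. c j * cnj (c k) * complex_of_real (sqrt (2 * pi) * gauss 1 (x k - x j)))"
      unfolding integral_complex_of_real[symmetric] using int by (simp_all add: g)
    have "(LINT t|lborel. (cmod (tp x K c t))\<^sup>2 * gauss 1 t) \<le>
        cmod (\<Sum>j\<in>K. \<Sum>k\<in>K. c j * cnj (c k) * complex_of_real (sqrt (2 * pi) * gauss 1 (x k - x j)))"
      unfolding eq[symmetric] by simp
    also have "\<dots> \<le> (\<Sum>j\<in>K. \<Sum>k\<in>K. cmod (c j) * cmod (c k) * (sqrt (2 * pi) * gauss 1 (x k - x j)))"
      by (intro sum_norm_le) (auto simp: norm_mult less_imp_le[OF gauss_pos] abs_of_pos[OF gauss_pos] intro!: sum_norm_le)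
    also have "\<dots> \<le> (\<Sum>j\<in>K. \<Sum>k\<in>K. sqrt (2 * pi) / 2 * ((cmod (c j))\<^sup>2 * gauss 1 (x k - x j)) + sqrt (2 * pi) / 2 * ((cmod (c k))\<^sup>2 * gauss 1 (x k - x j)))"
    proof (intro sum_mono)
      fix j k
      have "cmod (c j) * cmod (c k) * (sqrt (2 * pi) * gauss 1 (x k - x j)) \<le> ((cmod (c j))\<^sup>2 + (cmod (c k))\<^sup>2) / 2 * (sqrt (2 * pi) * gauss 1 (x k - x j))"
        using sum_squares_bound[of "cmod (c j)" "cmod (c k)"]
        by (intro mult_right_mono) (auto simp: less_imp_le[OF gauss_pos])
      then show "cmod (c j) * cmod (c k) * (sqrt (2 * pi) * gauss 1 (x k - x j)) \<le>
        sqrt (2 * pi) / 2 * ((cmod (c j))\<^sup>2 * gauss 1 (x k - x j)) + sqrt (2 * pi) / 2 * ((cmod (c k))\<^sup>2 * gauss 1 (x k - x j))"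
        by (simp add: algebra_simps add_divide_distrib)
    qed
    also have "\<dots> = sqrt (2 * pi) / 2 * (\<Sum>j\<in>K. \<Sum>k\<in>K. (cmod (c j))\<^sup>2 * gauss 1 (x k - x j)) +
        sqrt (2 * pi) / 2 * (\<Sum>j\<in>K. \<Sum>k\<in>K. (cmod (c k))\<^sup>2 * gauss 1 (x k - x j))"
      by (simp add: sum.distrib sum_distrib_left)
    also have "(\<Sum>j\<in>K. \<Sum>k\<in>K. (cmod (c k))\<^sup>2 * gauss 1 (x k - x j)) = (\<Sum>j\<in>K. \<Sum>k\<in>K. (cmod (c j))\<^sup>2 * gauss 1 (x k - x j))"
      by (subst sum.swap) (simp add: gauss_minus_commute)
    also have "sqrt (2 * pi) / 2 * (\<Sum>j\<in>K. \<Sum>k\<in>K. (cmod (c j))\<^sup>2 * gauss 1 (x k - x j)) +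
        sqrt (2 * pi) / 2 * (\<Sum>j\<in>K. \<Sum>k\<in>K. (cmod (c j))\<^sup>2 * gauss 1 (x k - x j)) =
        sqrt (2 * pi) * (\<Sum>j\<in>K. (cmod (c j))\<^sup>2 * (\<Sum>k\<in>K. gauss 1 (x k - x j)))"
      by (simp add: sum_distrib_left)
    also have "\<dots> \<le> sqrt (2 * pi) * (\<Sum>j\<in>K. (cmod (c j))\<^sup>2 * D)"
      by (intro mult_left_mono sum_mono D(2) K) auto
    also have "\<dots> = sqrt (2 * pi) * D * (norm (fin K c))\<^sup>2"
      using K by (simp add: norm_fin sum_distrib_left sum_distrib_right mult_ac)
    finally have gle: "(LINT t|lborel. (cmod (tp x K c t))\<^sup>2 * gauss 1 t) \<le> sqrt (2 * pi) * D * (norm (fin K c))\<^sup>2" .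
    have "(normT (tp x K c))\<^sup>2 \<le> (LINT t|lborel. exp (pi\<^sup>2 / 2) * ((cmod (tp x K c t))\<^sup>2 * gauss 1 t))"
      unfolding normT_eq_normR normR_square
    proof (rule integral_mono)
      show "integrable lborel (\<lambda>t. (cmod (indicator TT t * tp x K c t))\<^sup>2)"
        using L2T_tp[of x K c] by (simp add: L2T_iff_L2R L2R_def)
      show "integrable lborel (\<lambda>t. exp (pi\<^sup>2 / 2) * ((cmod (tp x K c t))\<^sup>2 * gauss 1 t))"
        using int2 by (intro integrable_mult_right) (simp only: complex_of_real_integrable_eq)
      fix t
      show "(cmod (indicator TT t * tp x K c t))\<^sup>2 \<le> exp (pi\<^sup>2 / 2) * ((cmod (tp x K c t))\<^sup>2 * gauss 1 t)"
      proof (cases "t \<in> TT")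
        case True
        then have "t\<^sup>2 \<le> pi\<^sup>2"
          by (auto simp: TT_def abs_le_square_iff[symmetric])
        then have "1 \<le> exp (pi\<^sup>2 / 2) * gauss 1 t"
          by (simp add: gauss_def flip: exp_add)
        then have "(cmod (tp x K c t))\<^sup>2 * 1 \<le> (cmod (tp x K c t))\<^sup>2 * (exp (pi\<^sup>2 / 2) * gauss 1 t)"
          by (intro mult_left_mono) auto
        then show ?thesis using True by (simp add: mult_ac)
      qed (simp add: less_imp_le[OF gauss_pos])
    qed
    also have "\<dots> \<le> exp (pi\<^sup>2 / 2) * (sqrt (2 * pi) * D * (norm (fin K c))\<^sup>2)"
      using gle by simp
    finally show ?thesis by (simp add: E_def mult.assoc)
  qed
  then have "normT (tp x K c) \<le> sqrt E * norm (fin K c)" if "finite K" for K c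
    using that E by (intro power2_le_imp_le[of "normT (tp x K c)"]) (auto simp: power_mult_distrib)
  then show ?thesis
    using E by (intro exI[of _ "sqrt E"]) simp
qed

text \<open>The bounds concern finite sums only and are carried over to \<open>ell2\<close> by
  density. \<open>complete\<close> supplies the spanning property, which turns a Riesz sequence into
  a Riesz basis.\<close>

locale riesz =
  fixes x :: "int \<Rightarrow> real" and C B :: real
  assumes C: "0 \<le> C" and B: "0 \<le> B"
    and lower: "\<And>K c. finite K \<Longrightarrow> norm (fin K c) \<le> C * normT (tp x K c)"
    and upper: "\<And>K c. finite K \<Longrightarrow> normT (tp x K c) \<le> B * norm (fin K c)"
    and complete: "\<And>F. L2T F \<Longrightarrow> (\<And>j. ipT F (\<lambda>t. cis (x j * t)) = 0) \<Longrightarrow> AE t in lborel. t \<in> TT \<longrightarrow> F t = 0"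

lemma CIS_riesz:
  assumes "CIS x"
  obtains C B where "riesz x C B"
proof -
  obtain C where "0 \<le> C" "\<And>K c. finite K \<Longrightarrow> norm (fin K c) \<le> C * normT (tp x K c)"
    using CIS_lower_bound[OF assms] by blast
  note C = this
  obtain d where d: "0 < d" "\<And>j k. j \<noteq> k \<Longrightarrow> d \<le> \<bar>x j - x k\<bar>"
    using CIS_separated[OF assms] by metis
  obtain B where "0 \<le> B" "\<And>K c. finite K \<Longrightarrow> normT (tp x K c) \<le> B * norm (fin K c)"
    using separated_upper_bound[of d x] d by blast
  with C have "riesz x C B"
    using CIS_complete[OF assms] by unfold_locales auto
  then show ?thesis by (rule that)
qed

section \<open>Synthesis on the whole line\<close>

text \<open>The infimum over admissible bounds is the infimum of a sequence of them, so countably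
  many null sets suffice and the essential supremum is itself admissible.\<close>

lemma esssupT_AE: "AE t in lborel. t \<in> TT \<longrightarrow> ennreal (cmod (g t)) \<le> esssupT g"
proof -
  let ?A = "{C. AE t in lborel. t \<in> TT \<longrightarrow> ennreal (cmod (g t)) \<le> C}"
  have "top \<in> ?A" by simp
  then obtain f :: "nat \<Rightarrow> ennreal" where f: "range f \<subseteq> ?A" "Inf ?A = (INF i. f i)"
    using ennreal_Inf_countable_INF[of ?A] by blast
  have "AE t in lborel. \<forall>i. t \<in> TT \<longrightarrow> ennreal (cmod (g t)) \<le> f i"
    unfolding AE_all_countable using f(1) by auto
  then show ?thesis
    by eventually_elim (auto simp: esssupT_def f(2) intro: INF_greatest)
qed

lemma essinfT_AE: "AE t in lborel. t \<in> TT \<longrightarrow> essinfT g \<le> ennreal (cmod (g t))"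
proof -
  let ?A = "{C. AE t in lborel. t \<in> TT \<longrightarrow> C \<le> ennreal (cmod (g t))}"
  have "0 \<in> ?A" by simp
  then obtain f :: "nat \<Rightarrow> ennreal" where f: "range f \<subseteq> ?A" "Sup ?A = (SUP i. f i)"
    using ennreal_Sup_countable_SUP[of ?A] by blast
  have "AE t in lborel. \<forall>i. t \<in> TT \<longrightarrow> f i \<le> ennreal (cmod (g t))"
    unfolding AE_all_countable using f(1) by auto
  then show ?thesis
    by eventually_elim (auto simp: essinfT_def f(2) intro: SUP_least)
qed

lemma AE_lborel_translate:
  assumes "AE t in lborel. P (t :: real)"
  shows "AE \<xi> in lborel. P (\<xi> - a)"
proof -
  obtain N where N: "{t. \<not> P t} \<subseteq> N" "N \<in> null_sets lborel"
    using assms by (auto simp: eventually_ae_filter)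
  then have "{\<xi>. \<xi> - a \<in> N} \<in> null_sets lborel"
    by (intro null_sets_translation)
  then show ?thesis
    by (rule AE_I') (use N(1) in auto)
qed

lemma floor_TT: "t \<in> TT \<Longrightarrow> \<lfloor>(t + 2 * pi * of_int k + pi) / (2 * pi)\<rfloor> = k"
  by (rule floor_unique) (auto simp: TT_def field_simps)

lemma minus_floor_TT: "\<xi> - 2 * pi * of_int \<lfloor>(\<xi> + pi) / (2 * pi)\<rfloor> \<in> TT"
proof -
  define m where "m = \<lfloor>(\<xi> + pi) / (2 * pi)\<rfloor>"
  have "of_int m \<le> (\<xi> + pi) / (2 * pi)" "(\<xi> + pi) / (2 * pi) < of_int m + 1"
    unfolding m_def by linarith+
  then show ?thesis
    unfolding m_def[symmetric] using pi_gt_zero by (auto simp: TT_def field_simps)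
qed

lemma AE_blocks:
  assumes "\<And>k::int. AE t in lborel. t \<in> TT \<longrightarrow> P (t + 2 * pi * of_int k)"
  shows "AE \<xi> in lborel. P \<xi>"
proof -
  have "AE \<xi> in lborel. \<forall>k::int. \<xi> - 2 * pi * of_int k \<in> TT \<longrightarrow> P (\<xi> - 2 * pi * of_int k + 2 * pi * of_int k)"
    unfolding AE_all_countable by (intro allI AE_lborel_translate assms)
  then show ?thesis
    by eventually_elim (use minus_floor_TT in fastforce)
qed

lemma AE_block:
  assumes "AE \<xi> in lborel. P \<xi>"
  shows "AE t in lborel. P (t + 2 * pi * of_int k)"
  using AE_lborel_translate[OF assms, of "- (2 * pi * of_int k)"] by simp

text \<open>\<open>U\<close> bounds the norm of \<open>u\<close> in the amalgam space W(L2,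
  l-infinity). Products of two such functions pair with weights of finite
  \<open>wiener_norm\<close>, that is, from W(L-infinity, l1).\<close>

definition amal :: "real \<Rightarrow> (real \<Rightarrow> complex) \<Rightarrow> bool" where
  "amal U u \<longleftrightarrow> u \<in> borel_measurable borel \<and> (\<forall>k. L2T (shift2pi k u) \<and> normT (shift2pi k u) \<le> U)"

lemma amal_measurable [measurable_dest]: "amal U u \<Longrightarrow> u \<in> borel_measurable borel"
  by (simp add: amal_def)

lemma amal_L2T: "amal U u \<Longrightarrow> L2T (shift2pi k u)" "amal U u \<Longrightarrow> normT (shift2pi k u) \<le> U"
  by (simp_all add: amal_def)

lemma amal_L2T_0: "amal U u \<Longrightarrow> L2T u" "amal U u \<Longrightarrow> normT u \<le> U"
  using amal_L2T[of U u 0] by (simp_all add: shift2pi_def)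

lemma amal_nonneg: "amal U u \<Longrightarrow> 0 \<le> U"
  using amal_L2T(2)[of U u 0] normT_nonneg order_trans by blast

lemma amal_cnj: "amal U u \<Longrightarrow> amal U (\<lambda>\<xi>. cnj (u \<xi>))"
  using L2T_cnj by (auto simp: amal_def shift2pi_def)

lemma measurable_shift2pi [measurable]:
  assumes [measurable]: "u \<in> borel_measurable borel"
  shows "shift2pi k u \<in> borel_measurable borel"
  unfolding shift2pi_def by measurable

lemma amal_bounded:
  assumes "u \<in> borel_measurable borel" "\<And>\<xi>. cmod (u \<xi>) \<le> M"
  shows "amal (M * sqrt (2 * pi)) u"
  using L2T_bounded[of "shift2pi k u" M for k] assms by (auto simp: amal_def shift2pi_def)

lemma nn_integral_TT_mult_le:
  assumes "L2T u" "L2T v"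
  shows "(\<integral>\<^sup>+ t. ennreal (cmod (u t) * cmod (v t)) * indicator TT t \<partial>lborel) \<le> ennreal (normT u * normT v)"
proof -
  let ?f = "\<lambda>t. indicator TT t * u t" and ?g = "\<lambda>t. indicator TT t * v t"
  have L2: "L2R ?f" "L2R ?g" using assms by (simp_all add: L2T_iff_L2R)
  note [measurable] = L2[THEN L2R_measurable]
  have int: "integrable lborel (\<lambda>x. cmod (?f x) * cmod (?g x))"
    using integrable_norm[OF L2R_mult_integrable[OF L2]] by (simp add: norm_mult)
  have "(\<integral>\<^sup>+ t. ennreal (cmod (u t) * cmod (v t)) * indicator TT t \<partial>lborel) = (\<integral>\<^sup>+ t. ennreal (cmod (?f t) * cmod (?g t)) \<partial>lborel)"
    by (intro nn_integral_cong) (auto split: split_indicator)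
  also have "\<dots> = ennreal (LINT t|lborel. cmod (?f t) * cmod (?g t))"
    by (rule nn_integral_eq_integral[OF int]) auto
  also have "\<dots> \<le> ennreal (normT u * normT v)"
    unfolding normT_eq_normR by (intro ennreal_leI L2R_Cauchy_Schwarz_norm L2)
  finally show ?thesis .
qed

text \<open>Hoelder's inequality with exponents infinity, 2, 2 on each block; the summation over
  blocks falls on \<open>w\<close> alone.\<close>

lemma nn_integral_amalgam_le:
  assumes w: "w \<in> borel_measurable borel" and u: "amal U u" and v: "amal V v"
  shows "(\<integral>\<^sup>+ k. (\<integral>\<^sup>+ t. ennreal (cmod (shift2pi k w t) * (cmod (shift2pi k u t) * cmod (shift2pi k v t))) * indicator TT t \<partial>lborel) \<partial>count_space S)
    \<le> (\<integral>\<^sup>+ k. esssupT (shift2pi k w) \<partial>count_space S) * ennreal (U * V)"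
proof -
  note [measurable] = w amal_measurable[OF u] amal_measurable[OF v]
  have "(\<integral>\<^sup>+ t. ennreal (cmod (shift2pi k w t) * (cmod (shift2pi k u t) * cmod (shift2pi k v t))) * indicator TT t \<partial>lborel) \<le> esssupT (shift2pi k w) * ennreal (U * V)" for k
  proof -
    have "(\<integral>\<^sup>+ t. ennreal (cmod (shift2pi k w t) * (cmod (shift2pi k u t) * cmod (shift2pi k v t))) * indicator TT t \<partial>lborel) \<le>
      (\<integral>\<^sup>+ t. esssupT (shift2pi k w) * (ennreal (cmod (shift2pi k u t) * cmod (shift2pi k v t)) * indicator TT t) \<partial>lborel)"
    proof (rule nn_integral_mono_AE, use esssupT_AE[of "shift2pi k w"] in eventually_elim)
      case (elim t)
      then show ?case
        by (auto simp: ennreal_mult mult.assoc split: split_indicator intro!: mult_right_mono)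
    qed
    also have "\<dots> = esssupT (shift2pi k w) * (\<integral>\<^sup>+ t. ennreal (cmod (shift2pi k u t) * cmod (shift2pi k v t)) * indicator TT t \<partial>lborel)"
      by (rule nn_integral_cmult) measurable
    also have "\<dots> \<le> esssupT (shift2pi k w) * ennreal (normT (shift2pi k u) * normT (shift2pi k v))"
      by (intro mult_left_mono nn_integral_TT_mult_le amal_L2T(1)[OF u] amal_L2T(1)[OF v]) auto
    also have "\<dots> \<le> esssupT (shift2pi k w) * ennreal (U * V)"
      by (intro mult_left_mono ennreal_leI mult_mono amal_L2T(2)[OF u] amal_L2T(2)[OF v]) (auto simp: amal_nonneg[OF u])
    finally show ?thesis .
  qed
  then show ?thesis
    by (subst nn_integral_multc[symmetric]) (auto intro!: nn_integral_mono)
qed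

lemma nn_integral_amalgam_UNIV:
  assumes [measurable]: "w \<in> borel_measurable borel" and u: "amal U u" and v: "amal V v"
    and W: "wiener_norm w \<le> ennreal W" "0 \<le> W"
  shows "(\<integral>\<^sup>+ \<xi>. ennreal (cmod (w \<xi> * (u \<xi> * v \<xi>))) \<partial>lborel) \<le> ennreal (W * (U * V))"
proof -
  note [measurable] = amal_measurable[OF u] amal_measurable[OF v]
  have "(\<integral>\<^sup>+ \<xi>. ennreal (cmod (w \<xi> * (u \<xi> * v \<xi>))) \<partial>lborel) \<le> ennreal W * ennreal (U * V)"
    using order_trans[OF nn_integral_amalgam_le[OF assms(1) u v, of UNIV] mult_right_mono[OF W(1)[unfolded wiener_norm_def]]]
    by (subst nn_integral_blocks) (auto simp: norm_mult shift2pi_def)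
  then show ?thesis
    using W(2) amal_nonneg[OF u] amal_nonneg[OF v] by (simp add: ennreal_mult)
qed

lemma integral_amalgam:
  assumes [measurable]: "w \<in> borel_measurable borel" and u: "amal U u" and v: "amal V v"
    and W: "wiener_norm w \<le> ennreal W" "0 \<le> W"
  shows "integrable lborel (\<lambda>\<xi>. w \<xi> * (u \<xi> * v \<xi>))" "cmod (LINT \<xi>|lborel. w \<xi> * (u \<xi> * v \<xi>)) \<le> W * (U * V)"
proof -
  note [measurable] = amal_measurable[OF u] amal_measurable[OF v]
  note le = nn_integral_amalgam_UNIV[OF assms]
  show int: "integrable lborel (\<lambda>\<xi>. w \<xi> * (u \<xi> * v \<xi>))"
    by (rule integrableI_bounded) (use le in \<open>auto intro: le_less_trans\<close>)
  have "ennreal (cmod (LINT \<xi>|lborel. w \<xi> * (u \<xi> * v \<xi>))) \<le> ennreal (W * (U * V))"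
    using integral_norm_bound_ennreal[OF int] le by (rule order_trans)
  then show "cmod (LINT \<xi>|lborel. w \<xi> * (u \<xi> * v \<xi>)) \<le> W * (U * V)"
    using W(2) amal_nonneg[OF u] amal_nonneg[OF v] by (simp add: ennreal_le_iff)
qed

lemma fin_eq:
  assumes "finite K" "\<And>j. j \<notin> K \<Longrightarrow> nth a j = 0"
  shows "fin K (nth a) = a"
  using assms by (intro ell2_eqI) (auto simp: nth_fin)

lemma tendsto_zero_finite_subsets:
  fixes f r :: "'a set \<Rightarrow> real"
  assumes "\<And>F. finite F \<Longrightarrow> f F \<le> r F" "\<And>F. 0 \<le> f F" "(r \<longlongrightarrow> 0) (finite_subsets_at_top UNIV)"
  shows "(f \<longlongrightarrow> 0) (finite_subsets_at_top UNIV)"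
  by (rule tendsto_sandwich[OF _ _ tendsto_const assms(3)])
    (auto simp: assms intro!: eventually_finite_subsets_at_top_weakI)

lemma le_lim_finite_subsets:
  fixes l :: real
  assumes "\<And>F. finite F \<Longrightarrow> l \<le> r F" "(r \<longlongrightarrow> R) (finite_subsets_at_top UNIV)"
  shows "l \<le> R"
  using assms by (intro tendsto_lowerbound[OF _ _ finite_subsets_at_top_neq_bot])
    (auto intro!: eventually_finite_subsets_at_top_weakI)

lemma fin_empty [simp]: "fin {} c = 0"
  by (rule ell2_eqI) (simp add: nth_fin)

context riesz
begin

lemma norm_fin_mult_cis: "finite K \<Longrightarrow> norm (fin K (\<lambda>j. c j * cis (s j))) = norm (fin K c)"
  using norm_fin[of K "\<lambda>j. c j * cis (s j)"] norm_fin[of K c]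
  by (simp add: norm_mult flip: power2_eq_iff_nonneg)

text \<open>A shift by a multiple of \<open>2 * pi\<close> multiplies the coefficients by unimodular
  numbers, so one constant serves all blocks.\<close>

lemma upper_shift:
  assumes "finite K"
  shows "normT (shift2pi k (tp x K c)) \<le> B * norm (fin K c)"
  using upper[OF assms, of "\<lambda>j. c j * cis (- (x j * (2 * pi * of_int k)))"] norm_fin_mult_cis[OF assms]
  by (simp add: shift2pi_def tp_shift[abs_def])

lemma amal_tp:
  assumes "finite K"
  shows "amal (B * norm (fin K c)) (tp x K c)"
  using upper_shift[OF assms] L2T_tp
  by (auto simp: amal_def shift2pi_def tp_shift[abs_def])

lemma tp_eq_fin:
  assumes "finite K" "F \<subseteq> K"
  shows "tp x F (nth a) = tp x K (nth (fin F (nth a)))"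
proof
  fix t
  have "(\<Sum>j\<in>F. nth a j * cis (- (x j * t))) = (\<Sum>j\<in>K. nth (fin F (nth a)) j * cis (- (x j * t)))"
    using assms finite_subset[OF assms(2,1)] by (intro sum.mono_neutral_cong_left) (auto simp: nth_fin)
  then show "tp x F (nth a) t = tp x K (nth (fin F (nth a))) t"
    by (simp add: tp_def)
qed

lemma normT_tp_diff:
  assumes "finite F" "finite G"
  shows "normT (\<lambda>t. shift2pi k (tp x F (nth a)) t - shift2pi k (tp x G (nth a)) t) \<le> B * norm (fin F (nth a) - fin G (nth a))"
proof -
  let ?K = "F \<union> G" and ?b = "fin F (nth a) - fin G (nth a)"
  have b: "fin ?K (nth ?b) = ?b"
    using assms by (intro fin_eq) (auto simp: nth_fin)
  have "(\<lambda>t. shift2pi k (tp x F (nth a)) t - shift2pi k (tp x G (nth a)) t) = shift2pi k (tp x ?K (nth ?b))"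
  proof -
    have "nth ?b = (\<lambda>j. nth (fin F (nth a)) j - nth (fin G (nth a)) j)"
      by (rule ext) simp
    then show ?thesis
      using assms tp_eq_fin[of ?K F a] tp_eq_fin[of ?K G a]
      by (simp add: shift2pi_def tp_diff[symmetric])
  qed
  then show ?thesis
    using upper_shift[of ?K k "nth ?b"] assms b by simp
qed

lemma ex_fin_close:
  assumes "0 < e"
  shows "\<exists>l. B * norm (a - fin (set l) (nth a)) < e"
proof -
  have "((\<lambda>F. B * norm (a - fin F (nth a))) \<longlongrightarrow> B * norm (a - a)) (finite_subsets_at_top UNIV)"
    by (intro tendsto_intros fin_tendsto)
  then have "\<forall>\<^sub>F F in finite_subsets_at_top UNIV. B * norm (a - fin F (nth a)) < e"
    using assms by (intro order_tendstoD(2)) auto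
  then obtain F where "finite F" "B * norm (a - fin F (nth a)) < e"
    unfolding eventually_finite_subsets_at_top by blast
  then show ?thesis
    using finite_list by metis
qed

text \<open>On each block the finite sums are Cauchy with the tail of \<open>a\<close> as rate,
  hence have an L2 limit; the limits on the blocks are then glued.\<close>

lemma synth_exists:
  "\<exists>H. H \<in> borel_measurable borel \<and> (\<forall>k. L2T (shift2pi k H) \<and>
    (\<forall>F. finite F \<longrightarrow> normT (\<lambda>t. shift2pi k H t - shift2pi k (tp x F (nth a)) t) \<le> B * norm (a - fin F (nth a))))"
proof -
  have "\<exists>h. L2R h \<and> (\<forall>l. normR (\<lambda>t. indicator TT t * shift2pi k (tp x (set l) (nth a)) t - h t) \<le> B * norm (a - fin (set l) (nth a)))" for k
  proof -
    \<comment> \<open>Finite sets are enumerated by lists, because the completeness lemma wants a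
      family over a whole type and \<open>set l\<close> runs through exactly the finite
      sets.\<close>
    let ?u = "\<lambda>l t. indicator TT t * shift2pi k (tp x (set l) (nth a)) t"
    have L2: "L2R (?u l)" for l
      using amal_L2T(1)[OF amal_tp[of "set l" "nth a"], of k] by (simp add: L2T_iff_L2R)
    have "normR (\<lambda>t. ?u l t - ?u l' t) \<le> B * norm (a - fin (set l) (nth a)) + B * norm (a - fin (set l') (nth a))" for l l'
    proof -
      have "normR (\<lambda>t. ?u l t - ?u l' t) \<le> B * norm (fin (set l) (nth a) - fin (set l') (nth a))"
        using normT_tp_diff[of "set l" "set l'" k a] by (simp add: normT_eq_normR right_diff_distrib)
      also have "\<dots> \<le> B * (norm (a - fin (set l) (nth a)) + norm (a - fin (set l') (nth a)))"
        using norm_triangle_ineq4[of "a - fin (set l') (nth a)" "a - fin (set l) (nth a)"] B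
        by (intro mult_left_mono) auto
      finally show ?thesis by (simp add: distrib_left)
    qed
    then obtain h where "L2R h" "\<And>l. normR (\<lambda>t. ?u l t - h t) \<le> B * norm (a - fin (set l) (nth a))"
      using L2R_complete[of ?u "\<lambda>l. B * norm (a - fin (set l) (nth a))"] L2 ex_fin_close by metis
    then show ?thesis by blast
  qed
  then obtain h where h: "\<And>k::int. L2R (h k)"
    "\<And>k l. normR (\<lambda>t. indicator TT t * shift2pi k (tp x (set l) (nth a)) t - h k t) \<le> B * norm (a - fin (set l) (nth a))"
    by metis
  note [measurable] = h(1)[THEN L2R_measurable]
  \<comment> \<open>The floor is the number of the block containing \<xi>; subtracting that many
    periods brings \<xi> back to \<open>TT\<close>.\<close>
  define H where "H \<xi> = h \<lfloor>(\<xi> + pi) / (2 * pi)\<rfloor> (\<xi> - 2 * pi * of_int \<lfloor>(\<xi> + pi) / (2 * pi)\<rfloor>)" for \<xi>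
  have H: "shift2pi k H t = h k t" if "t \<in> TT" for k t
    using floor_TT[OF that, of k] by (simp add: H_def shift2pi_def)
  have L2: "L2T (h k)" for k
    using L2R_mult_bounded(1)[OF _ h(1), of "indicator TT" 1] by (simp add: L2T_iff_L2R indicator_def)
  have "H \<in> borel_measurable borel"
    unfolding H_def
    by (rule measurable_compose_countable[where g="\<lambda>\<xi>. \<lfloor>(\<xi> + pi) / (2 * pi)\<rfloor>" and f="\<lambda>k \<xi>. h k (\<xi> - 2 * pi * of_int k)"]) auto
  moreover have "L2T (shift2pi k H)" for k
  proof -
    have "(\<lambda>t. indicator TT t * shift2pi k H t) = (\<lambda>t. indicator TT t * h k t)"
      using H by (auto split: split_indicator)
    then show ?thesis using L2[of k] by (simp add: L2T_iff_L2R)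
  qed
  moreover have "normT (\<lambda>t. shift2pi k H t - shift2pi k (tp x F (nth a)) t) \<le> B * norm (a - fin F (nth a))" if "finite F" for k F
  proof -
    obtain l where l: "set l = F" using finite_list[OF \<open>finite F\<close>] by blast
    have "normT (\<lambda>t. shift2pi k H t - shift2pi k (tp x F (nth a)) t) = normT (\<lambda>t. shift2pi k (tp x F (nth a)) t - h k t)"
      unfolding normT_minus_commute[of "shift2pi k H"] normT_eq_normR using H
      by (intro arg_cong[where f=normR]) (auto split: split_indicator)
    also have "\<dots> \<le> 1 * normR (\<lambda>t. indicator TT t * shift2pi k (tp x F (nth a)) t - h k t)"
      unfolding normT_eq_normR
    proof (rule L2R_bound_AE)
      show "L2R (\<lambda>t. indicator TT t * shift2pi k (tp x F (nth a)) t - h k t)"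
        using amal_L2T(1)[OF amal_tp[OF that, of "nth a"], of k] h(1) by (auto simp: L2T_iff_L2R)
    qed (auto split: split_indicator simp: shift2pi_def)
    also have "\<dots> \<le> B * norm (a - fin F (nth a))"
      using h(2)[of k l] l by simp
    finally show ?thesis .
  qed
  ultimately show ?thesis by blast
qed

text \<open>The exponential series with coefficients \<open>a\<close>, prolonged from
  \<open>TT\<close> to the whole line: the operator E of the English notions, expressed through
  coefficients. It is determined only up to null sets.\<close>

definition synth :: "ell2 \<Rightarrow> real \<Rightarrow> complex" where
  "synth a = (SOME H. H \<in> borel_measurable borel \<and> (\<forall>k. L2T (shift2pi k H) \<and>
    (\<forall>F. finite F \<longrightarrow> normT (\<lambda>t. shift2pi k H t - shift2pi k (tp x F (nth a)) t) \<le> B * norm (a - fin F (nth a)))))"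

lemma synth: "synth a \<in> borel_measurable borel" "L2T (shift2pi k (synth a))"
  "finite F \<Longrightarrow> normT (\<lambda>t. shift2pi k (synth a) t - shift2pi k (tp x F (nth a)) t) \<le> B * norm (a - fin F (nth a))"
  using someI_ex[OF synth_exists[of a]] unfolding synth_def[symmetric] by blast+

lemma amal_synth: "amal (B * norm a) (synth a)"
  using synth(1)[of a] synth(2)[where a=a] synth(3)[where F="{}" and a=a] by (auto simp: amal_def shift2pi_def tp_def)

lemma amal_synth_diff:
  assumes "finite F"
  shows "amal (B * norm (a - fin F (nth a))) (\<lambda>\<xi>. synth a \<xi> - tp x F (nth a) \<xi>)"
proof -
  note [measurable] = synth(1)
  show ?thesis
    using L2T_diff[OF synth(2) amal_L2T(1)[OF amal_tp[OF assms]]] assms synth(3)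
    by (auto simp: amal_def shift2pi_def)
qed

lemma norm_le_synth: "norm a \<le> C * normT (synth a)"
proof -
  have "norm (fin F (nth a)) \<le> C * normT (synth a) + C * (B * norm (a - fin F (nth a)))" if "finite F" for F
  proof -
    have "norm (fin F (nth a)) \<le> C * normT (tp x F (nth a))"
      using lower that .
    also have "normT (tp x F (nth a)) \<le> normT (\<lambda>t. tp x F (nth a) t - synth a t) + normT (synth a)"
      by (intro normT_le_add_diff L2T_tp amal_L2T_0[OF amal_synth])
    also have "normT (\<lambda>t. tp x F (nth a) t - synth a t) \<le> B * norm (a - fin F (nth a))"
      using amal_L2T_0(2)[OF amal_synth_diff[OF that]] by (simp add: normT_minus_commute)
    finally show ?thesis
      using C by (simp add: distrib_left mult_left_mono)
  qed
  then have "\<forall>\<^sub>F F in finite_subsets_at_top UNIV. norm (fin F (nth a)) \<le> C * normT (synth a) + C * (B * norm (a - fin F (nth a)))"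
    by (intro eventually_finite_subsets_at_top_weakI)
  moreover have "((\<lambda>F. norm (fin F (nth a))) \<longlongrightarrow> norm a) (finite_subsets_at_top UNIV)"
    by (intro tendsto_intros fin_tendsto)
  moreover have "((\<lambda>F. C * normT (synth a) + C * (B * norm (a - fin F (nth a)))) \<longlongrightarrow> C * normT (synth a) + C * (B * norm (a - a))) (finite_subsets_at_top UNIV)"
    by (intro tendsto_intros fin_tendsto)
  ultimately have "norm a \<le> C * normT (synth a) + C * (B * norm (a - a))"
    by (intro tendsto_le[OF finite_subsets_at_top_neq_bot])
  then show ?thesis by simp
qed

text \<open>As \<open>synth\<close> is a choice, its linearity has to be derived and holds only
  almost everywhere; this is the criterion used for it.\<close>

lemma synth_unique:
  assumes G: "\<And>k. L2T (shift2pi k G)"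
    and lim: "\<And>k. ((\<lambda>F. normT (\<lambda>t. shift2pi k G t - shift2pi k (tp x F (nth a)) t)) \<longlongrightarrow> 0) (finite_subsets_at_top UNIV)"
  shows "AE \<xi> in lborel. synth a \<xi> = G \<xi>"
proof (rule AE_blocks)
  fix k
  let ?d = "\<lambda>t. shift2pi k (synth a) t - shift2pi k G t"
  have d: "L2T ?d" using synth(2) G by auto
  have "normT ?d \<le> B * norm (a - fin F (nth a)) + normT (\<lambda>t. shift2pi k G t - shift2pi k (tp x F (nth a)) t)" if "finite F" for F
    using synth(3)[OF that, where k=k and a=a]
      normT_triangle_via[of "shift2pi k (synth a)" "shift2pi k (tp x F (nth a))" "shift2pi k G"]
      L2T_diff[OF synth(2)[where a=a and k=k] amal_L2T(1)[OF amal_tp[OF that, of "nth a"], of k]]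
      L2T_diff[OF amal_L2T(1)[OF amal_tp[OF that, of "nth a"], of k] G[of k]]
    by (simp add: normT_minus_commute[of "shift2pi k G"])
  moreover have "((\<lambda>F. B * norm (a - fin F (nth a)) + normT (\<lambda>t. shift2pi k G t - shift2pi k (tp x F (nth a)) t)) \<longlongrightarrow> B * norm (a - a) + 0) (finite_subsets_at_top UNIV)"
    by (intro tendsto_intros fin_tendsto lim)
  ultimately have "normT ?d \<le> B * norm (a - a) + 0"
    by (rule le_lim_finite_subsets)
  then have "normT ?d = 0" using normT_nonneg[of ?d] by simp
  then show "AE t in lborel. t \<in> TT \<longrightarrow> synth a (t + 2 * pi * of_int k) = G (t + 2 * pi * of_int k)"
    using normT_eq_0_AE[OF d] by (simp add: shift2pi_def)
qed

lemma synth_fin: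
  assumes "finite K"
  shows "AE \<xi> in lborel. synth (fin K c) \<xi> = tp x K c \<xi>"
proof (rule synth_unique)
  fix k
  show "L2T (shift2pi k (tp x K c))"
    by (rule amal_L2T(1)[OF amal_tp[OF assms]])
  have "\<forall>\<^sub>F F in finite_subsets_at_top UNIV. normT (\<lambda>t. shift2pi k (tp x K c) t - shift2pi k (tp x F (nth (fin K c))) t) = 0"
    unfolding eventually_finite_subsets_at_top
  proof (intro exI[of _ K] conjI allI impI assms)
    fix F assume F: "finite F \<and> K \<subseteq> F \<and> F \<subseteq> UNIV"
    have "tp x F (nth (fin K c)) t = tp x K c t" for t
      unfolding tp_def using F assms by (intro sum.mono_neutral_cong_right) (auto simp: nth_fin)
    then show "normT (\<lambda>t. shift2pi k (tp x K c) t - shift2pi k (tp x F (nth (fin K c))) t) = 0"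
      by (simp add: shift2pi_def normT_def set_lebesgue_integral_def)
  qed auto
  then show "((\<lambda>F. normT (\<lambda>t. shift2pi k (tp x K c) t - shift2pi k (tp x F (nth (fin K c))) t)) \<longlongrightarrow> 0) (finite_subsets_at_top UNIV)"
    by (rule tendsto_eventually)
qed

lemma synth_add: "AE \<xi> in lborel. synth (a + b) \<xi> = synth a \<xi> + synth b \<xi>"
proof (rule synth_unique)
  fix k
  let ?s = "\<lambda>\<xi>. synth a \<xi> + synth b \<xi>"
  show "L2T (shift2pi k ?s)"
    using L2T_add[OF synth(2)[where a=a and k=k] synth(2)[where a=b and k=k]] by (simp add: shift2pi_def)
  let ?r = "\<lambda>F. B * norm (a - fin F (nth a)) + B * norm (b - fin F (nth b))"
  have le: "normT (\<lambda>t. shift2pi k ?s t - shift2pi k (tp x F (nth (a + b))) t) \<le> ?r F" if "finite F" for F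
  proof -
    have "(\<lambda>t. shift2pi k ?s t - shift2pi k (tp x F (nth (a + b))) t) =
      (\<lambda>t. shift2pi k (\<lambda>\<xi>. synth a \<xi> - tp x F (nth a) \<xi>) t + shift2pi k (\<lambda>\<xi>. synth b \<xi> - tp x F (nth b) \<xi>) t)"
      by (simp add: shift2pi_def tp_def sum.distrib distrib_right fun_eq_iff)
    then show ?thesis
      using normT_triangle[OF amal_L2T(1)[OF amal_synth_diff[OF that, of a]] amal_L2T(1)[OF amal_synth_diff[OF that, of b]], of k k]
        amal_L2T(2)[OF amal_synth_diff[OF that, of a], of k] amal_L2T(2)[OF amal_synth_diff[OF that, of b], of k] by simp
  qed
  have "(?r \<longlongrightarrow> B * norm (a - a) + B * norm (b - b)) (finite_subsets_at_top UNIV)"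
    by (intro tendsto_intros fin_tendsto)
  then have "(?r \<longlongrightarrow> 0) (finite_subsets_at_top UNIV)" by simp
  from tendsto_zero_finite_subsets[OF le normT_nonneg this]
  show "((\<lambda>F. normT (\<lambda>t. shift2pi k ?s t - shift2pi k (tp x F (nth (a + b))) t)) \<longlongrightarrow> 0) (finite_subsets_at_top UNIV)" .
qed

lemma synth_scaleR: "AE \<xi> in lborel. synth (r *\<^sub>R a) \<xi> = of_real r * synth a \<xi>"
proof (rule synth_unique)
  fix k
  let ?s = "\<lambda>\<xi>. of_real r * synth a \<xi>"
  show "L2T (shift2pi k ?s)"
    using L2T_cmult[OF synth(2)[where a=a and k=k], of "of_real r"] by (simp add: shift2pi_def)
  let ?r = "\<lambda>F. \<bar>r\<bar> * (B * norm (a - fin F (nth a)))"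
  have le: "normT (\<lambda>t. shift2pi k ?s t - shift2pi k (tp x F (nth (r *\<^sub>R a))) t) \<le> ?r F" if "finite F" for F
  proof -
    have "(\<lambda>t. shift2pi k ?s t - shift2pi k (tp x F (nth (r *\<^sub>R a))) t) =
      (\<lambda>t. of_real r * shift2pi k (\<lambda>\<xi>. synth a \<xi> - tp x F (nth a) \<xi>) t)"
      by (simp add: shift2pi_def tp_def sum_distrib_left right_diff_distrib mult.assoc fun_eq_iff)
    then show ?thesis
      using amal_L2T(2)[OF amal_synth_diff[OF that, of a], of k] by (simp add: normT_cmult mult_left_mono)
  qed
  have "(?r \<longlongrightarrow> \<bar>r\<bar> * (B * norm (a - a))) (finite_subsets_at_top UNIV)"
    by (intro tendsto_intros fin_tendsto)
  then have "(?r \<longlongrightarrow> 0) (finite_subsets_at_top UNIV)" by simp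
  from tendsto_zero_finite_subsets[OF le normT_nonneg this]
  show "((\<lambda>F. normT (\<lambda>t. shift2pi k ?s t - shift2pi k (tp x F (nth (r *\<^sub>R a))) t)) \<longlongrightarrow> 0) (finite_subsets_at_top UNIV)" .
qed

end

section \<open>Gram systems\<close>

lemma esssupT_leI: "AE t in lborel. t \<in> TT \<longrightarrow> ennreal (cmod (g t)) \<le> M \<Longrightarrow> esssupT g \<le> M"
  unfolding esssupT_def by (rule Inf_lower) simp

text \<open>Makes the indicator of \<open>TT\<close> an admissible weight for the Gram systems,
  whose matrix is then the plain Gram matrix of the exponentials on \<open>TT\<close>.\<close>

lemma wiener_norm_indicator_TT: "wiener_norm (indicator TT) \<le> 1"
proof -
  have "esssupT (shift2pi k (indicator TT)) \<le> indicator {0} k" for k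
  proof (rule esssupT_leI, intro AE_I2 impI)
    fix t assume t: "t \<in> TT"
    have "t + 2 * pi * of_int k \<notin> TT" if "k \<noteq> 0"
    proof
      assume "t + 2 * pi * of_int k \<in> TT"
      then have "\<lfloor>(t + 2 * pi * of_int k + pi) / (2 * pi)\<rfloor> = 0"
        using floor_TT[of "t + 2 * pi * of_int k" 0] by simp
      then show False
        using floor_TT[OF t, of k] that by simp
    qed
    then show "ennreal (cmod (shift2pi k (indicator TT) t)) \<le> indicator {0} k"
      by (auto simp: shift2pi_def split: split_indicator)
  qed
  then have "wiener_norm (indicator TT) \<le> (\<integral>\<^sup>+ k. indicator {0} k \<partial>count_space (UNIV :: int set))"
    unfolding wiener_norm_def by (rule nn_integral_mono)
  then show ?thesis by simp
qed

lemma sum_cnj_mult_le: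
  assumes "finite K"
  shows "cmod (\<Sum>j\<in>K. cnj (a j) * b j) \<le> norm (fin K a) * norm (fin K b)"
proof -
  have "cmod (\<Sum>j\<in>K. cnj (a j) * b j) \<le> (\<Sum>j\<in>K. cmod (a j) * cmod (b j))"
    by (rule sum_norm_le) (simp add: norm_mult)
  also have "\<dots> \<le> norm (fin K a) * norm (fin K b)"
  proof (rule power2_le_imp_le)
    show "(\<Sum>j\<in>K. cmod (a j) * cmod (b j))\<^sup>2 \<le> (norm (fin K a) * norm (fin K b))\<^sup>2"
      unfolding power_mult_distrib norm_fin[OF assms] by (rule Cauchy_Schwarz_ineq_sum)
  qed simp
  finally show ?thesis .
qed

lemma norm_fin_le:
  assumes "finite F"
  shows "norm (fin F (nth a)) \<le> norm a"
  by (rule power2_le_imp_le) (simp_all add: norm_fin[OF assms] sum_le_norm_ell2[OF assms])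

lemma amal_cis: "amal (sqrt (2 * pi)) (\<lambda>\<xi>. cis (s * \<xi>))"
  using amal_bounded[of "\<lambda>\<xi>. cis (s * \<xi>)" 1] by simp

lemma cnj_eq_self_iff_norm: "w = complex_of_real (cmod w) \<Longrightarrow> cnj w = w"
  by (metis complex_cnj_complex_of_real)

context riesz
begin

lemma C_pos: "0 < C"
proof (rule ccontr)
  assume "\<not> 0 < C"
  with C have "norm (fin {0} (\<lambda>_. 1)) \<le> 0"
    using lower[of "{0}" "\<lambda>_. 1"] by simp
  then show False
    using norm_fin[of "{0}" "\<lambda>_. 1"] by simp
qed

text \<open>Duality with the upper Riesz bound: \<open>h\<close> is paired with the exponential sum
  whose coefficients are its own moments.\<close>

lemma norm_coef_le:
  assumes h: "L2T h" and K: "finite K"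
  shows "norm (fin K (\<lambda>k. ipT h (\<lambda>t. cis (x k * t)))) \<le> B * normT h"
proof -
  define g where "g k = ipT h (\<lambda>t. cis (x k * t))" for k
  have "of_real ((norm (fin K g))\<^sup>2) = ipT h (\<lambda>t. cnj (tp x K g t))"
    unfolding ipT_cnj_tp[OF h] norm_fin[OF K] g_def[symmetric]
    by (simp add: complex_norm_square mult.commute del: of_real_power)
  then have "(norm (fin K g))\<^sup>2 = cmod (ipT h (\<lambda>t. cnj (tp x K g t)))"
    by (metis norm_of_real abs_of_nonneg zero_le_power2)
  also have "\<dots> \<le> normT h * normT (tp x K g)"
    using norm_ipT_le[OF h L2T_cnj[OF L2T_tp]] by simp
  also have "\<dots> \<le> normT h * (B * norm (fin K g))"
    by (intro mult_left_mono upper K) auto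
  finally have "norm (fin K g) * norm (fin K g) \<le> (B * normT h) * norm (fin K g)"
    by (simp add: power2_eq_square mult_ac)
  then have "norm (fin K g) \<le> B * normT h"
    using B by (cases "norm (fin K g) = 0") auto
  then show ?thesis by (simp add: g_def[abs_def])
qed

lemma l2_coef:
  assumes "L2T h"
  shows "l2 (\<lambda>k. ipT h (\<lambda>t. cis (x k * t)))"
proof (rule l2_bounded_sums[where C="(B * normT h)\<^sup>2"])
  fix K :: "int set" assume "finite K"
  then show "(\<Sum>j\<in>K. (cmod (ipT h (\<lambda>t. cis (x j * t))))\<^sup>2) \<le> (B * normT h)\<^sup>2"
    using norm_coef_le[OF assms, of K] norm_fin[of K "\<lambda>k. ipT h (\<lambda>t. cis (x k * t))"] power_mono[OF _ norm_ge_zero, of "fin K (\<lambda>k. ipT h (\<lambda>t. cis (x k * t)))" "B * normT h" 2]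
    by simp
qed

text \<open>The form \<open>I\<close> is Hermitian because \<open>w\<close> is real, bounded by the
  amalgam estimate, and coercive because \<open>w\<close> is nonnegative everywhere and at least
  \<delta> on \<open>TT\<close>. Its real part fits the symmetric Lax-Milgram lemma on the real
  space \<open>ell2\<close>.\<close>

lemma Gram_solve:
  fixes \<beta> :: ell2
  assumes w[measurable]: "w \<in> borel_measurable borel" and W: "wiener_norm w \<le> ennreal W" "0 \<le> W"
    and pos: "AE \<xi> in lborel. w \<xi> = of_real (cmod (w \<xi>))"
    and \<delta>: "0 < \<delta>" "AE t in lborel. t \<in> TT \<longrightarrow> \<delta> \<le> cmod (w t)"
  shows "\<exists>a. \<forall>k. (LINT \<xi>|lborel. w \<xi> * (synth a \<xi> * cis (x k * \<xi>))) = nth \<beta> k"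
proof -
  note [measurable] = synth(1)
  define I where "I a b = (LINT \<xi>|lborel. w \<xi> * (synth a \<xi> * cnj (synth b \<xi>)))" for a b
  note amal_ab = integral_amalgam[OF w amal_synth amal_cnj[OF amal_synth] W]
  note int = amal_ab(1)
  have I_bound: "cmod (I a b) \<le> W * (B * norm a * (B * norm b))" for a b
    unfolding I_def by (rule amal_ab(2))
  have I_add: "I (a + b) c = I a c + I b c" for a b c
  proof -
    have "I (a + b) c = (LINT \<xi>|lborel. w \<xi> * (synth a \<xi> * cnj (synth c \<xi>)) + w \<xi> * (synth b \<xi> * cnj (synth c \<xi>)))"
      unfolding I_def by (rule integral_cong_AE, measurable, use synth_add[of a b] in eventually_elim) (simp add: algebra_simps)
    then show ?thesis
      unfolding I_def using int by simp
  qed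
  have I_scaleR: "I (r *\<^sub>R a) c = of_real r * I a c" for r a c
  proof -
    have "I (r *\<^sub>R a) c = (LINT \<xi>|lborel. of_real r * (w \<xi> * (synth a \<xi> * cnj (synth c \<xi>))))"
      unfolding I_def by (rule integral_cong_AE, measurable, use synth_scaleR[of r a] in eventually_elim) (simp add: algebra_simps)
    then show ?thesis
      unfolding I_def by simp
  qed
  have I_sym: "I b a = cnj (I a b)" for a b
  proof -
    have "I b a = (LINT \<xi>|lborel. cnj (w \<xi> * (synth a \<xi> * cnj (synth b \<xi>))))"
      unfolding I_def by (rule integral_cong_AE, measurable, use pos in eventually_elim) (simp add: cnj_eq_self_iff_norm mult.commute)
    then show ?thesis
      unfolding I_def by (simp only: Bochner_Integration.integral_cnj)
  qed
  define Q where "Q a b = Re (I a b)" for a b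
  have sym: "Q a b = Q b a" for a b
    unfolding Q_def using I_sym[of a b] by simp
  have Q_left: "Q (a + b) c = Q a c + Q b c" "Q (r *\<^sub>R a) c = r *\<^sub>R Q a c" for a b c r
    by (simp_all add: Q_def I_add I_scaleR)
  have Q_right: "Q c (a + b) = Q c a + Q c b" "Q c (r *\<^sub>R a) = r *\<^sub>R Q c a" for a b c r
    using Q_left sym by metis+
  have "bounded_bilinear Q"
  proof (unfold_locales)
    show "\<exists>K. \<forall>a b. norm (Q a b) \<le> norm a * norm b * K"
      using order_trans[OF abs_Re_le_cmod I_bound]
      by (intro exI[of _ "W * B * B"]) (simp add: Q_def mult_ac)
  qed (simp_all add: Q_left Q_right)
  \<comment> \<open>The weight gives the factor \<delta> on \<open>TT\<close>, and the lower Riesz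
    bound converts \<open>normT (synth a)\<close> into \<open>norm a / C\<close>.\<close>
  moreover have "\<delta> / C\<^sup>2 * (norm a)\<^sup>2 \<le> Q a a" for a
  proof -
    have "(norm a)\<^sup>2 \<le> (C * normT (synth a))\<^sup>2"
      by (intro power_mono norm_le_synth) auto
    then have "\<delta> / C\<^sup>2 * (norm a)\<^sup>2 \<le> \<delta> / C\<^sup>2 * (C * normT (synth a))\<^sup>2"
      using \<delta>(1) by (intro mult_left_mono) auto
    also have "\<dots> = \<delta> * (normT (synth a))\<^sup>2"
      using C_pos by (simp add: power_mult_distrib)
    also have "\<dots> = (LINT t|lborel. \<delta> * (cmod (indicator TT t * synth a t))\<^sup>2)"
      by (simp add: normT_eq_normR normR_square)
    also have "\<dots> \<le> (LINT \<xi>|lborel. Re (w \<xi> * (synth a \<xi> * cnj (synth a \<xi>))))"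
    proof (rule integral_mono_AE)
      show "integrable lborel (\<lambda>t. \<delta> * (cmod (indicator TT t * synth a t))\<^sup>2)"
        using amal_L2T_0(1)[OF amal_synth[of a]] by (auto simp: L2T_iff_L2R L2R_def)
      show "integrable lborel (\<lambda>\<xi>. Re (w \<xi> * (synth a \<xi> * cnj (synth a \<xi>))))"
        using int by (rule integrable_Re)
      show "AE t in lborel. \<delta> * (cmod (indicator TT t * synth a t))\<^sup>2 \<le> Re (w t * (synth a t * cnj (synth a t)))"
        using pos \<delta>(2)
      proof eventually_elim
        case (elim t)
        have "w t * (synth a t * cnj (synth a t)) = of_real (cmod (w t) * (cmod (synth a t))\<^sup>2)"
          using elim(1) by (metis complex_norm_square of_real_mult)
        then have "Re (w t * (synth a t * cnj (synth a t))) = cmod (w t) * (cmod (synth a t))\<^sup>2"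
          by simp
        then show ?case
          using elim(2) by (auto split: split_indicator intro!: mult_right_mono)
      qed
    qed
    also have "\<dots> = Q a a"
      unfolding Q_def I_def by (rule integral_Re[OF int])
    finally show ?thesis .
  qed
  moreover have "bounded_linear (\<lambda>b. \<beta> \<bullet> b)"
    by (rule bounded_linear_inner_right)
  ultimately obtain a where a: "\<And>b. Q a b = \<beta> \<bullet> b"
    using symmetric_Lax_Milgram[of Q "\<delta> / C\<^sup>2" "\<lambda>b. \<beta> \<bullet> b"] sym \<delta>(1) C_pos by (metis divide_pos_pos zero_less_power)
  have "(LINT \<xi>|lborel. w \<xi> * (synth a \<xi> * cis (x k * \<xi>))) = nth \<beta> k" for k
  proof -
    let ?J = "LINT \<xi>|lborel. w \<xi> * (synth a \<xi> * cis (x k * \<xi>))"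
    have J: "I a (fin {k} (\<lambda>_. z)) = cnj z * ?J" for z
    proof -
      have "I a (fin {k} (\<lambda>_. z)) = (LINT \<xi>|lborel. cnj z * (w \<xi> * (synth a \<xi> * cis (x k * \<xi>))))"
        unfolding I_def
        by (rule integral_cong_AE, measurable, use synth_fin[of "{k}" "\<lambda>_. z", simplified] in eventually_elim)
          (simp add: tp_def cis_cnj mult_ac)
      then show ?thesis by simp
    qed
    \<comment> \<open>Only real parts are tested, so the unit vector yields the real part of the
      equation and \<i> times the unit vector its imaginary part.\<close>
    have "Re ?J = Re (nth \<beta> k)"
      using a[of "fin {k} (\<lambda>_. 1)"] J[of 1] by (simp add: Q_def inner_fin inner_complex_def)
    moreover have "Im ?J = Im (nth \<beta> k)"
      using a[of "fin {k} (\<lambda>_. \<i>)"] J[of \<i>] by (simp add: Q_def inner_fin inner_complex_def)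
    ultimately show ?thesis by (rule complex_eqI)
  qed
  then show ?thesis by blast
qed

text \<open>The Gram system with weight \<open>indicator TT\<close> produces a series with the same
  moments as \<open>h\<close>, and completeness of the exponentials identifies the two.\<close>

lemma expansion:
  assumes h: "L2T h"
  shows "\<exists>a. AE t in lborel. t \<in> TT \<longrightarrow> synth a t = h t"
proof -
  have ind: "indicator TT \<in> borel_measurable (borel :: real measure)" "wiener_norm (indicator TT) \<le> ennreal 1"
    using wiener_norm_indicator_TT by auto
  define \<beta> where "\<beta> = Abs_ell2 (\<lambda>k. ipT h (\<lambda>t. cis (x k * t)))"
  have \<beta>: "nth \<beta> k = ipT h (\<lambda>t. cis (x k * t))" for k
    unfolding \<beta>_def using nth_Abs[OF l2_coef[OF h]] by simp
  obtain a where a: "\<And>k. (LINT \<xi>|lborel. indicator TT \<xi> * (synth a \<xi> * cis (x k * \<xi>))) = nth \<beta> k"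
    using Gram_solve[OF ind, of 1 \<beta>] by (auto split: split_indicator)
  have s: "L2T (synth a)"
    by (rule amal_L2T_0(1)[OF amal_synth])
  have "ipT (\<lambda>t. synth a t - h t) (\<lambda>t. cis (x k * t)) = 0" for k
    using ipT_diff_left[OF s h L2T_cis(1)] a[of k] \<beta>[of k] by (simp add: ipT_def)
  then have "AE t in lborel. t \<in> TT \<longrightarrow> synth a t - h t = 0"
    by (intro complete L2T_diff s h)
  then show ?thesis by (intro exI[of _ a]) simp
qed

text \<open>Expand \<open>G\<close> as a series with coefficients \<open>a\<close>. Then
  \<open>(normT G)\<^sup>2\<close> is the pairing of the moments of \<open>G\<close> with
  \<open>a\<close>, at most \<open>D * norm a\<close>, and \<open>norm a \<le> C * normT G\<close>;
  the proof does this for truncations of \<open>a\<close> and passes to the limit.\<close>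

lemma normT_le_coef:
  assumes G: "L2T G" and D: "0 \<le> D" "\<And>K. finite K \<Longrightarrow> norm (fin K (\<lambda>k. ipT G (\<lambda>t. cis (x k * t)))) \<le> D"
  shows "normT G \<le> C * D"
proof -
  obtain a where a: "AE t in lborel. t \<in> TT \<longrightarrow> synth a t = G t"
    using expansion[OF G] by blast
  have s: "L2T (synth a)"
    by (rule amal_L2T_0(1)[OF amal_synth])
  have eq: "normT (synth a) = normT G"
    by (rule normT_cong_AE[OF s G a])
  have na: "norm a \<le> C * normT G"
    using norm_le_synth[of a] eq by simp
  have "(normT G)\<^sup>2 \<le> C * normT G * D + normT G * (B * norm (a - fin F (nth a)))" if "finite F" for F
  proof -
    let ?d = "\<lambda>t. synth a t - tp x F (nth a) t"
    have d: "L2T ?d" "normT ?d \<le> B * norm (a - fin F (nth a))"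
      using amal_L2T_0[OF amal_synth_diff[OF that, of a]] by auto
    have "of_real ((normT G)\<^sup>2) = ipT G (\<lambda>t. cnj (synth a t))"
    proof -
      have "ipT (\<lambda>t. cnj (G t)) G = ipT (\<lambda>t. cnj (synth a t)) G"
        by (rule ipT_cong_AE) (use G s a in \<open>auto elim!: eventually_mono\<close>)
      then show ?thesis
        using ipT_cnj_self[of G] by (simp add: ipT_commute)
    qed
    also have "\<dots> = ipT G (\<lambda>t. cnj (tp x F (nth a) t)) + ipT G (\<lambda>t. cnj (?d t))"
      using ipT_diff_right[OF L2T_cnj[OF s] L2T_cnj[OF L2T_tp] G, of x F "nth a"] by simp
    finally have "(normT G)\<^sup>2 \<le> cmod (ipT G (\<lambda>t. cnj (tp x F (nth a) t))) + cmod (ipT G (\<lambda>t. cnj (?d t)))"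
      by (metis abs_of_nonneg norm_of_real norm_triangle_ineq zero_le_power2)
    also have "cmod (ipT G (\<lambda>t. cnj (tp x F (nth a) t))) \<le> norm (fin F (nth a)) * D"
      unfolding ipT_cnj_tp[OF G]
      by (rule order_trans[OF sum_cnj_mult_le[OF that]]) (intro mult_left_mono D(2) that, simp)
    also have "\<dots> \<le> C * normT G * D"
      using norm_fin_le[OF that, of a] na D(1) by (intro mult_right_mono) auto
    also have "cmod (ipT G (\<lambda>t. cnj (?d t))) \<le> normT G * (B * norm (a - fin F (nth a)))"
      using norm_ipT_le[OF G L2T_cnj[OF d(1)], unfolded normT_cnj]
      by (rule order_trans) (intro mult_left_mono d(2) normT_nonneg)
    finally show ?thesis by simp
  qed
  moreover have "((\<lambda>F. C * normT G * D + normT G * (B * norm (a - fin F (nth a)))) \<longlongrightarrow> C * normT G * D + normT G * (B * norm (a - a))) (finite_subsets_at_top UNIV)"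
    by (intro tendsto_intros fin_tendsto)
  ultimately have "(normT G)\<^sup>2 \<le> C * normT G * D + normT G * (B * norm (a - a))"
    by (rule le_lim_finite_subsets)
  then have "normT G * normT G \<le> (C * D) * normT G"
    by (simp add: power2_eq_square mult_ac)
  then show ?thesis
    using C D(1) normT_nonneg[of G] by (cases "normT G = 0") auto
qed

end

section \<open>Prolongation\<close>

text \<open>Reduces the filter to sequences, along which dominated convergence is applied: if
  convergence failed, elements of \<open>A\<close> beyond every natural number could be picked at
  which \<open>v\<close> stays away from 0.\<close>

lemma alpha_filter_tendsto_zeroI:
  fixes v :: "real \<Rightarrow> real"
  assumes "\<And>s. (\<And>n. s n \<in> A) \<Longrightarrow> filterlim s (alpha_filter A) sequentially \<Longrightarrow> (\<lambda>n. v (s n)) \<longlonglongrightarrow> 0"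
  shows "(v \<longlongrightarrow> 0) (alpha_filter A)"
proof (rule tendstoI, rule ccontr)
  fix e :: real
  assume "0 < e" and "\<not> (\<forall>\<^sub>F \<alpha> in alpha_filter A. dist (v \<alpha>) 0 < e)"
  then have "\<exists>\<alpha>. \<alpha> \<in> A \<and> real n \<le> \<alpha> \<and> e \<le> dist (v \<alpha>) 0" for n :: nat
    unfolding alpha_filter_def eventually_inf_principal eventually_at_top_linorder by (meson not_less)
  then obtain s where s: "\<And>n. s n \<in> A" "\<And>n. real n \<le> s n" "\<And>n. e \<le> dist (v (s n)) 0"
    by metis
  have "filterlim s at_top sequentially"
    using filterlim_real_sequentially by (rule filterlim_at_top_mono) (simp add: s)
  then have "filterlim s (alpha_filter A) sequentially"
    unfolding alpha_filter_def using s(1) by (simp add: filterlim_inf filterlim_principal)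
  then have "(\<lambda>n. v (s n)) \<longlonglongrightarrow> 0"
    using assms s(1) by blast
  then have "\<forall>\<^sub>F n in sequentially. dist (v (s n)) 0 < e"
    using \<open>0 < e\<close> by (rule tendstoD)
  then show False
    using s(3) by (auto simp: eventually_sequentially not_less[symmetric])
qed

lemma normT_mult_tendsto_zero:
  assumes [measurable]: "\<And>\<alpha>. \<alpha> \<in> A \<Longrightarrow> w \<alpha> \<in> borel_measurable borel"
    and le: "\<And>\<alpha>. \<alpha> \<in> A \<Longrightarrow> AE t in lborel. t \<in> TT \<longrightarrow> cmod (w \<alpha> t) \<le> 1"
    and lim: "AE t in lborel. t \<in> TT \<longrightarrow> ((\<lambda>\<alpha>. w \<alpha> t) \<longlongrightarrow> 0) (alpha_filter A)"
    and g: "L2T g"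
  shows "((\<lambda>\<alpha>. normT (\<lambda>t. w \<alpha> t * g t)) \<longlongrightarrow> 0) (alpha_filter A)"
proof (rule alpha_filter_tendsto_zeroI)
  fix s :: "nat \<Rightarrow> real" assume s: "\<And>n. s n \<in> A" "filterlim s (alpha_filter A) sequentially"
  let ?g = "\<lambda>t. indicator TT t * g t"
  have g': "L2R ?g" using g by (simp add: L2T_iff_L2R)
  note [measurable] = L2R_measurable[OF g'] assms(1)[OF s(1)]
  have eq: "(\<lambda>t. indicator TT t * (w (s n) t * g t)) = (\<lambda>t. w (s n) t * ?g t)" for n
    by (simp add: mult.left_commute)
  have le': "AE t in lborel. \<forall>n. t \<in> TT \<longrightarrow> cmod (w (s n) t) \<le> 1"
    unfolding AE_all_countable using le[OF s(1)] by blast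
  have "(\<lambda>n. LINT t|lborel. (cmod (w (s n) t * ?g t))\<^sup>2) \<longlonglongrightarrow> integral\<^sup>L lborel (\<lambda>t::real. 0::real)"
  proof (rule integral_dominated_convergence[where w="\<lambda>t. (cmod (?g t))\<^sup>2" and f="\<lambda>_. 0" and M=lborel])
    show "AE t in lborel. (\<lambda>n. (cmod (w (s n) t * ?g t))\<^sup>2) \<longlonglongrightarrow> 0"
      using lim
    proof eventually_elim
      case (elim t)
      show ?case
      proof (cases "t \<in> TT")
        case True
        then have "(\<lambda>n. w (s n) t) \<longlonglongrightarrow> 0"
          using elim filterlim_compose[OF _ s(2)] by blast
        then have "(\<lambda>n. (cmod (w (s n) t * ?g t))\<^sup>2) \<longlonglongrightarrow> (cmod (0 * ?g t))\<^sup>2"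
          by (intro tendsto_intros)
        then show ?thesis by simp
      qed simp
    qed
    show "AE t in lborel. norm ((cmod (w (s n) t * ?g t))\<^sup>2) \<le> (cmod (?g t))\<^sup>2" for n
      using le'
    proof eventually_elim
      case (elim t)
      then have "cmod (w (s n) t * ?g t) \<le> cmod (?g t)"
        by (cases "t \<in> TT") (auto simp: norm_mult intro: mult_left_le_one_le)
      then show ?case by (simp add: power_mono)
    qed
  qed (use g' in \<open>auto simp: L2R_def\<close>)
  then have "(\<lambda>n. sqrt (LINT t|lborel. (cmod (w (s n) t * ?g t))\<^sup>2)) \<longlonglongrightarrow> sqrt (integral\<^sup>L lborel (\<lambda>t::real. 0::real))"
    by (rule tendsto_real_sqrt)
  then show "(\<lambda>n. normT (\<lambda>t. w (s n) t * g t)) \<longlonglongrightarrow> 0"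
    unfolding normT_eq_normR eq normR_def by simp
qed

section \<open>Consequences of A2; the operators \<open>Top\<close> and \<open>Mop\<close>\<close>

lemma A2_D:
  assumes "A2 G"
  shows "G \<in> borel_measurable borel" "0 < delta G" "AE t in lborel. t \<in> TT \<longrightarrow> delta G \<le> cmod (G t)"
    "wiener_norm G < \<infinity>" "Cconst G < \<infinity>"
    "(\<integral>\<^sup>+ k. esssupT (shift2pi k G) \<partial>count_space (UNIV - {0})) = Cconst G * ennreal (delta G)"
proof -
  show "G \<in> borel_measurable borel" "wiener_norm G < \<infinity>" "Cconst G < \<infinity>" and "0 < delta G"
    using assms by (auto simp: A2_def inW_def delta_def enn2real_positive_iff)
  have e: "ennreal (delta G) = essinfT G"
    using assms by (simp add: A2_def delta_def)
  show "AE t in lborel. t \<in> TT \<longrightarrow> delta G \<le> cmod (G t)"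
    using essinfT_AE[of G] unfolding e[symmetric] by eventually_elim (simp add: ennreal_le_iff)
  show "(\<integral>\<^sup>+ k. esssupT (shift2pi k G) \<partial>count_space (UNIV - {0})) = Cconst G * ennreal (delta G)"
    unfolding Cconst_def using \<open>0 < delta G\<close> by (simp add: ennreal_divide_times ennreal_mult_divide_eq)
qed

lemma esssupT_le_wiener_norm: "esssupT (shift2pi k G) \<le> wiener_norm G"
proof -
  have "(\<integral>\<^sup>+ i. esssupT (shift2pi i G) * indicator {k} i \<partial>count_space UNIV) \<le> wiener_norm G"
    unfolding wiener_norm_def by (intro nn_integral_mono) (auto split: split_indicator)
  then show ?thesis by simp
qed

lemma normT_Top_le:
  assumes "A2 G" "L2T h"
  shows "L2T (Top G k h)" "ennreal (normT (Top G k h)) \<le> esssupT (shift2pi k G) * ennreal (normT h / delta G)"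
proof -
  note [measurable] = A2_D(1)[OF assms(1)]
  define M where "M = enn2real (esssupT (shift2pi k G))"
  have "esssupT (shift2pi k G) < top"
    using le_less_trans[OF esssupT_le_wiener_norm A2_D(4)[OF assms(1)]] by (simp add: infinity_ennreal_def)
  then have M: "esssupT (shift2pi k G) = ennreal M"
    by (simp add: M_def)
  have M0: "0 \<le> M" by (simp add: M_def)
  have d: "0 < delta G" by (rule A2_D(2)[OF assms(1)])
  have AE: "AE t in lborel. t \<in> TT \<longrightarrow> cmod (Top G k h t) \<le> M / delta G * cmod (h t)"
    using esssupT_AE[of "shift2pi k G"] unfolding M
  proof eventually_elim
    case (elim t)
    show ?case
    proof
      assume "t \<in> TT"
      then have "cmod (G (t + 2 * pi * of_int k)) \<le> M"
        using elim M0 by (simp add: shift2pi_def ennreal_le_iff)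
      then have "cmod (G (t + 2 * pi * of_int k)) * cmod (h t) / delta G \<le> M * cmod (h t) / delta G"
        using d by (intro divide_right_mono mult_right_mono) auto
      then show "cmod (Top G k h t) \<le> M / delta G * cmod (h t)"
        using d by (simp add: Top_def norm_divide norm_mult)
    qed
  qed
  have [measurable]: "(\<lambda>t. indicator TT t * h t) \<in> borel_measurable borel"
    using assms(2) L2R_measurable by (simp add: L2T_iff_L2R)
  have "(\<lambda>t. indicator TT t * Top G k h t) = (\<lambda>t. G (t + 2 * pi * of_int k) * (indicator TT t * h t) / of_real (delta G))"
    by (auto simp: Top_def)
  also have "\<dots> \<in> borel_measurable borel" by measurable
  finally have meas: "(\<lambda>t. indicator TT t * Top G k h t) \<in> borel_measurable borel" .
  show "L2T (Top G k h)"
    by (rule L2T_bound_AE(1)[OF meas assms(2) _ AE]) (use M0 d in simp)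
  have "normT (Top G k h) \<le> M / delta G * normT h"
    by (rule L2T_bound_AE(2)[OF meas assms(2) _ AE]) (use M0 d in simp)
  then show "ennreal (normT (Top G k h)) \<le> esssupT (shift2pi k G) * ennreal (normT h / delta G)"
    unfolding M using M0 d by (simp add: ennreal_mult[symmetric] ennreal_leI)
qed

lemma L2T_Mop:
  assumes "A2 G" "L2T g"
  shows "L2T (Mop G g)"
proof -
  note [measurable] = A2_D(1)[OF assms(1)]
  have [measurable]: "(\<lambda>t. indicator TT t * g t) \<in> borel_measurable borel"
    using assms(2) L2R_measurable by (simp add: L2T_iff_L2R)
  have "(\<lambda>t. indicator TT t * Mop G g t) = (\<lambda>t. of_real (delta G) * (indicator TT t * g t) / G t)"
    by (auto simp: Mop_def)
  also have "\<dots> \<in> borel_measurable borel" by measurable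
  finally have meas: "(\<lambda>t. indicator TT t * Mop G g t) \<in> borel_measurable borel" .
  show ?thesis
  proof (rule L2T_bound_AE(1)[OF meas assms(2), of 1])
    show "AE t in lborel. t \<in> TT \<longrightarrow> cmod (Mop G g t) \<le> 1 * cmod (g t)"
      using A2_D(3)[OF assms(1)]
    proof eventually_elim
      case (elim t)
      then show ?case
        using A2_D(2)[OF assms(1)] mult_right_mono[of "delta G" "cmod (G t)" "cmod (g t)"]
        by (auto simp: Mop_def norm_divide norm_mult divide_le_eq mult.commute)
    qed
  qed simp
qed

lemma series_L2T_iff_tp:
  "series_L2T c (\<lambda>j t. cis (- (x j * (t + 2 * pi * of_int k)))) h \<longleftrightarrow>
    ((\<lambda>F. normT (\<lambda>t. h t - shift2pi k (tp x F c) t)) \<longlongrightarrow> 0) (finite_subsets_at_top UNIV)"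
  by (simp add: series_L2T_def tp_def shift2pi_def)

lemma series_L2T_iff_tp_0:
  "series_L2T c (\<lambda>j t. cis (- (x j * t))) h \<longleftrightarrow>
    ((\<lambda>F. normT (\<lambda>t. h t - tp x F c t)) \<longlongrightarrow> 0) (finite_subsets_at_top UNIV)"
  by (simp add: series_L2T_def tp_def)

context riesz
begin

text \<open>If \<open>synth a\<close> represents \<open>h\<close> on \<open>TT\<close>, its shift by
  \<open>k\<close> blocks satisfies the condition inside \<open>SOME\<close>, so the chosen function
  satisfies it too.\<close>

lemma prolongA_spec:
  assumes h: "L2T h"
  shows "L2T (prolongA x k h)" "\<exists>c. l2 c \<and>
      series_L2T c (\<lambda>j t. cis (- (x j * t))) h \<and>
      series_L2T c (\<lambda>j t. cis (- (x j * (t + 2 * pi * of_int k)))) (prolongA x k h)"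
proof -
  obtain a where a: "AE t in lborel. t \<in> TT \<longrightarrow> synth a t = h t"
    using expansion[OF h] by blast
  have s: "L2T (synth a)"
    by (rule amal_L2T_0(1)[OF amal_synth])
  have "((\<lambda>F. B * norm (a - fin F (nth a))) \<longlongrightarrow> B * norm (a - a)) (finite_subsets_at_top UNIV)"
    by (intro tendsto_intros fin_tendsto)
  then have lim: "((\<lambda>F. B * norm (a - fin F (nth a))) \<longlongrightarrow> 0) (finite_subsets_at_top UNIV)"
    by simp
  have le: "normT (\<lambda>t. shift2pi k (synth a) t - shift2pi k (tp x F (nth a)) t) \<le> B * norm (a - fin F (nth a))" if "finite F" for F
    using synth(3)[OF that] .
  have le0: "normT (\<lambda>t. h t - tp x F (nth a) t) \<le> B * norm (a - fin F (nth a))" if "finite F" for F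
  proof -
    have "normT (\<lambda>t. h t - tp x F (nth a) t) = normT (\<lambda>t. synth a t - tp x F (nth a) t)"
      by (rule normT_cong_AE) (use h s a in \<open>auto elim!: eventually_mono\<close>)
    then show ?thesis
      using amal_L2T_0(2)[OF amal_synth_diff[OF that, of a]] by simp
  qed
  define P where "P G \<longleftrightarrow> L2T G \<and> (\<exists>c. l2 c \<and>
      series_L2T c (\<lambda>j t. cis (- (x j * t))) h \<and>
      series_L2T c (\<lambda>j t. cis (- (x j * (t + 2 * pi * of_int k)))) G)" for G
  have "P (shift2pi k (synth a))"
    unfolding P_def series_L2T_iff_tp series_L2T_iff_tp_0
    using synth(2) l2_nth tendsto_zero_finite_subsets[OF le normT_nonneg lim] tendsto_zero_finite_subsets[OF le0 normT_nonneg lim]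
    by blast
  moreover have "prolongA x k h = (SOME G. P G)"
    by (simp add: prolongA_def P_def)
  ultimately have "P (prolongA x k h)"
    by (simp add: someI[of P])
  then show "L2T (prolongA x k h)" "\<exists>c. l2 c \<and>
      series_L2T c (\<lambda>j t. cis (- (x j * t))) h \<and>
      series_L2T c (\<lambda>j t. cis (- (x j * (t + 2 * pi * of_int k)))) (prolongA x k h)"
    unfolding P_def by blast+
qed

text \<open>\<open>C\<close> passes from \<open>h\<close> on \<open>TT\<close> to the coefficients
  and \<open>B\<close> from the coefficients to block \<open>k\<close>; neither depends on
  \<open>k\<close>. Only the defining condition of the choice enters.\<close>

lemma normT_prolongA_le:
  assumes h: "L2T h"
  shows "normT (prolongA x k h) \<le> B * C * normT h"
proof -
  let ?G = "prolongA x k h"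
  obtain c where c: "((\<lambda>F. normT (\<lambda>t. h t - tp x F c t)) \<longlongrightarrow> 0) (finite_subsets_at_top UNIV)"
    "((\<lambda>F. normT (\<lambda>t. ?G t - shift2pi k (tp x F c) t)) \<longlongrightarrow> 0) (finite_subsets_at_top UNIV)"
    using prolongA_spec(2)[OF h] unfolding series_L2T_iff_tp series_L2T_iff_tp_0 by blast
  have "normT ?G \<le> normT (\<lambda>t. ?G t - shift2pi k (tp x F c) t) + B * (C * (normT (\<lambda>t. h t - tp x F c t) + normT h))" if "finite F" for F
  proof -
    have "normT ?G \<le> normT (\<lambda>t. ?G t - shift2pi k (tp x F c) t) + normT (shift2pi k (tp x F c))"
      by (intro normT_le_add_diff prolongA_spec h amal_L2T(1)[OF amal_tp[OF that]])
    also have "normT (shift2pi k (tp x F c)) \<le> B * norm (fin F c)"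
      by (rule upper_shift[OF that])
    also have "norm (fin F c) \<le> C * normT (tp x F c)"
      by (rule lower[OF that])
    also have "normT (tp x F c) \<le> normT (\<lambda>t. h t - tp x F c t) + normT h"
      unfolding normT_minus_commute[of h] by (intro normT_le_add_diff L2T_tp h)
    finally show ?thesis
      using B C by (simp add: mult_left_mono)
  qed
  moreover have "((\<lambda>F. normT (\<lambda>t. ?G t - shift2pi k (tp x F c) t) + B * (C * (normT (\<lambda>t. h t - tp x F c t) + normT h))) \<longlongrightarrow> 0 + B * (C * (0 + normT h))) (finite_subsets_at_top UNIV)"
    by (intro tendsto_intros c)
  ultimately have "normT ?G \<le> 0 + B * (C * (0 + normT h))"
    by (rule le_lim_finite_subsets)
  then show ?thesis by simp
qed

lemma nn_integral_Top_prolongA_le: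
  assumes G: "A2 G" and h: "L2T h"
  shows "(\<integral>\<^sup>+ k. ennreal (normT (Top G k (prolongA x k h))) \<partial>count_space (UNIV - {0})) \<le> Cconst G * ennreal (B * C * normT h)"
proof -
  have "ennreal (normT (Top G k (prolongA x k h))) \<le> esssupT (shift2pi k G) * ennreal (B * C * normT h / delta G)" for k
    using normT_Top_le(2)[OF G prolongA_spec(1)[OF h, of k], of k] A2_D(2)[OF G] normT_prolongA_le[OF h, of k]
    by (elim order_trans) (intro mult_left_mono ennreal_leI divide_right_mono, auto)
  then have "(\<integral>\<^sup>+ k. ennreal (normT (Top G k (prolongA x k h))) \<partial>count_space (UNIV - {0})) \<le>
     (\<integral>\<^sup>+ k. esssupT (shift2pi k G) * ennreal (B * C * normT h / delta G) \<partial>count_space (UNIV - {0}))"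
    by (intro nn_integral_mono)
  also have "\<dots> = Cconst G * (ennreal (delta G) * ennreal (B * C * normT h / delta G))"
    by (simp add: nn_integral_multc A2_D(6)[OF G] mult.assoc)
  also have "ennreal (delta G) * ennreal (B * C * normT h / delta G) = ennreal (B * C * normT h)"
    using A2_D(2)[OF G] B C by (simp add: ennreal_mult[symmetric])
  finally show ?thesis .
qed

end

text \<open>Each point outside the support has a neighbourhood where \<open>F\<close> vanishes
  almost everywhere; Lindelof's theorem reduces these to countably many.\<close>

lemma AE_zero_outside_ess_supp:
  assumes "ess_supp F \<subseteq> S"
  shows "AE \<xi> in lborel. \<xi> \<notin> S \<longrightarrow> F \<xi> = 0"
proof -
  define \<F> where "\<F> = {U :: real set. open U \<and> (AE t in lborel. t \<in> U \<longrightarrow> F t = 0)}"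
  obtain \<F>' where \<F>': "\<F>' \<subseteq> \<F>" "countable \<F>'" "\<Union>\<F>' = \<Union>\<F>"
    using Lindelof[of \<F>] by (auto simp: \<F>_def)
  have AE: "AE t in lborel. \<forall>U\<in>\<F>'. t \<in> U \<longrightarrow> F t = 0"
    using \<F>'(1) by (subst AE_ball_countable[OF \<F>'(2)]) (auto simp: \<F>_def)
  have cover: "\<xi> \<in> \<Union>\<F>'" if "\<xi> \<notin> S" for \<xi>
  proof -
    have "\<xi> \<notin> ess_supp F"
      using assms that by blast
    then obtain e where "e > 0" "AE t in lborel. t \<in> ball \<xi> e \<longrightarrow> F t = 0"
      unfolding ess_supp_def mem_Collect_eq not_all not_imp not_not by (elim exE conjE)
    then have "ball \<xi> e \<in> \<F>" "\<xi> \<in> ball \<xi> e" by (auto simp: \<F>_def)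
    then show ?thesis unfolding \<F>'(3) by blast
  qed
  from AE show ?thesis
  proof eventually_elim
    case (elim t)
    show ?case
    proof
      assume "t \<notin> S"
      from cover[OF this] obtain U where "U \<in> \<F>'" "t \<in> U" by (rule UnionE)
      with elim show "F t = 0" by blast
    qed
  qed
qed

lemma AE_shift2pi_zero:
  assumes "AE \<xi> in lborel. \<xi> \<notin> {-pi..pi} \<longrightarrow> F \<xi> = 0" "k \<noteq> 0"
  shows "AE t in lborel. t \<in> TT \<longrightarrow> F (t + 2 * pi * of_int k) = 0"
proof -
  \<comment> \<open>For \<open>k = 1\<close> the left end point of \<open>TT\<close> is carried to
    \<open>pi\<close>, which still belongs to the closed band.\<close>
  have "AE t in lborel. t \<noteq> - pi"
    by (rule AE_lborel_singleton)
  then show ?thesis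
    using AE_block[OF assms(1), of k]
  proof eventually_elim
    case (elim t)
    have "t + 2 * pi * of_int k \<notin> {-pi..pi}" if "t \<in> TT"
    proof (cases "1 \<le> k")
      case True
      then have "2 * pi * 1 \<le> 2 * pi * of_int k"
        by (intro mult_left_mono) auto
      moreover have "- pi < t" using that elim(1) by (auto simp: TT_def)
      ultimately have "pi < t + 2 * pi * of_int k" by linarith
      then show ?thesis by simp
    next
      case False
      then have "2 * pi * of_int k \<le> 2 * pi * (- 1)"
        using assms(2) by (intro mult_left_mono) auto
      moreover have "t < pi" using that by (auto simp: TT_def)
      ultimately have "t + 2 * pi * of_int k < - pi" by linarith
      then show ?thesis by simp
    qed
    then show ?case using elim(2) by blast
  qed
qed

lemma normT_AE_zero:
  assumes "AE t in lborel. t \<in> TT \<longrightarrow> g t = 0"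
  shows "normT g = 0"
proof -
  have "AE t in lborel. indicator TT t *\<^sub>R (cmod (g t))\<^sup>2 = 0"
    using assms by eventually_elim (auto split: split_indicator)
  then show ?thesis
    unfolding normT_def set_lebesgue_integral_def by (simp add: integral_eq_zero_AE)
qed

section \<open>The conditions B3 and B4 for a band-limited \<Psi>\<close>

lemma B3_if_band_limited:
  assumes "AE \<xi> in lborel. \<xi> \<notin> {-pi..pi} \<longrightarrow> \<Psi> \<xi> = 0"
  shows "B3 A \<Phi> \<Psi> x"
proof -
  have "normT (Top \<Psi> k h) = 0" if "k \<noteq> 0" for k h
    by (rule normT_AE_zero, use AE_shift2pi_zero[OF assms that] in eventually_elim) (simp add: Top_def)
  then have "(\<integral>\<^sup>+ k. ennreal (normT (Top \<Psi> k (h k))) \<partial>count_space (UNIV - {0})) = 0" for h :: "int \<Rightarrow> real \<Rightarrow> complex"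
    by (subst nn_integral_cong[where v="\<lambda>_. 0"]) auto
  then show ?thesis
    unfolding B3_def by simp
qed

lemma regular_interpolators_D:
  assumes "regular_interpolators A \<phi> \<Phi>" "\<alpha> \<in> A"
  shows "continuous_on UNIV (\<phi> \<alpha>)" "fourier_rel (\<phi> \<alpha>) (\<Phi> \<alpha>)" "A1 (\<phi> \<alpha>)" "A2 (\<Phi> \<alpha>)"
  using assms by (auto simp: regular_interpolators_def B1_def)

lemma regular_interpolators_Cconst:
  assumes "regular_interpolators A \<phi> \<Phi>"
  obtains M where "0 \<le> M" "\<And>\<alpha>. \<alpha> \<in> A \<Longrightarrow> Cconst (\<Phi> \<alpha>) \<le> ennreal M"
proof -
  define K where "K = (SUP \<alpha>\<in>A. Cconst (\<Phi> \<alpha>))"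
  have "K < \<infinity>"
    using assms by (simp add: regular_interpolators_def B2_def K_def)
  then have "Cconst (\<Phi> \<alpha>) \<le> ennreal (enn2real K)" if "\<alpha> \<in> A" for \<alpha>
    using SUP_upper[OF that, of "\<lambda>\<alpha>. Cconst (\<Phi> \<alpha>)"] \<open>K < \<infinity>\<close> by (simp add: K_def)
  then show ?thesis
    by (intro that[of "enn2real K"]) auto
qed

lemma A2_ratio_le_1:
  assumes "A2 G"
  shows "AE t in lborel. t \<in> TT \<longrightarrow> cmod (of_real (delta G) / G t) \<le> 1"
  using A2_D(3)[OF assms] by eventually_elim (use A2_D(2)[OF assms] in \<open>auto simp: norm_divide divide_le_eq_1\<close>)

lemma Mop_tendsto_zero:
  assumes "regular_interpolators A \<phi> \<Phi>" "L2T g"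
  shows "((\<lambda>\<alpha>. normT (Mop (\<Phi> \<alpha>) g)) \<longlongrightarrow> 0) (alpha_filter A)"
proof -
  note D = regular_interpolators_D(4)[OF assms(1)]
  have "((\<lambda>\<alpha>. normT (\<lambda>t. of_real (delta (\<Phi> \<alpha>)) / \<Phi> \<alpha> t * g t)) \<longlongrightarrow> 0) (alpha_filter A)"
  proof (rule normT_mult_tendsto_zero)
    fix \<alpha> assume "\<alpha> \<in> A"
    note [measurable] = A2_D(1)[OF D[OF this]]
    show "(\<lambda>t. of_real (delta (\<Phi> \<alpha>)) / \<Phi> \<alpha> t) \<in> borel_measurable borel" by measurable
    show "AE t in lborel. t \<in> TT \<longrightarrow> cmod (of_real (delta (\<Phi> \<alpha>)) / \<Phi> \<alpha> t) \<le> 1"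
      by (rule A2_ratio_le_1[OF D[OF \<open>\<alpha> \<in> A\<close>]])
  qed (use assms in \<open>auto simp: regular_interpolators_def\<close>)
  then show ?thesis
    by (simp add: Mop_def[abs_def])
qed

lemma B4_if_band_limited:
  assumes "CIS x" "CIS y" and reg: "regular_interpolators A \<phi> \<Phi>" and "A2 \<Psi>"
    and band: "AE \<xi> in lborel. \<xi> \<notin> {-pi..pi} \<longrightarrow> \<Psi> \<xi> = 0"
  shows "B4 A \<Phi> \<Psi> x y"
  unfolding B4_def
proof (intro allI impI)
  fix g assume g: "L2T g"
  obtain C B where "riesz y C B" using CIS_riesz[OF assms(2)] .
  then interpret y: riesz y C B .
  obtain C' B' where "riesz x C' B'" using CIS_riesz[OF assms(1)] .
  then interpret x: riesz x C' B' .
  obtain M where M: "0 \<le> M" "\<And>\<alpha>. \<alpha> \<in> A \<Longrightarrow> Cconst (\<Phi> \<alpha>) \<le> ennreal M"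
    using regular_interpolators_Cconst[OF reg] by blast
  let ?h = "\<lambda>\<alpha>. Mop (\<Phi> \<alpha>) g"
  let ?S = "\<lambda>\<alpha>. \<integral>\<^sup>+ k. ennreal (normT (\<lambda>t. Top (\<Phi> \<alpha>) k (prolongA y k (?h \<alpha>)) t - Top \<Psi> k (prolongA x k (?h \<alpha>)) t)) \<partial>count_space (UNIV - {0})"
  have "?S \<alpha> \<le> ennreal (M * (B * C * normT (?h \<alpha>)))" if "\<alpha> \<in> A" for \<alpha>
  proof -
    note A2 = regular_interpolators_D(4)[OF reg that]
    have h: "L2T (?h \<alpha>)" by (rule L2T_Mop[OF A2 g])
    have eq: "normT (\<lambda>t. Top (\<Phi> \<alpha>) k (prolongA y k (?h \<alpha>)) t - Top \<Psi> k (prolongA x k (?h \<alpha>)) t) = normT (Top (\<Phi> \<alpha>) k (prolongA y k (?h \<alpha>)))" if "k \<noteq> 0" for k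
    proof (rule normT_cong_AE)
      show "L2T (Top (\<Phi> \<alpha>) k (prolongA y k (?h \<alpha>)))"
        by (intro normT_Top_le(1) A2 y.prolongA_spec(1) h)
      then show "L2T (\<lambda>t. Top (\<Phi> \<alpha>) k (prolongA y k (?h \<alpha>)) t - Top \<Psi> k (prolongA x k (?h \<alpha>)) t)"
        by (rule L2T_diff) (intro normT_Top_le(1) assms(4) x.prolongA_spec(1) h)
      show "AE t in lborel. t \<in> TT \<longrightarrow> Top (\<Phi> \<alpha>) k (prolongA y k (?h \<alpha>)) t - Top \<Psi> k (prolongA x k (?h \<alpha>)) t = Top (\<Phi> \<alpha>) k (prolongA y k (?h \<alpha>)) t"
        using AE_shift2pi_zero[OF band that] by eventually_elim (simp add: Top_def)
    qed
    have "?S \<alpha> = (\<integral>\<^sup>+ k. ennreal (normT (Top (\<Phi> \<alpha>) k (prolongA y k (?h \<alpha>)))) \<partial>count_space (UNIV - {0}))"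
      by (rule nn_integral_cong) (simp add: eq)
    also have "\<dots> \<le> Cconst (\<Phi> \<alpha>) * ennreal (B * C * normT (?h \<alpha>))"
      by (rule y.nn_integral_Top_prolongA_le[OF A2 h])
    also have "\<dots> \<le> ennreal M * ennreal (B * C * normT (?h \<alpha>))"
      by (intro mult_right_mono M(2) that) simp
    also have "\<dots> = ennreal (M * (B * C * normT (?h \<alpha>)))"
      using M(1) y.B y.C by (simp add: ennreal_mult)
    finally show ?thesis .
  qed
  then have le: "\<forall>\<^sub>F \<alpha> in alpha_filter A. ?S \<alpha> \<le> ennreal (M * (B * C * normT (?h \<alpha>)))"
    by (auto simp: alpha_filter_def eventually_inf_principal)
  have "((\<lambda>\<alpha>. M * (B * C * normT (?h \<alpha>))) \<longlongrightarrow> M * (B * C * 0)) (alpha_filter A)"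
    by (intro tendsto_intros Mop_tendsto_zero[OF reg g])
  then have "((\<lambda>\<alpha>. ennreal (M * (B * C * normT (?h \<alpha>)))) \<longlongrightarrow> 0) (alpha_filter A)"
    using tendsto_ennrealI by fastforce
  from tendsto_sandwich[OF _ le tendsto_const this]
  show "(?S \<longlongrightarrow> 0) (alpha_filter A)" by simp
qed

section \<open>Transforms of interpolants\<close>

text \<open>A factor \<open>cis (- (x j * \<xi>))\<close> on the frequency side is a translation by
  \<open>x j\<close>, so combinations of translates correspond to products with exponential
  sums.\<close>

lemma ift_mult_tp:
  assumes "integrable lborel G"
  shows "ift (\<lambda>\<xi>. G \<xi> * tp x F c \<xi>) t = (\<Sum>j\<in>F. c j * ift G (t - x j))"
proof -
  have "ift (\<lambda>\<xi>. G \<xi> * tp x F c \<xi>) t = ift (\<lambda>\<xi>. \<Sum>j\<in>F. c j * (cis (- x j * \<xi>) * G \<xi>)) t"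
    by (simp add: tp_def sum_distrib_left mult_ac)
  also have "\<dots> = (\<Sum>j\<in>F. ift (\<lambda>\<xi>. c j * (cis (- x j * \<xi>) * G \<xi>)) t)"
  proof (rule ift_sum)
    fix j
    have "integrable lborel (\<lambda>\<xi>. G \<xi> * cis (- x j * \<xi>))"
      using assms by (rule integrable_mult_bounded[where C=1]) auto
    then show "integrable lborel (\<lambda>\<xi>. c j * (cis (- x j * \<xi>) * G \<xi>))"
      by (simp add: mult.commute)
  qed
  finally show ?thesis
    by (simp only: ift_cmult ift_cis diff_conv_add_uminus)
qed

lemma amal_one: "amal (sqrt (2 * pi)) (\<lambda>_. 1)"
  using amal_bounded[of "\<lambda>_. 1" 1] by simp

lemma amalgam_integrable:
  assumes w: "w \<in> borel_measurable borel" and u: "amal U u" and W: "wiener_norm w \<le> ennreal W" "0 \<le> W"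
  shows "integrable lborel (\<lambda>\<xi>. w \<xi> * u \<xi>)" "(LINT \<xi>|lborel. cmod (w \<xi> * u \<xi>)) \<le> W * (U * sqrt (2 * pi))"
proof -
  show int: "integrable lborel (\<lambda>\<xi>. w \<xi> * u \<xi>)"
    using integral_amalgam(1)[OF w u amal_one W] by simp
  have "ennreal (LINT \<xi>|lborel. cmod (w \<xi> * u \<xi>)) = (\<integral>\<^sup>+ \<xi>. ennreal (cmod (w \<xi> * u \<xi>)) \<partial>lborel)"
    using int by (intro nn_integral_eq_integral[symmetric] integrable_norm) auto
  also have "\<dots> \<le> ennreal (W * (U * sqrt (2 * pi)))"
    using nn_integral_amalgam_UNIV[OF w u amal_one W] by simp
  finally show "(LINT \<xi>|lborel. cmod (w \<xi> * u \<xi>)) \<le> W * (U * sqrt (2 * pi))"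
    using W(2) amal_nonneg[OF u] by (simp add: ennreal_le_iff)
qed

lemma amalgam_AE_bounded:
  assumes "wiener_norm w \<le> ennreal W" "0 \<le> W"
  shows "AE \<xi> in lborel. cmod (w \<xi>) \<le> W"
proof (rule AE_blocks)
  fix k
  have "esssupT (shift2pi k w) \<le> ennreal W"
    using esssupT_le_wiener_norm assms(1) by (rule order_trans)
  then show "AE t in lborel. t \<in> TT \<longrightarrow> cmod (w (t + 2 * pi * of_int k)) \<le> W"
    using esssupT_AE[of "shift2pi k w"] assms(2)
    by (auto simp: shift2pi_def ennreal_le_iff elim!: eventually_mono dest: order_trans)
qed

text \<open>In the square of \<open>w * u\<close> one factor of modulus \<open>w\<close> is replaced
  by its supremum, at most \<open>W\<close>, and the other goes into the amalgam estimate.\<close>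

lemma amalgam_L2R:
  assumes w: "w \<in> borel_measurable borel" and u: "amal U u" and W: "wiener_norm w \<le> ennreal W" "0 \<le> W"
  shows "L2R (\<lambda>\<xi>. w \<xi> * u \<xi>)" "normR (\<lambda>\<xi>. w \<xi> * u \<xi>) \<le> W * U"
proof -
  note [measurable] = w amal_measurable[OF u]
  have "(\<integral>\<^sup>+ \<xi>. ennreal ((cmod (w \<xi> * u \<xi>))\<^sup>2) \<partial>lborel) \<le> (\<integral>\<^sup>+ \<xi>. ennreal W * ennreal (cmod (w \<xi> * (u \<xi> * u \<xi>))) \<partial>lborel)"
  proof (rule nn_integral_mono_AE, use amalgam_AE_bounded[OF W] in eventually_elim)
    case (elim \<xi>)
    have "(cmod (w \<xi> * u \<xi>))\<^sup>2 = cmod (w \<xi>) * cmod (w \<xi> * (u \<xi> * u \<xi>))"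
      by (simp add: norm_mult power2_eq_square mult_ac)
    also have "\<dots> \<le> W * cmod (w \<xi> * (u \<xi> * u \<xi>))"
      using elim by (intro mult_right_mono) auto
    finally show ?case
      using W(2) by (simp add: ennreal_mult[symmetric] ennreal_leI)
  qed
  also have "\<dots> = ennreal W * (\<integral>\<^sup>+ \<xi>. ennreal (cmod (w \<xi> * (u \<xi> * u \<xi>))) \<partial>lborel)"
    by (rule nn_integral_cmult) measurable
  also have "\<dots> \<le> ennreal W * ennreal (W * (U * U))"
    by (intro mult_left_mono nn_integral_amalgam_UNIV[OF w u u W]) simp
  also have "\<dots> = ennreal ((W * U)\<^sup>2)"
    using W(2) amal_nonneg[OF u] by (simp add: ennreal_mult[symmetric] power2_eq_square mult_ac)
  finally have *: "(\<integral>\<^sup>+ \<xi>. ennreal ((cmod (w \<xi> * u \<xi>))\<^sup>2) \<partial>lborel) \<le> ennreal ((W * U)\<^sup>2)" .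
  show "L2R (\<lambda>\<xi>. w \<xi> * u \<xi>)" "normR (\<lambda>\<xi>. w \<xi> * u \<xi>) \<le> W * U"
    using L2R_leI[OF _ _ *] W(2) amal_nonneg[OF u] by auto
qed

text \<open>\<open>Cconst\<close> measures the blocks other than \<open>TT\<close> in units of
  \<open>delta\<close>. The factor \<open>delta\<close> gained here is the one that later multiplies
  \<open>norm a\<close>.\<close>

lemma wiener_norm_outside:
  assumes "A2 G"
  shows "wiener_norm (\<lambda>\<xi>. (1 - indicator TT \<xi>) * G \<xi>) \<le> ennreal (enn2real (Cconst G) * delta G)"
proof -
  let ?G = "\<lambda>\<xi>. (1 - indicator TT \<xi>) * G \<xi>"
  have "esssupT (shift2pi k ?G) \<le> esssupT (shift2pi k G) * indicator (UNIV - {0}) k" for k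
  proof (cases "k = 0")
    case True
    have "esssupT (shift2pi 0 ?G) \<le> 0"
      by (rule esssupT_leI) (auto simp: shift2pi_def)
    then show ?thesis using True by simp
  next
    case False
    have "esssupT (shift2pi k ?G) \<le> esssupT (shift2pi k G)"
    proof (rule esssupT_leI, use esssupT_AE[of "shift2pi k G"] in eventually_elim)
      case (elim t)
      have "cmod (shift2pi k ?G t) \<le> cmod (shift2pi k G t)"
        by (auto simp: shift2pi_def split: split_indicator)
      then show ?case
        using elim by (auto intro: order_trans[OF ennreal_leI])
    qed
    then show ?thesis using False by simp
  qed
  then have "wiener_norm ?G \<le> (\<integral>\<^sup>+ k. esssupT (shift2pi k G) * indicator (UNIV - {0}) k \<partial>count_space UNIV)"
    unfolding wiener_norm_def by (rule nn_integral_mono)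
  also have "\<dots> = (\<integral>\<^sup>+ k. esssupT (shift2pi k G) \<partial>count_space (UNIV - {0}))"
    by (rule nn_integral_count_space_indicator[symmetric]) simp
  also have "\<dots> = ennreal (enn2real (Cconst G) * delta G)"
    using A2_D(2,5)[OF assms] unfolding A2_D(6)[OF assms]
    by (simp add: ennreal_mult infinity_ennreal_def)
  finally show ?thesis .
qed

locale interpolator = riesz y C B for y :: "int \<Rightarrow> real" and C B :: real +
  fixes \<phi> \<Phi> :: "real \<Rightarrow> complex"
  assumes phi_cont: "continuous_on UNIV \<phi>" and phi_ft: "fourier_rel \<phi> \<Phi>"
    and phi_A1: "A1 \<phi>" and Phi_A2: "A2 \<Phi>"
begin

definition W :: real where "W = enn2real (wiener_norm \<Phi>)"

lemma W: "wiener_norm \<Phi> \<le> ennreal W" "0 \<le> W"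
  using A2_D(4)[OF Phi_A2] by (auto simp: W_def infinity_ennreal_def)

lemma Phi_meas [measurable]: "\<Phi> \<in> borel_measurable borel"
  by (rule A2_D(1)[OF Phi_A2])

lemmas Phi_amalgam = amalgam_integrable[OF Phi_meas _ W] amalgam_L2R[OF Phi_meas _ W]

lemma Phi_integrable: "integrable lborel \<Phi>"
  using Phi_amalgam(1)[OF amal_one] by simp

lemma phi_eq_ift: "\<phi> = ift \<Phi>"
  by (rule fourier_inversion[OF phi_ft Phi_integrable phi_cont])

lemma Phi_nonneg: "AE \<xi> in lborel. \<Phi> \<xi> = of_real (cmod (\<Phi> \<xi>))"
  using AE_nonneg_if_posdef_ift[OF Phi_integrable] phi_A1 by (simp add: A1_def phi_eq_ift)

lemma translates_eq_ift:
  "(\<Sum>j\<in>F. c j * \<phi> (t - y j)) = ift (\<lambda>\<xi>. \<Phi> \<xi> * tp y F c \<xi>) t"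
  by (simp add: ift_mult_tp[OF Phi_integrable] phi_eq_ift)

text \<open>Translates the series condition of \<open>interp\<close> into the form of the Fourier
  transform. From right to left Bessel's inequality bounds the error of the partial sums; conversely
  some transform of \<open>s\<close> exists, is identified with the product almost everywhere, and
  inversion returns to \<open>s\<close>.\<close>

lemma translate_series_iff:
  assumes s: "continuous_on UNIV s" "L2R s"
  shows "((\<lambda>F. normR (\<lambda>t. s t - (\<Sum>j\<in>F. nth a j * \<phi> (t - y j)))) \<longlongrightarrow> 0) (finite_subsets_at_top UNIV)
    \<longleftrightarrow> s = ift (\<lambda>\<xi>. \<Phi> \<xi> * synth a \<xi>)" (is "?lim \<longleftrightarrow> _")
proof
  let ?H = "\<lambda>\<xi>. \<Phi> \<xi> * synth a \<xi>" and ?P = "\<lambda>F \<xi>. \<Phi> \<xi> * tp y F (nth a) \<xi>"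
  note [measurable] = synth(1)
  note H = Phi_amalgam(1,3)[OF amal_synth[of a]]
  have P: "integrable lborel (?P F)" "L2R (?P F)" if "finite F" for F
    using Phi_amalgam(1,3)[OF amal_tp[OF that, of "nth a"]] by auto
  have HP: "normR (\<lambda>\<xi>. ?H \<xi> - ?P F \<xi>) \<le> W * (B * norm (a - fin F (nth a)))" if "finite F" for F
    using Phi_amalgam(4)[OF amal_synth_diff[OF that, of a]] by (simp add: right_diff_distrib)
  have "((\<lambda>F. W * (B * norm (a - fin F (nth a)))) \<longlongrightarrow> W * (B * norm (a - a))) (finite_subsets_at_top UNIV)"
    by (intro tendsto_intros fin_tendsto)
  then have lim0: "((\<lambda>F. W * (B * norm (a - fin F (nth a)))) \<longlongrightarrow> 0) (finite_subsets_at_top UNIV)"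
    by simp
  {
    assume "s = ift ?H"
    then have "normR (\<lambda>t. s t - (\<Sum>j\<in>F. nth a j * \<phi> (t - y j))) \<le> W * (B * norm (a - fin F (nth a)))" if "finite F" for F
      using normR_ift_le[OF Bochner_Integration.integrable_diff[OF H(1) P(1)[OF that]] L2R_diff[OF H(2) P(2)[OF that]]] HP[OF that]
      by (simp add: translates_eq_ift ift_diff[OF H(1) P(1)[OF that], abs_def])
    from tendsto_zero_finite_subsets[OF this normR_nonneg lim0]
    show ?lim .
  }
  {
    assume lim: ?lim
    obtain S where S: "fourier_rel s S"
      using fourier_rel_exists[OF s(2)] .
    note SL = fourier_rel_L2R(2)[OF S]
    have "normR (\<lambda>\<xi>. S \<xi> - ?H \<xi>) \<le> normR (\<lambda>t. s t - (\<Sum>j\<in>F. nth a j * \<phi> (t - y j))) + W * (B * norm (a - fin F (nth a)))" if "finite F" for F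
    proof -
      have "normR (\<lambda>\<xi>. S \<xi> - ?H \<xi>) \<le> normR (\<lambda>\<xi>. S \<xi> - ?P F \<xi>) + normR (\<lambda>\<xi>. ?P F \<xi> - ?H \<xi>)"
        by (intro normR_triangle_via L2R_diff SL H P that)
      also have "normR (\<lambda>\<xi>. S \<xi> - ?P F \<xi>) \<le> normR (\<lambda>t. s t - ift (?P F) t)"
        by (intro fourier_rel_normR_le fourier_rel_diff S fourier_rel_ift P that)
      finally show ?thesis
        using HP[OF that] by (simp add: translates_eq_ift normR_minus_commute[of "?P F"])
    qed
    moreover have "((\<lambda>F. normR (\<lambda>t. s t - (\<Sum>j\<in>F. nth a j * \<phi> (t - y j))) + W * (B * norm (a - fin F (nth a)))) \<longlongrightarrow> 0 + 0) (finite_subsets_at_top UNIV)"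
      by (intro tendsto_add lim lim0)
    ultimately have "normR (\<lambda>\<xi>. S \<xi> - ?H \<xi>) \<le> 0 + 0"
      by (rule le_lim_finite_subsets)
    then have "normR (\<lambda>\<xi>. S \<xi> - ?H \<xi>) = 0"
      using normR_nonneg[of "\<lambda>\<xi>. S \<xi> - ?H \<xi>"] by linarith
    from normR_eq_0_AE[OF L2R_diff[OF SL H(2)] this]
    have "AE \<xi> in lborel. ?H \<xi> = S \<xi>"
      by eventually_elim simp
    then have "fourier_rel s ?H"
      by (intro fourier_rel_cong_AE[OF S]) auto
    then show "s = ift ?H"
      by (rule fourier_inversion[OF _ H(1) s(1)])
  }
qed

text \<open>\<open>Gram_solve\<close> provides a function with the defining property, so
  \<open>interp\<close> has it. The coefficients are then read off from the chosen function itself,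
  and evaluation at the nodes turns interpolation into moment equations.\<close>

lemma interp_eq_ift:
  assumes F: "L2T F"
  obtains a where "interp \<phi> y (band F) = ift (\<lambda>\<xi>. \<Phi> \<xi> * synth a \<xi>)"
    "\<And>k. (LINT \<xi>|lborel. \<Phi> \<xi> * (synth a \<xi> * cis (y k * \<xi>))) = ipT F (\<lambda>t. cis (y k * t))"
proof -
  define P where "P s \<longleftrightarrow> continuous_on UNIV s \<and> L2R s \<and>
     (\<exists>a. l2 a \<and> ((\<lambda>F. normR (\<lambda>t. s t - (\<Sum>j\<in>F. a j * \<phi> (t - y j)))) \<longlongrightarrow> 0)
                     (finite_subsets_at_top UNIV)) \<and>
     (\<forall>k. s (y k) = band F (y k))" for s
  have at: "ift (\<lambda>\<xi>. \<Phi> \<xi> * synth a \<xi>) (y k) = of_real (1 / sqrt (2 * pi)) * (LINT \<xi>|lborel. \<Phi> \<xi> * (synth a \<xi> * cis (y k * \<xi>)))" for a k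
    by (simp add: ift_def mult.assoc mult.commute[of _ "y k"])
  define \<beta> where "\<beta> = Abs_ell2 (\<lambda>k. ipT F (\<lambda>t. cis (y k * t)))"
  have \<beta>: "nth \<beta> k = ipT F (\<lambda>t. cis (y k * t))" for k
    unfolding \<beta>_def using nth_Abs[OF l2_coef[OF F]] by simp
  obtain a where a: "\<And>k. (LINT \<xi>|lborel. \<Phi> \<xi> * (synth a \<xi> * cis (y k * \<xi>))) = nth \<beta> k"
    using Gram_solve[OF Phi_meas W Phi_nonneg A2_D(2,3)[OF Phi_A2], of \<beta>] by blast
  let ?s = "ift (\<lambda>\<xi>. \<Phi> \<xi> * synth a \<xi>)"
  note H = Phi_amalgam(1,3)[OF amal_synth[of a]]
  have s: "continuous_on UNIV ?s" "L2R ?s"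
    by (rule ift_continuous[OF H(1)], rule L2R_ift[OF H])
  have "P ?s"
    unfolding P_def using s translate_series_iff[OF s, of a] a \<beta> at
    by (intro conjI exI[of _ "nth a"] allI) (auto simp: band_eq_ipT)
  moreover have "interp \<phi> y (band F) = (SOME s. P s)"
    by (simp add: interp_def P_def)
  ultimately have "P (interp \<phi> y (band F))"
    by (simp add: someI[of P])
  note P = this[unfolded P_def]
  note P12 = P[THEN conjunct1] P[THEN conjunct2, THEN conjunct1]
  obtain c where "l2 c"
    "((\<lambda>K. normR (\<lambda>t. interp \<phi> y (band F) t - (\<Sum>j\<in>K. c j * \<phi> (t - y j)))) \<longlongrightarrow> 0) (finite_subsets_at_top UNIV)"
    using P[THEN conjunct2, THEN conjunct2, THEN conjunct1] by (elim exE conjE)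
  then have eq: "interp \<phi> y (band F) = ift (\<lambda>\<xi>. \<Phi> \<xi> * synth (Abs_ell2 c) \<xi>)"
    using translate_series_iff[OF P12, of "Abs_ell2 c"] by (simp add: nth_Abs)
  moreover have "(LINT \<xi>|lborel. \<Phi> \<xi> * (synth (Abs_ell2 c) \<xi> * cis (y k * \<xi>))) = ipT F (\<lambda>t. cis (y k * t))" for k
  proof -
    have "interp \<phi> y (band F) (y k) = band F (y k)"
      using P[THEN conjunct2, THEN conjunct2, THEN conjunct2] by (rule spec)
    then show ?thesis
      unfolding eq at band_eq_ipT by simp
  qed
  ultimately show ?thesis using that by blast
qed

end

section \<open>Convergence of interpolants\<close>

lemma L2R_imp_L2T: "L2R f \<Longrightarrow> L2T f"
  unfolding L2T_iff_L2R by (rule L2R_mult_bounded(1)[where C=1]) (auto split: split_indicator)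

lemma integral_norm_le_normT:
  assumes "L2T f"
  shows "(LINT t|lborel. cmod (indicator TT t * f t)) \<le> normT f * sqrt (2 * pi)"
proof -
  have "L2T (\<lambda>_. 1)" "normT (\<lambda>_. 1) \<le> 1 * sqrt (2 * pi)"
    using L2T_bounded[of "\<lambda>_. 1" 1] by auto
  have "(LINT t|lborel. cmod (indicator TT t * f t)) = (LINT t|lborel. cmod (indicator TT t * f t) * cmod (indicator TT t * 1))"
    by (intro Bochner_Integration.integral_cong) (auto split: split_indicator)
  also have "\<dots> \<le> normT f * normT (\<lambda>_. 1)"
    using L2R_Cauchy_Schwarz_norm[of "\<lambda>t. indicator TT t * f t" "\<lambda>t. indicator TT t * 1"] assms \<open>L2T (\<lambda>_. 1)\<close>
    unfolding L2T_iff_L2R normT_eq_normR by blast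
  also have "\<dots> \<le> normT f * (1 * sqrt (2 * pi))"
    by (intro mult_left_mono) (fact, simp)
  finally show ?thesis by simp
qed

context interpolator
begin

text \<open>The moment equations are combined with the conjugates of the coefficients. For truncated
  coefficients this is a finite sum; the remainder is controlled on the left by the amalgam estimate
  and on the right by Cauchy-Schwarz.\<close>

lemma energy_identity:
  assumes F: "L2T F"
    and a: "\<And>k. (LINT \<xi>|lborel. \<Phi> \<xi> * (synth a \<xi> * cis (y k * \<xi>))) = ipT F (\<lambda>t. cis (y k * t))"
  shows "(LINT \<xi>|lborel. \<Phi> \<xi> * (synth a \<xi> * cnj (synth a \<xi>))) = ipT F (\<lambda>t. cnj (synth a t))"
proof -
  let ?g = "synth a"
  let ?J = "(LINT \<xi>|lborel. \<Phi> \<xi> * (?g \<xi> * cnj (?g \<xi>))) - ipT F (\<lambda>t. cnj (?g t))"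
  have g: "L2T ?g" by (rule amal_L2T_0(1)[OF amal_synth])
  have "cmod ?J \<le> W * (B * norm a * (B * norm (a - fin K (nth a)))) + normT F * (B * norm (a - fin K (nth a)))" if K: "finite K" for K
  proof -
    let ?p = "tp y K (nth a)" and ?d = "\<lambda>\<xi>. ?g \<xi> - tp y K (nth a) \<xi>"
    have d: "L2T ?d" "normT ?d \<le> B * norm (a - fin K (nth a))"
      using amal_L2T_0[OF amal_synth_diff[OF K, of a]] by auto
    have "(LINT \<xi>|lborel. \<Phi> \<xi> * (?g \<xi> * cnj (?p \<xi>))) = (LINT \<xi>|lborel. (\<Sum>j\<in>K. cnj (nth a j) * (\<Phi> \<xi> * (?g \<xi> * cis (y j * \<xi>)))))"
      by (simp add: cnj_tp sum_distrib_left mult_ac)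
    also have "\<dots> = (\<Sum>j\<in>K. cnj (nth a j) * ipT F (\<lambda>t. cis (y j * t)))"
      using integral_amalgam(1)[OF Phi_meas amal_synth amal_cis W] by (simp add: a)
    also have "\<dots> = ipT F (\<lambda>t. cnj (?p t))"
      by (rule ipT_cnj_tp[OF F, symmetric])
    finally have p: "(LINT \<xi>|lborel. \<Phi> \<xi> * (?g \<xi> * cnj (?p \<xi>))) = ipT F (\<lambda>t. cnj (?p t))" .
    have "(LINT \<xi>|lborel. \<Phi> \<xi> * (?g \<xi> * cnj (?d \<xi>))) =
        (LINT \<xi>|lborel. \<Phi> \<xi> * (?g \<xi> * cnj (?g \<xi>))) - (LINT \<xi>|lborel. \<Phi> \<xi> * (?g \<xi> * cnj (?p \<xi>)))"
      using integral_amalgam(1)[OF Phi_meas amal_synth amal_cnj[OF amal_synth] W, of a a]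
        integral_amalgam(1)[OF Phi_meas amal_synth amal_cnj[OF amal_tp[OF K]] W, of a "nth a"]
      by (simp add: right_diff_distrib)
    moreover have "ipT F (\<lambda>t. cnj (?d t)) = ipT F (\<lambda>t. cnj (?g t)) - ipT F (\<lambda>t. cnj (?p t))"
      using ipT_diff_right[OF L2T_cnj[OF g] L2T_cnj[OF L2T_tp] F, of y K "nth a"] by simp
    ultimately have "cmod ?J = cmod ((LINT \<xi>|lborel. \<Phi> \<xi> * (?g \<xi> * cnj (?d \<xi>))) - ipT F (\<lambda>t. cnj (?d t)))"
      unfolding p by simp
    also have "\<dots> \<le> cmod (LINT \<xi>|lborel. \<Phi> \<xi> * (?g \<xi> * cnj (?d \<xi>))) + cmod (ipT F (\<lambda>t. cnj (?d t)))"
      by (rule norm_triangle_ineq4)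
    also have "\<dots> \<le> W * (B * norm a * (B * norm (a - fin K (nth a)))) + normT F * (B * norm (a - fin K (nth a)))"
    proof (rule add_mono)
      show "cmod (LINT \<xi>|lborel. \<Phi> \<xi> * (?g \<xi> * cnj (?d \<xi>))) \<le> W * (B * norm a * (B * norm (a - fin K (nth a))))"
        by (rule integral_amalgam(2)[OF Phi_meas amal_synth amal_cnj[OF amal_synth_diff[OF K]] W])
      show "cmod (ipT F (\<lambda>t. cnj (?d t))) \<le> normT F * (B * norm (a - fin K (nth a)))"
        using norm_ipT_le[OF F L2T_cnj[OF d(1)], unfolded normT_cnj]
        by (rule order_trans) (intro mult_left_mono d(2) normT_nonneg)
    qed
    finally show ?thesis .
  qed
  moreover have "((\<lambda>K. W * (B * norm a * (B * norm (a - fin K (nth a)))) + normT F * (B * norm (a - fin K (nth a))))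
      \<longlongrightarrow> W * (B * norm a * (B * norm (a - a))) + normT F * (B * norm (a - a))) (finite_subsets_at_top UNIV)"
    by (intro tendsto_intros fin_tendsto)
  ultimately have "cmod ?J \<le> W * (B * norm a * (B * norm (a - a))) + normT F * (B * norm (a - a))"
    by (rule le_lim_finite_subsets)
  then show ?thesis by simp
qed

text \<open>With \<open>v = sqrt \<Phi> * g\<close> and \<open>u = F / sqrt \<Phi>\<close> on \<open>TT\<close>, the energy identity bounds
  \<open>(normT v)\<^sup>2\<close> by the pairing of \<open>u\<close> with \<open>v\<close>, hence \<open>normT v \<le> normT u\<close>.\<close>

lemma coefficient_bound:
  assumes F: "L2T F"
    and a: "\<And>k. (LINT \<xi>|lborel. \<Phi> \<xi> * (synth a \<xi> * cis (y k * \<xi>))) = ipT F (\<lambda>t. cis (y k * t))"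
  shows "delta \<Phi> * norm a \<le> C * normT (\<lambda>t. of_real (sqrt (cmod (of_real (delta \<Phi>) / \<Phi> t))) * F t)"
proof -
  let ?g = "synth a" and ?\<delta> = "delta \<Phi>"
  note [measurable] = synth(1)
  have \<delta>: "0 < ?\<delta>" "AE t in lborel. t \<in> TT \<longrightarrow> ?\<delta> \<le> cmod (\<Phi> t)"
    using A2_D[OF Phi_A2] by auto
  have g: "L2T ?g" by (rule amal_L2T_0(1)[OF amal_synth])
  have [measurable]: "(\<lambda>t. indicator TT t * F t) \<in> borel_measurable borel"
    using F L2R_measurable by (simp add: L2T_iff_L2R)
  define r where "r t = sqrt (cmod (\<Phi> t))" for t
  have [measurable]: "r \<in> borel_measurable borel" unfolding r_def by measurable
  define v where "v t = of_real (r t) * ?g t" for t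
  define u where "u t = of_real (1 / r t) * F t" for t
  have r_low: "AE t in lborel. t \<in> TT \<longrightarrow> sqrt ?\<delta> \<le> r t"
    using \<delta>(2) by eventually_elim (simp add: r_def)
  have v: "L2T v"
  proof (rule L2T_bound_AE(1)[OF _ g, of _ "sqrt W"])
    show "(\<lambda>t. indicator TT t * v t) \<in> borel_measurable borel" unfolding v_def by measurable
    show "AE t in lborel. t \<in> TT \<longrightarrow> cmod (v t) \<le> sqrt W * cmod (?g t)"
      using amalgam_AE_bounded[OF W] by eventually_elim (auto simp: v_def r_def norm_mult intro!: mult_right_mono)
  qed (simp add: W)
  have u: "L2T u"
  proof (rule L2T_bound_AE(1)[OF _ F, of _ "1 / sqrt ?\<delta>"])
    have "(\<lambda>t. indicator TT t * u t) = (\<lambda>t. of_real (1 / r t) * (indicator TT t * F t))"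
      by (simp add: u_def mult_ac)
    also have "\<dots> \<in> borel_measurable borel" by measurable
    finally show "(\<lambda>t. indicator TT t * u t) \<in> borel_measurable borel" .
    show "AE t in lborel. t \<in> TT \<longrightarrow> cmod (u t) \<le> 1 / sqrt ?\<delta> * cmod (F t)"
      using r_low
    proof eventually_elim
      case (elim t)
      show ?case
      proof
        assume "t \<in> TT"
        then have "sqrt ?\<delta> \<le> r t" "0 < r t"
          using elim \<delta>(1) less_le_trans[of 0 "sqrt ?\<delta>" "r t"] by auto
        then have "1 / r t \<le> 1 / sqrt ?\<delta>"
          using \<delta>(1) by (intro divide_left_mono) auto
        then show "cmod (u t) \<le> 1 / sqrt ?\<delta> * cmod (F t)"
          using \<open>0 < r t\<close> unfolding u_def norm_mult norm_of_real by (intro mult_right_mono) auto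
      qed
    qed
  qed (use \<delta>(1) in simp)
  have "(normT v)\<^sup>2 \<le> normT u * normT v"
  proof -
    have "(normT v)\<^sup>2 = (LINT t|lborel. (cmod (indicator TT t * v t))\<^sup>2)"
      by (simp add: normT_eq_normR normR_square)
    \<comment> \<open>Since \<open>\<Phi>\<close> is nonnegative almost everywhere, the contribution
      from outside \<open>TT\<close> can only increase the integral.\<close>
    also have "\<dots> \<le> (LINT \<xi>|lborel. Re (\<Phi> \<xi> * (?g \<xi> * cnj (?g \<xi>))))"
    proof (rule integral_mono_AE)
      show "integrable lborel (\<lambda>t. (cmod (indicator TT t * v t))\<^sup>2)"
        using v by (simp add: L2T_iff_L2R L2R_def)
      show "integrable lborel (\<lambda>\<xi>. Re (\<Phi> \<xi> * (?g \<xi> * cnj (?g \<xi>))))"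
        by (intro integrable_Re integral_amalgam(1)[OF Phi_meas amal_synth amal_cnj[OF amal_synth] W])
      show "AE t in lborel. (cmod (indicator TT t * v t))\<^sup>2 \<le> Re (\<Phi> t * (?g t * cnj (?g t)))"
        using Phi_nonneg
      proof eventually_elim
        case (elim t)
        have "\<Phi> t * (?g t * cnj (?g t)) = of_real (cmod (\<Phi> t) * (cmod (?g t))\<^sup>2)"
          using elim by (metis complex_norm_square of_real_mult)
        then have "Re (\<Phi> t * (?g t * cnj (?g t))) = cmod (\<Phi> t) * (cmod (?g t))\<^sup>2"
          by simp
        then show ?case
          by (auto simp: v_def r_def norm_mult power_mult_distrib split: split_indicator)
      qed
    qed
    also have "\<dots> = Re (ipT F (\<lambda>t. cnj (?g t)))"
      unfolding energy_identity[OF assms, symmetric]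
      by (rule integral_Re[OF integral_amalgam(1)[OF Phi_meas amal_synth amal_cnj[OF amal_synth] W]])
    also have "ipT F (\<lambda>t. cnj (?g t)) = ipT u (\<lambda>t. cnj (v t))"
      unfolding ipT_def
    proof (rule integral_cong_AE)
      show "(\<lambda>t. indicator TT t * (F t * cnj (?g t))) \<in> borel_measurable lborel"
        "(\<lambda>t. indicator TT t * (u t * cnj (v t))) \<in> borel_measurable lborel"
        using L2T_mult_integrable[OF F L2T_cnj[OF g]] L2T_mult_integrable[OF u L2T_cnj[OF v]] by auto
      show "AE t in lborel. indicator TT t * (F t * cnj (?g t)) = indicator TT t * (u t * cnj (v t))"
        using r_low
      proof eventually_elim
        case (elim t)
        have "u t * cnj (v t) = F t * cnj (?g t)" if "t \<in> TT"
        proof -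
          have "r t \<noteq> 0" using elim that \<delta>(1) less_le_trans[of 0 "sqrt ?\<delta>" "r t"] by auto
          then show ?thesis by (simp add: u_def v_def)
        qed
        then show ?case by (simp split: split_indicator)
      qed
    qed
    also have "Re (ipT u (\<lambda>t. cnj (v t))) \<le> cmod (ipT u (\<lambda>t. cnj (v t)))"
      by (rule complex_Re_le_cmod)
    also have "\<dots> \<le> normT u * normT v"
      using norm_ipT_le[OF u L2T_cnj[OF v]] by simp
    finally show ?thesis .
  qed
  then have vu: "normT v \<le> normT u"
    using normT_nonneg[of v] normT_nonneg[of u] by (cases "normT v = 0") (auto simp: power2_eq_square)
  \<comment> \<open>Returning from \<open>v\<close> to the series costs
    \<open>1 / sqrt (delta \<Phi>)\<close>. After multiplication by \<open>delta \<Phi>\<close> a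
    factor \<open>sqrt (delta \<Phi>)\<close> is left for \<open>u\<close>, which produces the
    square root of the regularity weight.\<close>
  have "normT ?g \<le> 1 / sqrt ?\<delta> * normT v"
  proof (rule L2T_bound_AE(2)[OF _ v])
    show "AE t in lborel. t \<in> TT \<longrightarrow> cmod (?g t) \<le> 1 / sqrt ?\<delta> * cmod (v t)"
      using r_low
    proof eventually_elim
      case (elim t)
      show ?case
      proof
        assume "t \<in> TT"
        then have "sqrt ?\<delta> * cmod (?g t) \<le> r t * cmod (?g t)"
          using elim by (intro mult_right_mono) auto
        also have "r t * cmod (?g t) = cmod (v t)"
          by (simp add: v_def norm_mult r_def)
        finally show "cmod (?g t) \<le> 1 / sqrt ?\<delta> * cmod (v t)"
          using \<delta>(1) by (simp add: field_simps)
      qed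
    qed
  qed (use \<delta>(1) in auto)
  then have "?\<delta> * normT ?g \<le> ?\<delta> * (1 / sqrt ?\<delta> * normT u)"
    using \<delta>(1) vu by (intro mult_left_mono order_trans[OF _ mult_left_mono[OF vu]]) auto
  also have "?\<delta> * (1 / sqrt ?\<delta> * normT u) = sqrt ?\<delta> * normT u"
    using \<delta>(1) by (simp add: field_simps)
  also have "\<dots> = normT (\<lambda>t. of_real (sqrt ?\<delta>) * u t)"
    using \<delta>(1) by (simp add: normT_cmult)
  also have "(\<lambda>t. of_real (sqrt ?\<delta>) * u t) = (\<lambda>t. of_real (sqrt (cmod (of_real ?\<delta> / \<Phi> t))) * F t)"
    using \<delta>(1) by (simp add: u_def r_def norm_divide real_sqrt_divide)
  finally have "?\<delta> * normT ?g \<le> normT (\<lambda>t. of_real (sqrt (cmod (of_real ?\<delta> / \<Phi> t))) * F t)" .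
  moreover have "?\<delta> * norm a \<le> C * (?\<delta> * normT ?g)"
    using norm_le_synth[of a] \<delta>(1) by (simp add: mult.left_commute mult_left_mono)
  ultimately show ?thesis
    using C by (auto intro: order_trans mult_left_mono)
qed

text \<open>The error has transform \<open>R\<close> on \<open>TT\<close> and
  \<open>\<Phi>0 * synth a\<close> outside. The outer part is at most
  \<open>B * W0 * norm a\<close>. The moments of \<open>R\<close> are bounded by
  \<open>B\<^sup>2 * W0 * norm a\<close>, so \<open>R\<close> itself by \<open>C\<close> times that;
  this gives the factor \<open>C * B\<^sup>2 + B\<close>. As \<open>W0\<close> contains
  \<open>delta \<Phi>\<close>, the coefficient bound finishes.\<close>

lemma interp_error:
  assumes F: "L2T F"
  defines "E \<equiv> (C * B\<^sup>2 + B) * enn2real (Cconst \<Phi>) * (C * normT (\<lambda>t. of_real (sqrt (cmod (of_real (delta \<Phi>) / \<Phi> t))) * F t))"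
  shows "normR (\<lambda>t. interp \<phi> y (band F) t - band F t) \<le> E" "cmod (interp \<phi> y (band F) t - band F t) \<le> E"
proof -
  obtain a where interp: "interp \<phi> y (band F) = ift (\<lambda>\<xi>. \<Phi> \<xi> * synth a \<xi>)"
    and a: "\<And>k. (LINT \<xi>|lborel. \<Phi> \<xi> * (synth a \<xi> * cis (y k * \<xi>))) = ipT F (\<lambda>t. cis (y k * t))"
    using interp_eq_ift[OF F] by metis
  let ?g = "synth a"
  note [measurable] = synth(1)
  define W0 where "W0 = enn2real (Cconst \<Phi>) * delta \<Phi>"
  define \<Phi>0 where "\<Phi>0 \<xi> = (1 - indicator TT \<xi>) * \<Phi> \<xi>" for \<xi>
  have \<Phi>0 [measurable]: "\<Phi>0 \<in> borel_measurable borel"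
    unfolding \<Phi>0_def by measurable
  have W0: "wiener_norm \<Phi>0 \<le> ennreal W0" "0 \<le> W0"
    using wiener_norm_outside[OF Phi_A2] A2_D(2)[OF Phi_A2] by (simp_all add: \<Phi>0_def[abs_def] W0_def)
  note outer = integral_amalgam[OF \<Phi>0 _ _ W0]
  note outer_g = amalgam_integrable[OF \<Phi>0 amal_synth[of a] W0] amalgam_L2R[OF \<Phi>0 amal_synth[of a] W0]
  note H = Phi_amalgam(1,3)[OF amal_synth[of a]]
  define R where "R t = \<Phi> t * ?g t - F t" for t
  have \<Phi>g: "L2T (\<lambda>t. \<Phi> t * ?g t)" by (rule L2R_imp_L2T[OF H(2)])
  have R: "L2T R" unfolding R_def by (intro L2T_diff \<Phi>g F)
  \<comment> \<open>The moment equations are split at the boundary of \<open>TT\<close>: what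
    \<open>\<Phi> * synth a\<close> misses of \<open>F\<close> inside is compensated, in every
    moment, by the part outside.\<close>
  have coef: "ipT R (\<lambda>t. cis (y k * t)) = - (LINT \<xi>|lborel. \<Phi>0 \<xi> * (?g \<xi> * cis (y k * \<xi>)))" for k
  proof -
    have "ipT (\<lambda>t. \<Phi> t * ?g t) (\<lambda>t. cis (y k * t)) + (LINT \<xi>|lborel. \<Phi>0 \<xi> * (?g \<xi> * cis (y k * \<xi>))) =
      (LINT \<xi>|lborel. indicator TT \<xi> * (\<Phi> \<xi> * ?g \<xi> * cis (y k * \<xi>)) + \<Phi>0 \<xi> * (?g \<xi> * cis (y k * \<xi>)))"
      unfolding ipT_def
      by (rule Bochner_Integration.integral_add[symmetric]) (intro L2T_mult_integrable \<Phi>g L2T_cis outer(1)[OF amal_synth amal_cis])+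
    also have "\<dots> = ipT F (\<lambda>t. cis (y k * t))"
      unfolding a[symmetric] by (intro Bochner_Integration.integral_cong) (auto simp: \<Phi>0_def split: split_indicator)
    finally show ?thesis
      using ipT_diff_left[OF \<Phi>g F L2T_cis(1), of "y k"] unfolding R_def
      by (metis add_diff_cancel_left' minus_diff_eq)
  qed
  have "norm (fin K (\<lambda>k. ipT R (\<lambda>t. cis (y k * t)))) \<le> W0 * (B * norm a) * B" if K: "finite K" for K
  proof -
    define c where "c k = ipT R (\<lambda>t. cis (y k * t))" for k
    have "of_real ((norm (fin K c))\<^sup>2) = (\<Sum>k\<in>K. cnj (c k) * c k)"
      unfolding norm_fin[OF K] by (simp add: complex_norm_square mult.commute del: of_real_power)
    also have "\<dots> = - (\<Sum>k\<in>K. cnj (c k) * (LINT \<xi>|lborel. \<Phi>0 \<xi> * (?g \<xi> * cis (y k * \<xi>))))"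
      unfolding sum_negf[symmetric] by (intro sum.cong) (simp_all add: c_def coef)
    also have "(\<Sum>k\<in>K. cnj (c k) * (LINT \<xi>|lborel. \<Phi>0 \<xi> * (?g \<xi> * cis (y k * \<xi>)))) =
        (LINT \<xi>|lborel. (\<Sum>k\<in>K. cnj (c k) * (\<Phi>0 \<xi> * (?g \<xi> * cis (y k * \<xi>)))))"
      using outer(1)[OF amal_synth amal_cis] by simp
    also have "\<dots> = (LINT \<xi>|lborel. \<Phi>0 \<xi> * (?g \<xi> * cnj (tp y K c \<xi>)))"
      by (simp add: cnj_tp sum_distrib_left mult_ac)
    finally have "(norm (fin K c))\<^sup>2 = cmod (LINT \<xi>|lborel. \<Phi>0 \<xi> * (?g \<xi> * cnj (tp y K c \<xi>)))"
      by (metis abs_of_nonneg norm_minus_cancel norm_of_real zero_le_power2)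
    also have "\<dots> \<le> W0 * (B * norm a * (B * norm (fin K c)))"
      by (rule outer(2)[OF amal_synth amal_cnj[OF amal_tp[OF K]]])
    finally have "norm (fin K c) * norm (fin K c) \<le> (W0 * (B * norm a) * B) * norm (fin K c)"
      by (simp add: power2_eq_square mult_ac)
    moreover have "0 \<le> W0 * (B * norm a) * B"
      using W0(2) B by simp
    ultimately have "norm (fin K c) \<le> W0 * (B * norm a) * B"
      by (cases "norm (fin K c) = 0") auto
    then show ?thesis by (simp add: c_def[abs_def])
  qed
  then have normT_R: "normT R \<le> C * (W0 * (B * norm a) * B)"
    using W0(2) B by (intro normT_le_coef R) auto
  let ?D = "\<lambda>\<xi>. indicator TT \<xi> * R \<xi> + \<Phi>0 \<xi> * ?g \<xi>"
  have D: "integrable lborel ?D" "L2R ?D"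
    using integrable_L2T[OF R] R outer_g by (auto simp: L2T_iff_L2R)
  have diff: "interp \<phi> y (band F) t - band F t = ift ?D t" for t
  proof -
    have "?D = (\<lambda>\<xi>. \<Phi> \<xi> * ?g \<xi> - indicator TT \<xi> * F \<xi>)"
      by (auto simp: R_def \<Phi>0_def split: split_indicator)
    then show ?thesis
      using ift_diff[OF H(1) integrable_L2T[OF F]] unfolding interp by (simp add: band_def)
  qed
  define E' where "E' = C * (W0 * (B * norm a) * B) + W0 * (B * norm a)"
  have "E' = (C * B\<^sup>2 + B) * enn2real (Cconst \<Phi>) * (delta \<Phi> * norm a)"
    by (simp add: E'_def W0_def power2_eq_square algebra_simps)
  also have "\<dots> \<le> E"
    unfolding E_def using C B by (intro mult_left_mono coefficient_bound F a) auto
  finally have E': "E' \<le> E" .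
  have "normR ?D \<le> normT R + W0 * (B * norm a)"
    using normR_triangle[of "\<lambda>\<xi>. indicator TT \<xi> * R \<xi>" "\<lambda>\<xi>. \<Phi>0 \<xi> * ?g \<xi>"] R outer_g(3,4)
    by (simp add: L2T_iff_L2R normT_eq_normR)
  then have "normR (ift ?D) \<le> E"
    using normR_ift_le[OF D] normT_R E' unfolding E'_def by linarith
  then show "normR (\<lambda>t. interp \<phi> y (band F) t - band F t) \<le> E"
    unfolding diff .
  \<comment> \<open>Passing from L2 to L1 on a block costs \<open>sqrt (2 * pi)\<close>, the norm of
    the constant 1 on \<open>TT\<close>, which the factor in \<open>ift\<close> cancels. Hence the
    uniform error obeys the same bound.\<close>
  have "(LINT \<xi>|lborel. cmod (?D \<xi>)) \<le> (LINT \<xi>|lborel. cmod (indicator TT \<xi> * R \<xi>) + cmod (\<Phi>0 \<xi> * ?g \<xi>))"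
    using D(1) integrable_L2T[OF R] outer_g(1) by (intro integral_mono integrable_norm Bochner_Integration.integrable_add norm_triangle_ineq)
  also have "\<dots> = (LINT \<xi>|lborel. cmod (indicator TT \<xi> * R \<xi>)) + (LINT \<xi>|lborel. cmod (\<Phi>0 \<xi> * ?g \<xi>))"
    using integrable_L2T[OF R] outer_g(1) by (intro Bochner_Integration.integral_add integrable_norm)
  also have "\<dots> \<le> normT R * sqrt (2 * pi) + W0 * (B * norm a * sqrt (2 * pi))"
    by (intro add_mono integral_norm_le_normT R outer_g(2))
  also have "\<dots> = (normT R + W0 * (B * norm a)) * sqrt (2 * pi)"
    by (simp add: algebra_simps)
  finally have "1 / sqrt (2 * pi) * (LINT \<xi>|lborel. cmod (?D \<xi>)) \<le> normT R + W0 * (B * norm a)"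
    by (simp add: divide_le_eq)
  then show "cmod (interp \<phi> y (band F) t - band F t) \<le> E"
    using norm_ift_le[of ?D t] normT_R E' unfolding E'_def diff by linarith
qed

end

text \<open>Cutting a transform off to the outside of the band is a contraction that annihilates the
  transform of every finite combination of translates of \<psi>. Approximability by such
  combinations leaves nothing outside the band.\<close>

lemma Vspace_subset_PW:
  assumes \<psi>: "continuous_on UNIV \<psi>" "fourier_rel \<psi> \<Psi>" "A2 \<Psi>"
    and band: "AE \<xi> in lborel. \<xi> \<notin> {-pi..pi} \<longrightarrow> \<Psi> \<xi> = 0"
  shows "Vspace \<psi> x \<subseteq> PW"
proof
  fix f assume "f \<in> Vspace \<psi> x"
  then have f: "continuous_on UNIV f" "L2R f"
    and approx: "\<And>e. 0 < e \<Longrightarrow> \<exists>F c. finite F \<and> normR (\<lambda>t. f t - (\<Sum>j\<in>F. c j * \<psi> (t - x j))) < e"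
    by (auto simp: Vspace_def)
  note \<Psi>L = fourier_rel_L2R(2)[OF \<psi>(2)]
  note \<Psi>m [measurable] = L2R_measurable[OF \<Psi>L]
  have \<Psi>_int: "integrable lborel \<Psi>"
    using amalgam_integrable(1)[OF \<Psi>m amal_one, of "enn2real (wiener_norm \<Psi>)"] A2_D(4)[OF \<psi>(3)]
    by (simp add: infinity_ennreal_def)
  have \<psi>_eq: "\<psi> = ift \<Psi>"
    by (rule fourier_inversion[OF \<psi>(2) \<Psi>_int \<psi>(1)])
  obtain S where S: "fourier_rel f S"
    using fourier_rel_exists[OF f(2)] .
  note SL = fourier_rel_L2R(2)[OF S]
  let ?o = "\<lambda>\<xi>. (1 - indicator {-pi..pi} \<xi>) * S \<xi>"
  have oL: "L2R ?o"
    by (rule L2R_mult_bounded(1)[OF _ SL, of _ 1]) (auto split: split_indicator)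
  have "normR ?o \<le> e" if "0 < e" for e
  proof -
    obtain F c where Fc: "finite F" "normR (\<lambda>t. f t - (\<Sum>j\<in>F. c j * \<psi> (t - x j))) < e"
      using approx[OF \<open>0 < e\<close>] by blast
    let ?P = "\<lambda>\<xi>. \<Psi> \<xi> * tp x F c \<xi>"
    have P: "integrable lborel ?P" "L2R ?P"
      using integrable_mult_bounded[where g="tp x F c", OF \<Psi>_int _ norm_tp_le] L2R_mult_bounded(1)[where g="tp x F c", OF _ \<Psi>L norm_tp_le]
      by (simp_all add: mult.commute)
    have eq: "ift ?P t = (\<Sum>j\<in>F. c j * \<psi> (t - x j))" for t
      by (simp add: ift_mult_tp[OF \<Psi>_int] \<psi>_eq)
    have "normR ?o \<le> 1 * normR (\<lambda>\<xi>. S \<xi> - ?P \<xi>)"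
    proof (rule L2R_bound_AE(2))
      show "AE \<xi> in lborel. cmod (?o \<xi>) \<le> 1 * cmod (S \<xi> - ?P \<xi>)"
        using band by eventually_elim (auto split: split_indicator)
    qed (use oL SL P in auto)
    also have "\<dots> \<le> normR (\<lambda>t. f t - ift ?P t)"
      using fourier_rel_normR_le[OF fourier_rel_diff[OF S fourier_rel_ift[OF P]]] by simp
    finally show ?thesis
      using Fc(2) by (simp add: eq)
  qed
  then have "normR ?o \<le> 0"
    by (rule field_le_epsilon) simp
  then have "normR ?o = 0"
    using normR_nonneg[of ?o] by linarith
  from normR_eq_0_AE[OF oL this]
  have "AE \<xi> in lborel. \<xi> \<notin> {-pi..pi} \<longrightarrow> S \<xi> = 0"
    by eventually_elim (auto split: split_indicator_asm)
  then show "f \<in> PW"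
    using f S by (auto simp: PW_def)
qed

lemma interpolation_converges:
  assumes "CIS y" and reg: "regular_interpolators A \<phi> \<Phi>" and "f \<in> PW"
  shows "((\<lambda>\<alpha>. normR (\<lambda>t. interp (\<phi> \<alpha>) y f t - f t)) \<longlongrightarrow> 0) (alpha_filter A)"
    "uniform_limit UNIV (\<lambda>\<alpha>. interp (\<phi> \<alpha>) y f) f (alpha_filter A)"
proof -
  obtain C B where "riesz y C B" using CIS_riesz[OF assms(1)] .
  then interpret riesz y C B .
  obtain M where M: "0 \<le> M" "\<And>\<alpha>. \<alpha> \<in> A \<Longrightarrow> Cconst (\<Phi> \<alpha>) \<le> ennreal M"
    using regular_interpolators_Cconst[OF reg] by blast
  obtain F where F: "L2T F" "f = band F"
    using assms(3) by (auto simp: PW_iff_band)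
  note D = regular_interpolators_D[OF reg]
  \<comment> \<open>The square root of the regularity weight inherits its bound 1 on
    \<open>TT\<close> and its limit 0, the two requirements for dominated convergence.\<close>
  define w where "w \<alpha> t = complex_of_real (sqrt (cmod (of_real (delta (\<Phi> \<alpha>)) / \<Phi> \<alpha> t)))" for \<alpha> t
  have w: "((\<lambda>\<alpha>. normT (\<lambda>t. w \<alpha> t * F t)) \<longlongrightarrow> 0) (alpha_filter A)"
  proof (rule normT_mult_tendsto_zero[OF _ _ _ F(1)])
    fix \<alpha> assume \<alpha>: "\<alpha> \<in> A"
    note [measurable] = A2_D(1)[OF D(4)[OF \<alpha>]]
    show "w \<alpha> \<in> borel_measurable borel" unfolding w_def by measurable
    show "AE t in lborel. t \<in> TT \<longrightarrow> cmod (w \<alpha> t) \<le> 1"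
      using A2_ratio_le_1[OF D(4)[OF \<alpha>]] by eventually_elim (simp add: w_def)
  next
    have "AE t in lborel. t \<in> TT \<longrightarrow> ((\<lambda>\<alpha>. complex_of_real (delta (\<Phi> \<alpha>)) / \<Phi> \<alpha> t) \<longlongrightarrow> 0) (alpha_filter A)"
      using reg by (simp add: regular_interpolators_def)
    then show "AE t in lborel. t \<in> TT \<longrightarrow> ((\<lambda>\<alpha>. w \<alpha> t) \<longlongrightarrow> 0) (alpha_filter A)"
    proof eventually_elim
      case (elim t)
      show ?case
      proof
        assume "t \<in> TT"
        then have "((\<lambda>\<alpha>. w \<alpha> t) \<longlongrightarrow> of_real (sqrt (cmod 0))) (alpha_filter A)"
          unfolding w_def using elim by (intro tendsto_of_real tendsto_real_sqrt tendsto_norm) auto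
        then show "((\<lambda>\<alpha>. w \<alpha> t) \<longlongrightarrow> 0) (alpha_filter A)" by simp
      qed
    qed
  qed
  define E where "E \<alpha> = (C * B\<^sup>2 + B) * M * (C * normT (\<lambda>t. w \<alpha> t * F t))" for \<alpha>
  have "(E \<longlongrightarrow> (C * B\<^sup>2 + B) * M * (C * 0)) (alpha_filter A)"
    unfolding E_def by (intro tendsto_intros w)
  then have E: "(E \<longlongrightarrow> 0) (alpha_filter A)" by simp
  have err: "normR (\<lambda>t. interp (\<phi> \<alpha>) y f t - f t) \<le> E \<alpha>" "cmod (interp (\<phi> \<alpha>) y f t - f t) \<le> E \<alpha>" if "\<alpha> \<in> A" for \<alpha> t
  proof -
    interpret interpolator y C B "\<phi> \<alpha>" "\<Phi> \<alpha>"
      using D[OF that] by unfold_locales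
    have "enn2real (Cconst (\<Phi> \<alpha>)) \<le> M"
      using M(2)[OF that] M(1) by (simp add: enn2real_leI)
    then have "(C * B\<^sup>2 + B) * enn2real (Cconst (\<Phi> \<alpha>)) * (C * normT (\<lambda>t. w \<alpha> t * F t)) \<le> E \<alpha>"
      unfolding E_def using C B by (intro mult_right_mono mult_left_mono) auto
    then show "normR (\<lambda>t. interp (\<phi> \<alpha>) y f t - f t) \<le> E \<alpha>" "cmod (interp (\<phi> \<alpha>) y f t - f t) \<le> E \<alpha>"
      using interp_error[OF F(1)] unfolding F(2) w_def by (auto intro: order_trans)
  qed
  have ev: "\<forall>\<^sub>F \<alpha> in alpha_filter A. \<alpha> \<in> A"
    by (simp add: alpha_filter_def eventually_inf_principal)
  show "((\<lambda>\<alpha>. normR (\<lambda>t. interp (\<phi> \<alpha>) y f t - f t)) \<longlongrightarrow> 0) (alpha_filter A)"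
  proof (rule tendsto_sandwich[OF _ _ tendsto_const E])
    show "\<forall>\<^sub>F \<alpha> in alpha_filter A. normR (\<lambda>t. interp (\<phi> \<alpha>) y f t - f t) \<le> E \<alpha>"
      using ev by eventually_elim (rule err(1))
  qed simp
  show "uniform_limit UNIV (\<lambda>\<alpha>. interp (\<phi> \<alpha>) y f) f (alpha_filter A)"
    unfolding uniform_limit_iff
  proof (intro allI impI)
    fix e :: real assume "0 < e"
    have "\<forall>\<^sub>F \<alpha> in alpha_filter A. E \<alpha> < e"
      using order_tendstoD(2)[OF E \<open>0 < e\<close>] .
    then show "\<forall>\<^sub>F \<alpha> in alpha_filter A. \<forall>t\<in>UNIV. dist (interp (\<phi> \<alpha>) y f t) (f t) < e"
      using ev by eventually_elim (auto simp: dist_norm intro: le_less_trans[OF err(2)])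
  qed
qed

theorem theorem5:
  fixes x y :: "int \<Rightarrow> real" and A :: "real set"
    and \<phi> \<Phi> :: "real \<Rightarrow> real \<Rightarrow> complex" and \<psi> \<Psi> :: "real \<Rightarrow> complex"
  assumes "CIS x" and "CIS y"
    and "regular_interpolators A \<phi> \<Phi>"
    and "continuous_on UNIV \<psi>" and "fourier_rel \<psi> \<Psi>" and "A1 \<psi>" and "A2 \<Psi>"
    and "ess_supp \<Psi> = {-pi..pi}"
  shows "B1 A \<phi> \<Phi> \<and> B2 A \<Phi> \<and> B3 A \<Phi> \<Psi> x \<and> B4 A \<Phi> \<Psi> x y \<and>
    (\<forall>f\<in>Vspace \<psi> x.
       ((\<lambda>\<alpha>. normR (\<lambda>t. interp (\<phi> \<alpha>) y f t - f t)) \<longlongrightarrow> 0) (alpha_filter A) \<and>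
       uniform_limit UNIV (\<lambda>\<alpha>. interp (\<phi> \<alpha>) y f) f (alpha_filter A))"
proof -
  have band: "AE \<xi> in lborel. \<xi> \<notin> {-pi..pi} \<longrightarrow> \<Psi> \<xi> = 0"
    by (rule AE_zero_outside_ess_supp) (simp add: assms(8))
  have "B1 A \<phi> \<Phi>" "B2 A \<Phi>"
    using assms(3) by (simp_all add: regular_interpolators_def)
  moreover have "B3 A \<Phi> \<Psi> x"
    by (rule B3_if_band_limited[OF band])
  moreover have "B4 A \<Phi> \<Psi> x y"
    by (rule B4_if_band_limited[OF assms(1-3,7) band])
  moreover have "Vspace \<psi> x \<subseteq> PW"
    by (rule Vspace_subset_PW[OF assms(4,5,7) band])
  ultimately show ?thesis
    using interpolation_converges[OF assms(2,3)] by blast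
qed

end
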